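(* Let $k$ be a field and let $I\subseteq k[x_1,\dots,x_n,y]$ be a nonzero monomial ideal with generators in the variables $x_1,\dots,x_n$. Suppose that there exists another field $k'$ such that $\mathrm{reg}_k(I)\ne \mathrm{reg}_{k'}(I)$. Then there exists $c\in\mathbb{N}$ such that $\mathrm{reg}_k\big((I+(y^c))^h\big)\neq \mathrm{reg}_{k'}\big((I+(y^c))^h\big)$ for all sufficiently large integers $h$.
   Context: A monomial ideal $I$ has a unique minimal system $G(I)$ of monic monomial generators, which makes sense over every coefficient field; for a field $k$, invariants with sub- or superscript $k$ are those of the ideal generated by $G(I)$ in the polynomial ring over $k$ in the same variables. "With generators in the variables $x_1,\dots,x_n$" means that all elements of $G(I)$ are monomials in $x_1,\dots,x_n$ only. The polynomial ring $R$ over $k$ is standard graded, $\beta_{i,j}^k(I)=\dim_k\mathrm{Tor}_i^R(I,k)_j$ are the graded Betti numbers, and the Castelnuovo-Mumford regularity is $\mathrm{reg}_k(I)=\max\{j-i:\beta_{i,j}^k(I)\neq 0\}$. *)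

theory Defs
  imports "HOL-Library.Poly_Mapping" "HOL-Library.Extended_Nat"
begin

section \<open>Dimension of a quotient space\<close>

text \<open>
  For subspaces \<open>W \<subseteq> V\<close>, the dimension of \<open>V / W\<close>: the largest number of vectors of \<open>V\<close> whose
  cosets modulo \<open>W\<close> are linearly independent (distinct vectors then have distinct cosets), and
  \<open>\<infinity>\<close> if there is no such largest number.
\<close>

definition (in vector_space) quotient_dim :: "'b set \<Rightarrow> 'b set \<Rightarrow> enat" where
  "quotient_dim V W =
     (SUP B \<in> {B. finite B \<and> B \<subseteq> V \<and> independent B \<and> span B \<inter> W = {0}}. enat (card B))"


section \<open>Polynomials and monomial ideals\<close>

text \<open>
  Exponent vectors over a finite type \<open>'v\<close> of variables are finitely supported functions
  \<open>'v \<Rightarrow>\<^sub>0 nat\<close>; polynomials are finitely supported functions from these to the coefficient field,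
  with the convolution product of \<open>HOL-Library.Poly_Mapping\<close>.
\<close>

type_synonym ('v, 'k) mpoly = "('v \<Rightarrow>\<^sub>0 nat) \<Rightarrow>\<^sub>0 'k"

definition monom :: "('v \<Rightarrow>\<^sub>0 nat) \<Rightarrow> ('v, 'k::field) mpoly" where
  "monom t = Poly_Mapping.single t 1"

definition const :: "'k::field \<Rightarrow> ('v, 'k) mpoly" where
  "const c = Poly_Mapping.single 0 c"

definition var :: "'v \<Rightarrow> ('v, 'k::field) mpoly" where
  "var v = monom (Poly_Mapping.single v 1)"

definition mdeg :: "('v::finite \<Rightarrow>\<^sub>0 nat) \<Rightarrow> nat" where
  "mdeg t = (\<Sum>v\<in>UNIV. Poly_Mapping.lookup t v)"

definition homogeneous :: "int \<Rightarrow> ('v::finite, 'k::field) mpoly \<Rightarrow> bool" where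
  "homogeneous j p \<longleftrightarrow> (\<forall>t\<in>Poly_Mapping.keys p. int (mdeg t) = j)"

definition ideal :: "('v, 'k::field) mpoly set \<Rightarrow> ('v, 'k) mpoly set" where
  "ideal = module.span (*)"

lemma module_mpoly: "module ((*) :: ('v, 'k::field) mpoly \<Rightarrow> _)"
  by unfold_locales (simp_all add: algebra_simps)

definition ideal_add ::
    "('v, 'k::field) mpoly set \<Rightarrow> ('v, 'k) mpoly set \<Rightarrow> ('v, 'k) mpoly set" where
  "ideal_add I J = {a + b | a b. a \<in> I \<and> b \<in> J}"

definition ideal_mult ::
    "('v, 'k::field) mpoly set \<Rightarrow> ('v, 'k) mpoly set \<Rightarrow> ('v, 'k) mpoly set" where
  "ideal_mult I J = ideal {a * b | a b. a \<in> I \<and> b \<in> J}"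

primrec ideal_power :: "('v, 'k::field) mpoly set \<Rightarrow> nat \<Rightarrow> ('v, 'k) mpoly set" where
  "ideal_power I 0 = UNIV"
| "ideal_power I (Suc h) = ideal_mult I (ideal_power I h)"

definition monomial_ideal :: "('v, 'k::field) mpoly set \<Rightarrow> bool" where
  "monomial_ideal I \<longleftrightarrow> (\<exists>T. I = ideal (monom ` T))"

text \<open>
  The minimal monomial generating system \<open>G(I)\<close>, given by its exponent vectors, so that it does
  not refer to the coefficient field any more.
\<close>

definition min_gens :: "('v, 'k::field) mpoly set \<Rightarrow> ('v \<Rightarrow>\<^sub>0 nat) set" where
  "min_gens I =
     (THE T. ideal (monom ` T) = I \<and> (\<forall>S. S \<subset> T \<longrightarrow> ideal (monom ` S) \<noteq> I))"

text \<open>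
  The ideal generated by \<open>G(I)\<close> over another coefficient field \<open>'l\<close>, which is fixed by the
  expected result type.
\<close>

definition change_field :: "('v, 'k::field) mpoly set \<Rightarrow> ('v, 'l::field) mpoly set" where
  "change_field I = ideal (monom ` min_gens I)"


section \<open>Graded free resolutions\<close>

text \<open>
  Let \<open>R = ('v, 'k) mpoly\<close>. All free modules live in the type \<open>nat \<Rightarrow>\<^sub>0 R\<close>: the free module
  with basis indexed by \<open>B \<subseteq> nat\<close> consists of the elements supported in \<open>B\<close>.
\<close>

definition rscale ::
    "('v, 'k::field) mpoly \<Rightarrow> (nat \<Rightarrow>\<^sub>0 ('v, 'k) mpoly) \<Rightarrow> (nat \<Rightarrow>\<^sub>0 ('v, 'k) mpoly)" where
  "rscale r f = Poly_Mapping.map ((*) r) f"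

definition kscale ::
    "'k::field \<Rightarrow> (nat \<Rightarrow>\<^sub>0 ('v, 'k) mpoly) \<Rightarrow> (nat \<Rightarrow>\<^sub>0 ('v, 'k) mpoly)" where
  "kscale c = rscale (const c)"

lemma lookup_rscale: "Poly_Mapping.lookup (rscale r f) b = r * Poly_Mapping.lookup f b"
  by (simp add: rscale_def Poly_Mapping.map.rep_eq when_def)

lemma module_rscale: "module (rscale :: ('v, 'k::field) mpoly \<Rightarrow> _)"
  by unfold_locales
    (auto intro!: poly_mapping_eqI simp: lookup_rscale lookup_add algebra_simps)

lemma vector_space_kscale: "vector_space (kscale :: 'k::field \<Rightarrow> (nat \<Rightarrow>\<^sub>0 ('v, 'k) mpoly) \<Rightarrow> _)"
proof -
  have add: "(const (a + b) :: ('v, 'k) mpoly) = const a + const b" for a b :: 'k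
    by (simp add: const_def single_add)
  have mult: "(const (a * b) :: ('v, 'k) mpoly) = const a * const b" for a b :: 'k
    by (simp add: const_def mult_single)
  have one: "(const 1 :: ('v, 'k) mpoly) = 1"
    by (simp add: const_def single_one)
  show ?thesis
    by unfold_locales
      (auto intro!: poly_mapping_eqI simp: kscale_def lookup_rscale lookup_add add mult one algebra_simps)
qed

text \<open>
  In homological degree \<open>i\<close> the complex has the free module \<open>F\<^sub>i\<close> on basis elements \<open>e\<^sub>b\<close>,
  \<open>b \<in> basis i\<close>, with \<open>e\<^sub>b\<close> in degree \<open>bdeg i b\<close>. The differential \<open>diff i\<close> goes from
  \<open>F\<^bsub>i+1\<^esub>\<close> to \<open>F\<^sub>i\<close>, and \<open>aug\<close> goes from \<open>F\<^sub>0\<close> to \<open>R\<close>.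
\<close>

record (overloaded) ('v, 'k) free_complex =
  basis :: "nat \<Rightarrow> nat set"
  bdeg :: "nat \<Rightarrow> nat \<Rightarrow> int"
  diff :: "nat \<Rightarrow> (nat \<Rightarrow>\<^sub>0 (('v \<Rightarrow>\<^sub>0 nat) \<Rightarrow>\<^sub>0 'k::field)) \<Rightarrow> (nat \<Rightarrow>\<^sub>0 (('v \<Rightarrow>\<^sub>0 nat) \<Rightarrow>\<^sub>0 'k))"
  aug :: "(nat \<Rightarrow>\<^sub>0 (('v \<Rightarrow>\<^sub>0 nat) \<Rightarrow>\<^sub>0 'k)) \<Rightarrow> (('v \<Rightarrow>\<^sub>0 nat) \<Rightarrow>\<^sub>0 'k)"

definition free_mod ::
    "('v, 'k::field) free_complex \<Rightarrow> nat \<Rightarrow> (nat \<Rightarrow>\<^sub>0 ('v, 'k) mpoly) set" where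
  "free_mod F i = {f. Poly_Mapping.keys f \<subseteq> basis F i}"

definition free_comp ::
    "('v::finite, 'k::field) free_complex \<Rightarrow> nat \<Rightarrow> int \<Rightarrow> (nat \<Rightarrow>\<^sub>0 ('v, 'k) mpoly) set" where
  "free_comp F i j =
     {f \<in> free_mod F i. \<forall>b\<in>basis F i. homogeneous (j - bdeg F i b) (Poly_Mapping.lookup f b)}"

text \<open>
  Linearity is required of the maps on the whole type \<open>nat \<Rightarrow>\<^sub>0 R\<close>. This is no restriction, as
  \<open>F\<^sub>i\<close> is a direct summand; grading and exactness concern \<open>F\<^sub>i\<close> only. A resolution need be neither
  minimal nor of finite rank.
\<close>

definition graded_free_resolution ::
    "('v::finite, 'k::field) mpoly set \<Rightarrow> ('v, 'k) free_complex \<Rightarrow> bool" where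
  "graded_free_resolution I F \<longleftrightarrow>
     module_hom rscale (*) (aug F) \<and>
     (\<forall>i. module_hom rscale rscale (diff F i)) \<and>
     (\<forall>j. \<forall>f\<in>free_comp F 0 j. homogeneous j (aug F f)) \<and>
     (\<forall>i j. diff F i ` free_comp F (Suc i) j \<subseteq> free_comp F i j) \<and>
     aug F ` free_mod F 0 = I \<and>
     diff F 0 ` free_mod F 1 = {f \<in> free_mod F 0. aug F f = 0} \<and>
     (\<forall>i. diff F (Suc i) ` free_mod F (Suc (Suc i)) = {f \<in> free_mod F (Suc i). diff F i f = 0})"


section \<open>Graded Betti numbers and regularity\<close>

text \<open>
  With \<open>\<mm> = (var v | v)\<close> and \<open>k = R / \<mm>\<close>, one has \<open>F\<^sub>i \<otimes>\<^sub>R k = F\<^sub>i / \<mm> F\<^sub>i\<close>. The cycles and boundaries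
  below are the preimages in the degree \<open>j\<close> part of \<open>F\<^sub>i\<close> of those of the complex \<open>F \<otimes>\<^sub>R k\<close>, so
  that their quotient is the degree \<open>j\<close> part of \<open>H\<^sub>i(F \<otimes>\<^sub>R k)\<close>, that is of \<open>Tor\<^sub>i(I, k)\<close>.
\<close>

definition irrelevant_ideal :: "('v, 'k::field) mpoly set" where
  "irrelevant_ideal = ideal (range var)"

definition irrelevant_mult ::
    "('v, 'k::field) free_complex \<Rightarrow> nat \<Rightarrow> (nat \<Rightarrow>\<^sub>0 ('v, 'k) mpoly) set" where
  "irrelevant_mult F i =
     module.span rscale {rscale r f | r f. r \<in> irrelevant_ideal \<and> f \<in> free_mod F i}"

definition tor_cycles ::
    "('v::finite, 'k::field) free_complex \<Rightarrow> nat \<Rightarrow> int \<Rightarrow> (nat \<Rightarrow>\<^sub>0 ('v, 'k) mpoly) set" where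
  "tor_cycles F i j =
     {f \<in> free_comp F i j. \<forall>l. i = Suc l \<longrightarrow> diff F l f \<in> irrelevant_mult F l}"

definition tor_boundaries ::
    "('v::finite, 'k::field) free_complex \<Rightarrow> nat \<Rightarrow> int \<Rightarrow> (nat \<Rightarrow>\<^sub>0 ('v, 'k) mpoly) set" where
  "tor_boundaries F i j =
     {f \<in> free_comp F i j. \<exists>g\<in>free_comp F (Suc i) j. f - diff F i g \<in> irrelevant_mult F i}"

text \<open>Up to isomorphism, Tor does not depend on the chosen resolution.\<close>

definition betti :: "nat \<Rightarrow> int \<Rightarrow> ('v::finite, 'k::field) mpoly set \<Rightarrow> enat" where
  "betti i j I =
     (let F = (SOME F. graded_free_resolution I F)
      in vector_space.quotient_dim kscale (tor_cycles F i j) (tor_boundaries F i j))"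

definition reg :: "('v::finite, 'k::field) mpoly set \<Rightarrow> int" where
  "reg I = Max {j - int i | i j. betti i j I \<noteq> 0}"

end

theory Submission
  imports Defs "HOL-Library.Countable_Set" "HOL-Library.Cardinality"
begin

text \<open>
  Write \<open>J = I + (y\<^sup>c)\<close>. The theorem holds because, for \<open>c\<close> large enough in terms of \<open>G(I)\<close> only and
  for all \<open>h \<ge> 1\<close>, one has \<open>reg J\<^sup>h = reg I + c h - 1\<close> over every coefficient field
  (\<open>Max_reg_set_power\<close>). The case \<open>I = R\<close> is excluded by the hypothesis, as \<open>reg R = 0\<close> over every field.

  The formula is read off from multigraded Betti numbers. Let \<open>U\<close> be the set of exponents of the
  monomials of a monomial ideal. Its Betti number in homological degree \<open>i\<close> and multidegree \<open>\<alpha>\<close>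
  does not vanish if and only if the upper Koszul complex \<open>{\<sigma> \<subseteq> supp \<alpha>. \<alpha> - \<sigma> \<in> U}\<close> has nonzero
  homology on faces of cardinality \<open>i\<close> (\<open>betti_exp_ideal\<close>). If the complex is a cone, this
  homology vanishes (\<open>acyclic_cone\<close>). It is a cone with apex \<open>v \<in> supp \<alpha>\<close> whenever membership of
  \<open>\<alpha> - \<sigma>\<close> in \<open>U\<close> does not depend on whether \<open>v \<in> \<sigma>\<close>, for example if \<open>\<alpha>\<^sub>v\<close> exceeds the \<open>v\<close>-exponents of all
  minimal generators.

  Now \<open>J\<^sup>h\<close> is the sum of the ideals \<open>I\<^sup>i y\<^bsup>c(h-i)\<^esup>\<close>, so that \<open>x\<^sup>t \<in> J\<^sup>h\<close> if and only if \<open>x\<^sup>t \<in> I\<^sup>i\<close> for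
  \<open>i = h - \<lfloor>t\<^sub>y / c\<rfloor>\<close> (or \<open>i = 0\<close> if this is negative). The complex of \<open>J\<^sup>h\<close> in degree \<open>\<alpha>\<close> is a
  cone with apex \<open>y\<close> unless \<open>\<alpha>\<^sub>y\<close> is a multiple of \<open>c\<close> that is at most \<open>c h\<close>. If \<open>\<alpha>\<^sub>y < c h\<close> and the
  homology does not vanish, then the remaining exponents are bounded by those of the generators of a
  power of \<open>I\<close>, and a large \<open>c\<close> forces \<open>|\<alpha>| \<le> c h\<close>. If \<open>\<alpha>\<^sub>y = c h\<close> and another exponent is nonzero,
  then the complex is, up to homology, the suspension of the complex of \<open>I\<close> in the degree of the
  remaining variables (\<open>acyclic_suspension\<close>); this shifts the homological degree by one and
  the total degree by \<open>c h\<close>. As \<open>reg I \<ge> 1\<close>, the maximum is attained in the last case.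

  To reach the Betti numbers, which are defined by an arbitrary graded free resolution, one needs
  such a resolution to exist (\<open>graded_free_resolution_exists\<close>) and \<open>Tor\<close> to be
  computable from the Koszul complex instead (\<open>tor_cycles_subset_iff\<close>). The latter is dimension
  shifting along the resolution, which uses that the Koszul complex of a free module is exact;
  this again is the statement that full simplices are cones.
\<close>

section \<open>Simplicial chains over a field\<close>

text \<open>
  The sign of the vertex \<open>v\<close> in the face \<open>insert v \<sigma>\<close>. The vertices are ordered by an arbitrary
  injection into the natural numbers.
\<close>

definition ksgn :: "'v::finite \<Rightarrow> 'v set \<Rightarrow> 'a::comm_ring_1" where
  "ksgn v \<sigma> = (-1) ^ card {w \<in> \<sigma>. to_nat w < to_nat v}"

text \<open>
  The simplicial boundary in coordinates: a chain \<open>c\<close> assigns a coefficient to every face. The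
  empty face is included, so that homology is reduced; chains are graded by the cardinality of
  faces, which is one more than their dimension.
\<close>

definition bd :: "('v::finite set \<Rightarrow> 'k::field) \<Rightarrow> 'v set \<Rightarrow> 'k" where
  "bd c \<tau> = (\<Sum>v\<in>-\<tau>. ksgn v \<tau> * c (insert v \<tau>))"

text \<open>
  Chains supported on the members of \<open>\<Delta>\<close> of cardinality \<open>p\<close>. The family \<open>\<Delta>\<close> need not be closed
  under taking subsets, and a boundary need not be supported on \<open>\<Delta>\<close> again.
\<close>

definition kchains :: "nat \<Rightarrow> 'v set set \<Rightarrow> ('v set \<Rightarrow> 'k::field) set" where
  "kchains p \<Delta> = {c. \<forall>\<sigma>. c \<sigma> \<noteq> 0 \<longrightarrow> \<sigma> \<in> \<Delta> \<and> card \<sigma> = p}"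

text \<open>
  Every cycle on faces of cardinality \<open>p\<close> is a boundary; for a simplicial complex \<open>\<Delta>\<close> this is
  the vanishing of its reduced homology in dimension \<open>p - 1\<close>.
\<close>

definition acyclic_at :: "'k::field itself \<Rightarrow> nat \<Rightarrow> 'v::finite set set \<Rightarrow> bool" where
  "acyclic_at _ p \<Delta> \<longleftrightarrow>
     (\<forall>c \<in> kchains p \<Delta>. bd c = (\<lambda>_. 0) \<longrightarrow>
        (\<exists>e \<in> kchains (Suc p) \<Delta>. bd e = (c :: 'v set \<Rightarrow> 'k)))"

text \<open>
  The join \<open>c \<mapsto> v * c\<close> with a vertex, which drops the faces of \<open>c\<close> that contain \<open>v\<close> already.
\<close>

definition cone :: "'v::finite \<Rightarrow> ('v set \<Rightarrow> 'k::field) \<Rightarrow> 'v set \<Rightarrow> 'k" where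
  "cone v c \<sigma> = (if v \<in> \<sigma> then ksgn v (\<sigma> - {v}) * c (\<sigma> - {v}) else 0)"

lemma acyclic_atD:
  fixes c :: "'v::finite set \<Rightarrow> 'k::field"
  assumes "acyclic_at TYPE('k) p \<Delta>" "c \<in> kchains p \<Delta>" "bd c = (\<lambda>_. 0)"
  shows "\<exists>e\<in>kchains (Suc p) \<Delta>. bd e = c"
  using assms unfolding acyclic_at_def by simp

lemma ksgn_square [simp]: "ksgn v \<sigma> * ksgn v \<sigma> = 1" "ksgn v \<sigma> * (ksgn v \<sigma> * x) = x"
  by (simp_all add: ksgn_def flip: power_add mult.assoc)

lemma ksgn_insert:
  assumes "w \<notin> \<tau>"
  shows "ksgn v (insert w \<tau>) = (if to_nat w < to_nat v then - ksgn v \<tau> else (ksgn v \<tau> :: 'a::comm_ring_1))"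
proof -
  have "{u \<in> insert w \<tau>. to_nat u < to_nat v} =
      (if to_nat w < to_nat v then insert w {u \<in> \<tau>. to_nat u < to_nat v} else {u \<in> \<tau>. to_nat u < to_nat v})"
    by auto
  then show ?thesis using assms by (simp add: ksgn_def)
qed

lemma ksgn_swap:
  assumes "v \<noteq> w" "v \<notin> \<tau>" "w \<notin> \<tau>"
  shows "ksgn v \<tau> * ksgn w (insert v \<tau>) = - (ksgn w \<tau> * ksgn v (insert w \<tau>) :: 'a::comm_ring_1)"
proof -
  have "to_nat v < to_nat w \<longleftrightarrow> \<not> to_nat w < to_nat v"
    using assms(1) by (metis linorder_cases order_less_asym to_nat_split)
  then show ?thesis using assms by (simp add: ksgn_insert mult.commute)
qed

lemma bd_linear [simp]:
  "bd (\<lambda>\<sigma>. c \<sigma> + d \<sigma>) \<tau> = bd c \<tau> + bd d \<tau>"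
  "bd (\<lambda>\<sigma>. c \<sigma> - d \<sigma>) \<tau> = bd c \<tau> - bd d \<tau>"
  "bd (\<lambda>\<sigma>. - d \<sigma>) \<tau> = - bd d \<tau>"
  by (simp_all add: bd_def algebra_simps sum.distrib sum_subtractf sum_negf)

lemma kchains_add: "c \<in> kchains p \<Delta> \<Longrightarrow> d \<in> kchains p \<Delta> \<Longrightarrow> (\<lambda>\<sigma>. c \<sigma> + d \<sigma>) \<in> kchains p \<Delta>"
  unfolding kchains_def mem_Collect_eq by (metis add_0)

lemma kchains_diff: "c \<in> kchains p \<Delta> \<Longrightarrow> d \<in> kchains p \<Delta> \<Longrightarrow> (\<lambda>\<sigma>. c \<sigma> - d \<sigma>) \<in> kchains p \<Delta>"
  unfolding kchains_def mem_Collect_eq by (metis diff_0_right diff_self)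

lemma bd_kchains_0: "c \<in> kchains 0 \<Delta> \<Longrightarrow> bd c = (\<lambda>_. 0)"
  by (rule ext) (auto simp: bd_def kchains_def intro!: sum.neutral)

text \<open>Coning off with apex \<open>v\<close> is a homotopy from the identity to zero.\<close>

lemma bd_cone:
  fixes c :: "'v::finite set \<Rightarrow> 'k::field"
  shows "bd (cone v c) \<tau> + cone v (bd c) \<tau> = c \<tau>"
proof (cases "v \<in> \<tau>")
  case False
  have "bd (cone v c) \<tau> = (\<Sum>w\<in>-\<tau>. if w = v then c \<tau> else 0)"
    unfolding bd_def using False by (intro sum.cong) (auto simp: cone_def)
  then show ?thesis using False by (simp add: cone_def)
next
  case True
  define \<rho> where "\<rho> = \<tau> - {v}"
  have \<tau>: "\<tau> = insert v \<rho>" and v: "v \<notin> \<rho>" using True by (auto simp: \<rho>_def)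
  have "bd (cone v c) \<tau> = (\<Sum>w\<in>-\<tau>. ksgn w \<tau> * (ksgn v (insert w \<rho>) * c (insert w \<rho>)))"
    unfolding bd_def
  proof (rule sum.cong[OF refl])
    fix w assume "w \<in> - \<tau>"
    then have "insert w \<tau> - {v} = insert w \<rho>" "v \<in> insert w \<tau>" using \<tau> v by auto
    then show "ksgn w \<tau> * cone v c (insert w \<tau>) = ksgn w \<tau> * (ksgn v (insert w \<rho>) * c (insert w \<rho>))"
      by (simp add: cone_def)
  qed
  also have "\<dots> = (\<Sum>w\<in>-\<tau>. - (ksgn v \<rho> * (ksgn w \<rho> * c (insert w \<rho>))))"
  proof (rule sum.cong[OF refl])
    fix w assume w: "w \<in> - \<tau>"
    then have ne: "w \<noteq> v" "w \<notin> \<rho>" using \<tau> by auto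
    define a b a' b' :: 'k where "a = ksgn w \<rho>" and "b = ksgn v (insert w \<rho>)"
      and "a' = ksgn v \<rho>" and "b' = ksgn w (insert v \<rho>)"
    have 1: "a * b = - (a' * b')" unfolding a_def b_def a'_def b'_def by (rule ksgn_swap) (use ne v in auto)
    have 2: "a' * a' = 1" "b' * b' = 1" "a * a = 1" by (simp_all add: a'_def b'_def a_def)
    have "b' * b = b' * (a * a) * b" using 2 by simp
    also have "\<dots> = a * b' * (a * b)" by (simp add: ac_simps)
    also have "\<dots> = - (a * a' * (b' * b'))" unfolding 1 by (simp add: ac_simps)
    finally have "b' * b = - (a' * a)" using 2 by (simp add: ac_simps)
    then have "b' * (b * x) = - (a' * (a * x))" for x by (metis mult.assoc mult_minus_left)
    then show "ksgn w \<tau> * (ksgn v (insert w \<rho>) * c (insert w \<rho>)) = - (ksgn v \<rho> * (ksgn w \<rho> * c (insert w \<rho>)))"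
      by (simp add: a_def b_def a'_def b'_def \<tau>)
  qed
  also have "\<dots> = - (ksgn v \<rho> * (\<Sum>w\<in>-\<tau>. ksgn w \<rho> * c (insert w \<rho>)))"
    by (simp add: sum_negf sum_distrib_left)
  finally have 1: "bd (cone v c) \<tau> = - (ksgn v \<rho> * (\<Sum>w\<in>-\<tau>. ksgn w \<rho> * c (insert w \<rho>)))" .
  have "-\<rho> = insert v (-\<tau>)" using \<tau> v by auto
  then have "bd c \<rho> = ksgn v \<rho> * c \<tau> + (\<Sum>w\<in>-\<tau>. ksgn w \<rho> * c (insert w \<rho>))"
    using True \<tau> by (simp add: bd_def)
  then have "ksgn v \<rho> * bd c \<rho> = c \<tau> + ksgn v \<rho> * (\<Sum>w\<in>-\<tau>. ksgn w \<rho> * c (insert w \<rho>))"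
    by (simp add: algebra_simps)
  then show ?thesis using 1 True by (simp add: cone_def \<rho>_def)
qed

text \<open>
  A family that is invariant under adding and removing \<open>v\<close> is a cone with apex \<open>v\<close>, and cones have no
  homology.
\<close>

lemma acyclic_cone:
  assumes "\<And>\<sigma>. v \<notin> \<sigma> \<Longrightarrow> \<sigma> \<in> \<Delta> \<longleftrightarrow> insert v \<sigma> \<in> \<Delta>"
  shows "acyclic_at TYPE('k::field) p \<Delta>"
  unfolding acyclic_at_def
proof (intro ballI impI)
  fix c :: "'a set \<Rightarrow> 'k" assume c: "c \<in> kchains p \<Delta>" "bd c = (\<lambda>_. 0)"
  have "cone v c \<in> kchains (Suc p) \<Delta>"
    unfolding kchains_def
  proof safe
    fix \<sigma> assume "cone v c \<sigma> \<noteq> 0"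
    then have v: "v \<in> \<sigma>" and "c (\<sigma> - {v}) \<noteq> 0" by (auto simp: cone_def split: if_splits)
    then have *: "\<sigma> - {v} \<in> \<Delta>" "card (\<sigma> - {v}) = p" using c by (auto simp: kchains_def)
    show "\<sigma> \<in> \<Delta>" using assms[of "\<sigma> - {v}"] * v by (auto simp: insert_absorb)
    show "card \<sigma> = Suc p" using * v by (metis card.remove finite)
  qed
  moreover have "bd (cone v c) \<tau> = c \<tau>" for \<tau>
    using bd_cone[of v c \<tau>] c(2) by (simp add: cone_def split: if_splits)
  ultimately show "\<exists>e\<in>kchains (Suc p) \<Delta>. bd e = c" by (meson ext)
qed

text \<open>
  If \<open>\<Phi>\<close> is acyclic, then gluing the cone \<open>y * \<Gamma>\<close> onto it along \<open>\<Gamma>\<close> gives, up to homology, the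
  suspension of \<open>\<Gamma>\<close>.
\<close>

lemma acyclic_suspension:
  fixes \<Phi> \<Gamma> \<Delta> :: "'v::finite set set"
  assumes sub: "\<Gamma> \<subseteq> \<Phi>" and y: "\<And>\<sigma>. \<sigma> \<in> \<Phi> \<Longrightarrow> y \<notin> \<sigma>"
    and acyc: "\<And>p. acyclic_at TYPE('k::field) p \<Phi>"
    and \<Delta>: "\<Delta> = \<Phi> \<union> insert y ` \<Gamma>"
  shows "acyclic_at TYPE('k) 0 \<Delta>"
    and "acyclic_at TYPE('k) (Suc p) \<Delta> \<longleftrightarrow> acyclic_at TYPE('k) p \<Gamma>"
proof -
  have in\<Delta>1: "\<sigma> \<in> \<Delta> \<longleftrightarrow> \<sigma> \<in> \<Phi>" if "y \<notin> \<sigma>" for \<sigma> using that by (auto simp: \<Delta>)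
  have in\<Delta>2: "\<sigma> \<in> \<Delta> \<longleftrightarrow> \<sigma> - {y} \<in> \<Gamma>" if "y \<in> \<sigma>" for \<sigma>
    using that y sub by (auto simp: \<Delta> insert_absorb image_iff)
  have y\<Gamma>: "y \<notin> \<sigma>" if "\<sigma> \<in> \<Gamma>" for \<sigma> using y sub that by auto
  have \<Phi>\<Delta>: "c \<in> kchains p \<Delta>" if "c \<in> kchains p \<Phi>" for c :: "'v set \<Rightarrow> 'k" and p
    using that by (auto simp: kchains_def \<Delta>)
  have \<Gamma>\<Phi>: "c \<in> kchains p \<Phi>" if "c \<in> kchains p \<Gamma>" for c :: "'v set \<Rightarrow> 'k" and p
    using that sub by (auto simp: kchains_def)
  have card_y: "card (\<sigma> - {y}) = p \<longleftrightarrow> card \<sigma> = Suc p" if "y \<in> \<sigma>" for \<sigma> p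
    using that by (metis Suc_inject card.remove finite)
  have cone: "cone y c \<in> kchains (Suc p) \<Delta>" if "c \<in> kchains p \<Gamma>" for c :: "'v set \<Rightarrow> 'k" and p
    using that card_y by (fastforce simp: kchains_def cone_def in\<Delta>2 split: if_splits)
  \<comment> \<open>A chain on \<open>\<Delta>\<close> is a chain on \<open>\<Phi>\<close> plus the cone over its link at \<open>y\<close>.\<close>
  define link :: "('v set \<Rightarrow> 'k) \<Rightarrow> 'v set \<Rightarrow> 'k" where
    "link c \<sigma> = (if y \<in> \<sigma> then 0 else ksgn y \<sigma> * c (insert y \<sigma>))" for c \<sigma>
  have link: "link c \<in> kchains p \<Gamma>" if "c \<in> kchains (Suc p) \<Delta>" for c p
    unfolding kchains_def
  proof safe
    fix \<sigma> assume "link c \<sigma> \<noteq> 0"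
    then have "y \<notin> \<sigma>" "c (insert y \<sigma>) \<noteq> 0" by (auto simp: link_def split: if_splits)
    then show "\<sigma> \<in> \<Gamma>" "card \<sigma> = p" using that in\<Delta>2[of "insert y \<sigma>"] by (auto simp: kchains_def)
  qed
  have rest: "(\<lambda>\<sigma>. c \<sigma> - cone y (link c) \<sigma>) \<in> kchains p \<Phi>" if "c \<in> kchains p \<Delta>" for c p
    using that by (auto simp: kchains_def cone_def link_def in\<Delta>1 insert_absorb split: if_splits)
  have bd_link: "bd (link c) \<tau> = - link (bd c) \<tau>" if "c \<in> kchains p \<Delta>" for c \<tau> p
  proof (cases "y \<in> \<tau>")
    case True
    then show ?thesis by (simp add: bd_def link_def)
  next
    case False
    have "cone y (link c) (insert y \<tau>) = c (insert y \<tau>)" using False by (simp add: cone_def link_def)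
    have ph: "bd (\<lambda>\<sigma>. c \<sigma> - cone y (link c) \<sigma>) (insert y \<tau>) = 0"
      unfolding bd_def by (intro sum.neutral) (auto simp: cone_def link_def insert_absorb)
    have "bd c (insert y \<tau>) = bd (cone y (link c)) (insert y \<tau>)" using ph by simp
    also have "\<dots> = link c (insert y \<tau>) - cone y (bd (link c)) (insert y \<tau>)"
      using bd_cone[of y "link c" "insert y \<tau>"] by (simp add: algebra_simps)
    also have "\<dots> = - (ksgn y \<tau> * bd (link c) \<tau>)"
      using False by (simp add: link_def cone_def)
    finally show ?thesis using False by (simp add: link_def)
  qed
  have cyc: "\<exists>e\<in>kchains (Suc p) \<Phi>. bd e = c" if "c \<in> kchains p \<Phi>" "bd c = (\<lambda>_. 0)" for c :: "'v set \<Rightarrow> 'k" and p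
    using acyc[of p] that by (auto simp: acyclic_at_def)
  show "acyclic_at TYPE('k) 0 \<Delta>"
    unfolding acyclic_at_def
  proof (intro ballI impI)
    fix c :: "'v set \<Rightarrow> 'k" assume c: "c \<in> kchains 0 \<Delta>" "bd c = (\<lambda>_. 0)"
    have "c \<in> kchains 0 \<Phi>" using c(1) by (auto simp: kchains_def in\<Delta>1)
    then show "\<exists>e\<in>kchains (Suc 0) \<Delta>. bd e = c" using cyc c(2) \<Phi>\<Delta> by blast
  qed
  show "acyclic_at TYPE('k) (Suc p) \<Delta> \<longleftrightarrow> acyclic_at TYPE('k) p \<Gamma>"
  proof
    assume A: "acyclic_at TYPE('k) (Suc p) \<Delta>"
    show "acyclic_at TYPE('k) p \<Gamma>"
      unfolding acyclic_at_def
    proof (intro ballI impI)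
      fix c :: "'v set \<Rightarrow> 'k" assume c: "c \<in> kchains p \<Gamma>" "bd c = (\<lambda>_. 0)"
      obtain f where f: "f \<in> kchains (Suc p) \<Phi>" "bd f = c" using cyc[OF \<Gamma>\<Phi>[OF c(1)] c(2)] by auto
      define z where "z \<sigma> = f \<sigma> - cone y c \<sigma>" for \<sigma>
      have z: "z \<in> kchains (Suc p) \<Delta>"
        using cone[OF c(1)] \<Phi>\<Delta>[OF f(1)] unfolding z_def by (rule kchains_diff[rotated])
      have "bd (cone y c) \<tau> = c \<tau>" for \<tau> using bd_cone[of y c \<tau>] c(2) by (simp add: cone_def split: if_splits)
      then have "bd z = (\<lambda>_. 0)" using f(2) unfolding z_def by (auto simp: fun_eq_iff)
      then obtain e where e: "e \<in> kchains (Suc (Suc p)) \<Delta>" "bd e = z"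
        using A z by (auto simp: acyclic_at_def)
      have f0: "f (insert y \<sigma>) = 0" for \<sigma> using f(1) y[of "insert y \<sigma>"] by (auto simp: kchains_def)
      have "c \<sigma> = 0" if "y \<in> \<sigma>" for \<sigma> using c(1) y\<Gamma> that by (auto simp: kchains_def)
      then have "bd (link e) \<tau> = c \<tau>" for \<tau>
        unfolding bd_link[OF e(1)] e(2) by (auto simp: link_def z_def cone_def f0)
      then show "\<exists>e\<in>kchains (Suc p) \<Gamma>. bd e = c" using link[OF e(1)] by blast
    qed
  next
    assume A: "acyclic_at TYPE('k) p \<Gamma>"
    show "acyclic_at TYPE('k) (Suc p) \<Delta>"
      unfolding acyclic_at_def
    proof (intro ballI impI)
      fix z :: "'v set \<Rightarrow> 'k" assume z: "z \<in> kchains (Suc p) \<Delta>" "bd z = (\<lambda>_. 0)"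
      have "bd (link z) = (\<lambda>_. 0)" by (auto simp: fun_eq_iff bd_link[OF z(1)] z(2)) (simp add: link_def)
      then obtain e1 where e1: "e1 \<in> kchains (Suc p) \<Gamma>" "bd e1 = link z"
        using A link[OF z(1)] by (auto simp: acyclic_at_def)
      define w where "w \<sigma> = (z \<sigma> - cone y (link z) \<sigma>) + e1 \<sigma>" for \<sigma>
      have w: "w \<in> kchains (Suc p) \<Phi>"
        using rest[OF z(1)] \<Gamma>\<Phi>[OF e1(1)] unfolding w_def by (rule kchains_add)
      have e1eq: "e1 \<tau> = bd (cone y e1) \<tau> + cone y (link z) \<tau>" for \<tau>
        using bd_cone[of y e1 \<tau>] e1(2) by simp
      have weq: "w = (\<lambda>\<tau>. z \<tau> + bd (cone y e1) \<tau>)" using e1eq by (auto simp: w_def)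
      have "bd w = (\<lambda>_. 0)"
      proof
        fix \<tau>
        have "bd (cone y (link z)) \<tau> = link z \<tau>"
          using bd_cone[of y "link z" \<tau>] \<open>bd (link z) = _\<close> by (simp add: cone_def split: if_splits)
        then show "bd w \<tau> = 0" unfolding w_def using z(2) e1(2) by simp
      qed
      then obtain f where f: "f \<in> kchains (Suc (Suc p)) \<Phi>" "bd f = w" using cyc[OF w] by auto
      have "(\<lambda>\<sigma>. f \<sigma> - cone y e1 \<sigma>) \<in> kchains (Suc (Suc p)) \<Delta>"
        using \<Phi>\<Delta>[OF f(1)] cone[OF e1(1)] by (rule kchains_diff)
      moreover have "bd (\<lambda>\<sigma>. f \<sigma> - cone y e1 \<sigma>) = z" using f(2) weq by (auto simp: fun_eq_iff)
      ultimately show "\<exists>e\<in>kchains (Suc (Suc p)) \<Delta>. bd e = z" by blast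
    qed
  qed
qed

abbreviation "lookup \<equiv> Poly_Mapping.lookup"
abbreviation "keys \<equiv> Poly_Mapping.keys"
abbreviation "single \<equiv> Poly_Mapping.single"

section \<open>Exponent vectors and coefficients\<close>

lemma sum_single: "(\<Sum>t\<in>keys p. single t (lookup p t)) = p"
proof (rule poly_mapping_eqI)
  fix k
  have "lookup (\<Sum>t\<in>keys p. single t (lookup p t)) k = (\<Sum>t\<in>keys p. if t = k then lookup p k else 0)"
    by (auto simp: lookup_sum lookup_single when_def intro!: sum.cong)
  then show "lookup (\<Sum>t\<in>keys p. single t (lookup p t)) k = lookup p k"
    by (auto simp: in_keys_iff)
qed

lemma poly_mapping_additive_induct [case_names zero single add]:
  fixes p :: "'a \<Rightarrow>\<^sub>0 'b::comm_monoid_add"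
  assumes "P 0" "\<And>t c. P (single t c)" "\<And>p q. P p \<Longrightarrow> P q \<Longrightarrow> P (p + q)"
  shows "P p"
proof -
  have "finite A \<Longrightarrow> P (\<Sum>t\<in>A. single t (lookup p t))" for A
    by (induction A rule: finite_induct) (auto intro: assms)
  from this[of "keys p"] show ?thesis by (simp add: sum_single)
qed

lemma mdeg_simps [simp]:
  "mdeg 0 = 0" "mdeg (s + t) = mdeg s + mdeg t" "mdeg (single v n) = n"
  by (simp_all add: mdeg_def lookup_add sum.distrib lookup_single when_def)

lemma mdeg_eq_0 [simp]: "mdeg t = 0 \<longleftrightarrow> t = 0"
  by (auto simp: mdeg_def intro: poly_mapping_eqI)

text \<open>The exponent vector of the squarefree monomial with support \<open>\<sigma>\<close>.\<close>

lift_definition ind :: "'v::finite set \<Rightarrow> ('v \<Rightarrow>\<^sub>0 nat)" is "\<lambda>\<sigma> v. if v \<in> \<sigma> then 1 else 0"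
  by simp

lemma lookup_ind: "lookup (ind \<sigma>) v = (if v \<in> \<sigma> then 1 else 0)"
  by transfer simp

text \<open>
  The squarefree monomial with support \<open>\<sigma>\<close> divides the monomial with exponent \<open>\<alpha>\<close>.
\<close>

definition ind_le :: "'v::finite set \<Rightarrow> ('v \<Rightarrow>\<^sub>0 nat) \<Rightarrow> bool" where
  "ind_le \<sigma> \<alpha> \<longleftrightarrow> (\<forall>v\<in>\<sigma>. lookup \<alpha> v > 0)"

lemma ind_le_diff_add: "ind_le \<sigma> \<alpha> \<Longrightarrow> (\<alpha> - ind \<sigma>) + ind \<sigma> = \<alpha>"
  by (rule poly_mapping_eqI) (auto simp: ind_le_def lookup_add lookup_minus lookup_ind)

lemma ind_le_add [simp]: "ind_le \<sigma> (t + ind \<sigma>)"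
  by (auto simp: ind_le_def lookup_add lookup_ind)

lemma mdeg_ind [simp]: "mdeg (ind \<sigma>) = card \<sigma>"
  by (simp add: mdeg_def lookup_ind sum.If_cases)

lemma ind_insert: "v \<notin> \<sigma> \<Longrightarrow> ind (insert v \<sigma>) = ind \<sigma> + single v 1"
  by (rule poly_mapping_eqI) (auto simp: lookup_ind lookup_add lookup_single when_def)

lemma ind_le_insert: "ind_le (insert v \<sigma>) \<alpha> \<longleftrightarrow> lookup \<alpha> v > 0 \<and> ind_le \<sigma> \<alpha>"
  by (auto simp: ind_le_def)

lemma lookup_var_mult:
  "lookup (var v * p) s = (if lookup s v > 0 then lookup p (s - single v 1) else 0)"
proof (induction p rule: poly_mapping_additive_induct)
  case (single t c)
  have "single v 1 + t = s \<longleftrightarrow> lookup s v > 0 \<and> t = s - single v 1"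
    by (auto simp: poly_mapping_eq_iff lookup_add lookup_minus lookup_single when_def fun_eq_iff)
  then show ?case by (auto simp: var_def monom_def mult_single lookup_single when_def)
qed (simp_all add: algebra_simps lookup_add)

lemma lookup_ksgn_mult: "lookup (ksgn v \<sigma> * p) s = ksgn v \<sigma> * lookup p s"
proof -
  have "lookup ((-1) ^ n * p) s = (-1) ^ n * lookup p s" for n
    by (cases "even n") auto
  then show ?thesis by (simp add: ksgn_def)
qed

section \<open>The Koszul complex\<close>

interpretation rs: module "rscale :: ('v, 'k::field) mpoly \<Rightarrow> _"
  by (rule module_rscale)

text \<open>
  Submodules of \<open>nat \<Rightarrow>\<^sub>0 R\<close> enter through their homogeneous components, a family
  \<open>M :: int \<Rightarrow> _ set\<close> of additive subgroups with \<open>x\<^sub>v M d \<subseteq> M (d + 1)\<close>.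
\<close>

definition graded_family :: "(int \<Rightarrow> (nat \<Rightarrow>\<^sub>0 ('v, 'k::field) mpoly) set) \<Rightarrow> bool" where
  "graded_family M \<longleftrightarrow> (\<forall>d. 0 \<in> M d \<and> (\<forall>f\<in>M d. \<forall>g\<in>M d. f - g \<in> M d) \<and>
     (\<forall>f\<in>M d. \<forall>v. rscale (var v) f \<in> M (d + 1)))"

text \<open>
  The degree \<open>j\<close> part of \<open>K\<^sub>p(M)\<close>, where \<open>K(M)\<close> is the Koszul complex on all variables with
  coefficients in \<open>M\<close>: an element assigns to every \<open>p\<close>-element set \<open>\<sigma>\<close> of variables the coefficient,
  homogeneous of degree \<open>j - p\<close>, of the basis element indexed by \<open>\<sigma>\<close>.
\<close>

definition kosz :: "nat \<Rightarrow> int \<Rightarrow> (int \<Rightarrow> (nat \<Rightarrow>\<^sub>0 ('v::finite, 'k::field) mpoly) set)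
    \<Rightarrow> ('v set \<Rightarrow> nat \<Rightarrow>\<^sub>0 ('v, 'k) mpoly) set" where
  "kosz p j M = {C. \<forall>\<sigma>. if card \<sigma> = p then C \<sigma> \<in> M (j - int p) else C \<sigma> = 0}"

text \<open>
  The Koszul differential, with the signs of the simplicial boundary.
\<close>

definition kd :: "('v::finite set \<Rightarrow> nat \<Rightarrow>\<^sub>0 ('v, 'k::field) mpoly)
    \<Rightarrow> 'v set \<Rightarrow> nat \<Rightarrow>\<^sub>0 ('v, 'k) mpoly" where
  "kd C \<tau> = (\<Sum>v\<in>-\<tau>. rscale (ksgn v \<tau> * var v) (C (insert v \<tau>)))"

text \<open>Vanishing of the degree \<open>j\<close> part of \<open>H\<^sub>p(K(M)) = Tor\<^sub>p(M, k)\<close>.\<close>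

definition koszul_exact :: "nat \<Rightarrow> int \<Rightarrow> (int \<Rightarrow> (nat \<Rightarrow>\<^sub>0 ('v::finite, 'k::field) mpoly) set) \<Rightarrow> bool" where
  "koszul_exact p j M \<longleftrightarrow> (\<forall>C\<in>kosz p j M. kd C = (\<lambda>_. 0) \<longrightarrow> (\<exists>E\<in>kosz (Suc p) j M. kd E = C))"

text \<open>
  For \<open>M \<subseteq> G\<close>: injectivity of \<open>H\<^sub>p(K(M)) \<longrightarrow> H\<^sub>p(K(G))\<close> in degree \<open>j\<close>.
\<close>

definition koszul_inj :: "nat \<Rightarrow> int \<Rightarrow> (int \<Rightarrow> (nat \<Rightarrow>\<^sub>0 ('v::finite, 'k::field) mpoly) set)
    \<Rightarrow> (int \<Rightarrow> (nat \<Rightarrow>\<^sub>0 ('v::finite, 'k::field) mpoly) set) \<Rightarrow> bool" where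
  "koszul_inj p j G M \<longleftrightarrow> (\<forall>C\<in>kosz (Suc p) j G. kd C \<in> kosz p j M \<longrightarrow> (\<exists>E\<in>kosz (Suc p) j M. kd E = kd C))"

lemma koszul_exactD:
  assumes "koszul_exact p j M" "C \<in> kosz p j M" "kd C = (\<lambda>_. 0)"
  obtains E where "E \<in> kosz (Suc p) j M" "kd E = C"
  using assms unfolding koszul_exact_def by blast

lemma koszul_injD:
  assumes "koszul_inj p j G M" "C \<in> kosz (Suc p) j G" "kd C \<in> kosz p j M"
  obtains E where "E \<in> kosz (Suc p) j M" "kd E = kd C"
  using assms unfolding koszul_inj_def by blast

lemma graded_familyD:
  assumes "graded_family M"
  shows "0 \<in> M d" "f \<in> M d \<Longrightarrow> g \<in> M d \<Longrightarrow> f - g \<in> M d" "f \<in> M d \<Longrightarrow> - f \<in> M d"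
    "f \<in> M d \<Longrightarrow> g \<in> M d \<Longrightarrow> f + g \<in> M d" "f \<in> M d \<Longrightarrow> rscale (var v) f \<in> M (d + 1)"
proof -
  show 1: "0 \<in> M d" and 2: "f \<in> M d \<Longrightarrow> g \<in> M d \<Longrightarrow> f - g \<in> M d" for f g
    using assms by (auto simp: graded_family_def)
  show 3: "f \<in> M d \<Longrightarrow> - f \<in> M d" for f using 2[of 0 f] 1 by simp
  show "f \<in> M d \<Longrightarrow> g \<in> M d \<Longrightarrow> f + g \<in> M d" using 2[of f "-g"] 3[of g] by simp
  show "f \<in> M d \<Longrightarrow> rscale (var v) f \<in> M (d + 1)" using assms by (auto simp: graded_family_def)
qed

lemma rscale_ksgn_var: "rscale (ksgn v \<tau> * var v) f = rscale (var v) f \<or> rscale (ksgn v \<tau> * var v) f = - rscale (var v) f"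
  by (cases "even (card {w \<in> \<tau>. to_nat w < to_nat v})") (auto simp: ksgn_def)

lemma graded_family_sum:
  assumes "graded_family M" "\<And>x. x \<in> A \<Longrightarrow> f x \<in> M d"
  shows "sum f A \<in> M d"
  using assms(2) by (induction A rule: infinite_finite_induct) (auto intro: graded_familyD[OF assms(1)])

lemma kosz_kd:
  assumes M: "graded_family M" and C: "C \<in> kosz (Suc p) j M"
  shows "kd C \<in> kosz p j M"
proof -
  have "rscale (ksgn v \<tau> * var v) (C (insert v \<tau>)) \<in> M (j - int p)" if "card \<tau> = p" "v \<notin> \<tau>" for v \<tau>
  proof -
    have "card (insert v \<tau>) = Suc p" using that by simp
    then have "C (insert v \<tau>) \<in> M (j - int (Suc p))" using C unfolding kosz_def mem_Collect_eq by presburger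
    from graded_familyD(5)[OF M this, of v] have "rscale (var v) (C (insert v \<tau>)) \<in> M (j - int p)" by simp
    then show ?thesis using rscale_ksgn_var[of v \<tau> "C (insert v \<tau>)"] graded_familyD(3)[OF M] by metis
  qed
  moreover have "C (insert v \<tau>) = 0" if "card \<tau> \<noteq> p" "v \<notin> \<tau>" for v \<tau>
  proof -
    have "card (insert v \<tau>) \<noteq> Suc p" using that by simp
    then show ?thesis using C unfolding kosz_def by (auto dest!: spec[of _ "insert v \<tau>"])
  qed
  ultimately show ?thesis
    unfolding kosz_def kd_def by (auto intro!: graded_family_sum[OF M] sum.neutral)
qed

lemma kosz_diff:
  "graded_family M \<Longrightarrow> C \<in> kosz p j M \<Longrightarrow> D \<in> kosz p j M \<Longrightarrow> (\<lambda>\<sigma>. C \<sigma> - D \<sigma>) \<in> kosz p j M"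
  unfolding kosz_def using graded_familyD(2) by fastforce

lemma kd_diff: "kd (\<lambda>\<sigma>. C \<sigma> - D \<sigma>) \<tau> = kd C \<tau> - kd D \<tau>"
  by (simp add: kd_def rs.scale_right_diff_distrib sum_subtractf)

lemma kd_module_hom:
  assumes "module_hom rscale rscale \<delta>"
  shows "kd (\<lambda>\<sigma>. \<delta> (C \<sigma>)) \<tau> = \<delta> (kd C \<tau>)"
proof -
  interpret module_hom rscale rscale \<delta> by fact
  show ?thesis by (simp add: kd_def sum scale)
qed

lemma kd_kd: "kd (kd C) \<tau> = 0"
proof -
  define S where "S = (SIGMA v:-\<tau>. - insert v \<tau>)"
  define L where "L = {(v, w) \<in> S. to_nat v < to_nat w}"
  define f where "f = (\<lambda>(v, w). rscale ((ksgn v \<tau> * var v) * (ksgn w (insert v \<tau>) * var w)) (C (insert w (insert v \<tau>))))"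
  \<comment> \<open>The terms of \<open>(v, w)\<close> and \<open>(w, v)\<close> cancel. Pairing them, rather than showing that the sum is
    its own negative, covers characteristic two.\<close>
  have "kd (kd C) \<tau> = (\<Sum>v\<in>-\<tau>. \<Sum>w\<in>-insert v \<tau>. f (v, w))"
    by (simp add: kd_def rs.scale_sum_right f_def)
  also have "\<dots> = sum f S" unfolding S_def by (subst sum.Sigma) auto
  also have "S = L \<union> prod.swap ` L"
    by (auto simp: S_def L_def image_iff) (metis linorder_cases to_nat_split)+
  also have "sum f \<dots> = sum f L + sum f (prod.swap ` L)"
    by (rule sum.union_disjoint) (auto simp: L_def)
  also have "sum f (prod.swap ` L) = (\<Sum>x\<in>L. f (prod.swap x))"
    by (subst sum.reindex) auto
  also have "\<dots> = (\<Sum>x\<in>L. - f x)"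
  proof (rule sum.cong[OF refl])
    fix x assume "x \<in> L"
    then obtain v w where x: "x = (v, w)" "v \<notin> \<tau>" "w \<notin> \<tau>" "v \<noteq> w" by (auto simp: L_def S_def)
    have "(ksgn w \<tau> * var w) * (ksgn v (insert w \<tau>) * var v) = (ksgn w \<tau> * ksgn v (insert w \<tau>)) * (var w * var v :: ('a, 'b) mpoly)"
      by (simp add: ac_simps)
    also have "\<dots> = - (ksgn v \<tau> * ksgn w (insert v \<tau>) * (var w * var v))"
      using ksgn_swap[of w v \<tau>, where 'a = "('a, 'b) mpoly"] x by simp
    also have "\<dots> = - ((ksgn v \<tau> * var v) * (ksgn w (insert v \<tau>) * var w))"
      by (simp add: ac_simps)
    finally show "f (prod.swap x) = - f x" by (simp add: f_def x insert_commute)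
  qed
  finally show ?thesis by (simp add: sum_negf)
qed

text \<open>
  Dimension shifting along \<open>0 \<longrightarrow> Z' \<longrightarrow> G \<longrightarrow> Z \<longrightarrow> 0\<close>, where \<open>K(G)\<close> is exact in positive degrees: the
  connecting map identifies \<open>H\<^bsub>p+1\<^esub>(K(Z))\<close> with the kernel of \<open>H\<^sub>p(K(Z')) \<longrightarrow> H\<^sub>p(K(G))\<close>, which
  is all of \<open>H\<^sub>p(K(Z'))\<close> if \<open>p > 0\<close> (\<open>koszul_inj_iff_exact\<close>). Only the vanishing of these is stated.
\<close>

lemma koszul_exact_iff_inj:
  assumes G: "graded_family G" and Z: "graded_family Z" and Z'fam: "graded_family Z'" and \<delta>: "module_hom rscale rscale \<delta>"
    and im: "\<And>d. \<delta> ` G d = Z d" and ker: "\<And>d. Z' d = {g \<in> G d. \<delta> g = 0}"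
    and ex: "koszul_exact (Suc p) j G"
  shows "koszul_exact (Suc p) j Z \<longleftrightarrow> koszul_inj p j G Z'"
proof -
  interpret \<delta>: module_hom rscale rscale \<delta> by fact
  have map: "(\<lambda>\<sigma>. \<delta> (C \<sigma>)) \<in> kosz q j Z" if "C \<in> kosz q j G" for C q
    using that im unfolding kosz_def by (auto split: if_splits)
  have lift: "\<exists>C\<in>kosz q j G. \<forall>\<sigma>. \<delta> (C \<sigma>) = D \<sigma>" if "D \<in> kosz q j Z" for D q
  proof -
    have "\<forall>\<sigma>. \<exists>c. (if card \<sigma> = q then c \<in> G (j - int q) else c = 0) \<and> \<delta> c = D \<sigma>"
    proof
      fix \<sigma>
      have "if card \<sigma> = q then D \<sigma> \<in> \<delta> ` G (j - int q) else D \<sigma> = 0" using that by (auto simp: kosz_def im)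
      then show "\<exists>c. (if card \<sigma> = q then c \<in> G (j - int q) else c = 0) \<and> \<delta> c = D \<sigma>"
        by (auto split: if_splits)
    qed
    then obtain C where "\<forall>\<sigma>. (if card \<sigma> = q then C \<sigma> \<in> G (j - int q) else C \<sigma> = 0) \<and> \<delta> (C \<sigma>) = D \<sigma>"
      by metis
    then show ?thesis unfolding kosz_def by (intro bexI[of _ C]) auto
  qed
  have kerk: "C \<in> kosz q j Z'" if "C \<in> kosz q j G" "\<And>\<sigma>. \<delta> (C \<sigma>) = 0" for C q
    using that by (auto simp: kosz_def ker)
  have Z'G: "C \<in> kosz q j G" "\<delta> (C \<sigma>) = 0" if "C \<in> kosz q j Z'" for C q \<sigma>
  proof -
    have *: "if card \<sigma> = q then C \<sigma> \<in> G (j - int q) \<and> \<delta> (C \<sigma>) = 0 else C \<sigma> = 0" for \<sigma>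
      using that unfolding kosz_def mem_Collect_eq ker by meson
    show "C \<in> kosz q j G" using * unfolding kosz_def mem_Collect_eq by meson
    show "\<delta> (C \<sigma>) = 0" using *[of \<sigma>] \<delta>.zero by (metis (full_types))
  qed
  show ?thesis
  proof
    assume A: "koszul_inj p j G Z'"
    show "koszul_exact (Suc p) j Z" unfolding koszul_exact_def
    proof (intro ballI impI)
      fix D assume D: "D \<in> kosz (Suc p) j Z" "kd D = (\<lambda>_. 0)"
      obtain C where C: "C \<in> kosz (Suc p) j G" "\<And>\<sigma>. \<delta> (C \<sigma>) = D \<sigma>" using lift[OF D(1)] by blast
      have "\<delta> (kd C \<tau>) = 0" for \<tau>
        using kd_module_hom[OF \<delta>, of C \<tau>] D(2) by (simp add: C(2))
      then have "kd C \<in> kosz p j Z'" by (rule kerk[OF kosz_kd[OF G C(1)]])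
      then obtain C' where C': "C' \<in> kosz (Suc p) j Z'" "kd C' = kd C"
        by (rule koszul_injD[OF A C(1)])
      have "(\<lambda>\<sigma>. C \<sigma> - C' \<sigma>) \<in> kosz (Suc p) j G" "kd (\<lambda>\<sigma>. C \<sigma> - C' \<sigma>) = (\<lambda>_. 0)"
        using kosz_diff[OF G C(1) Z'G(1)[OF C'(1)]] C'(2) by (auto simp: kd_diff)
      then obtain E where E: "E \<in> kosz (Suc (Suc p)) j G" "kd E = (\<lambda>\<sigma>. C \<sigma> - C' \<sigma>)"
        by (rule koszul_exactD[OF ex])
      have "kd (\<lambda>\<sigma>. \<delta> (E \<sigma>)) = D"
        by (rule ext) (simp add: kd_module_hom[OF \<delta>] E(2) \<delta>.diff C(2) Z'G(2)[OF C'(1)])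
      then show "\<exists>E\<in>kosz (Suc (Suc p)) j Z. kd E = D" using map[OF E(1)] by blast
    qed
  next
    assume A: "koszul_exact (Suc p) j Z"
    show "koszul_inj p j G Z'" unfolding koszul_inj_def
    proof (intro ballI impI)
      fix C assume C: "C \<in> kosz (Suc p) j G" "kd C \<in> kosz p j Z'"
      have "kd (\<lambda>\<sigma>. \<delta> (C \<sigma>)) = (\<lambda>_. 0)" by (rule ext) (simp add: kd_module_hom[OF \<delta>] Z'G(2)[OF C(2)])
      then obtain E where E: "E \<in> kosz (Suc (Suc p)) j Z" "kd E = (\<lambda>\<sigma>. \<delta> (C \<sigma>))"
        by (rule koszul_exactD[OF A map[OF C(1)]])
      obtain E' where E': "E' \<in> kosz (Suc (Suc p)) j G" "\<And>\<sigma>. \<delta> (E' \<sigma>) = E \<sigma>" using lift[OF E(1)] by blast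
      define C' where "C' = (\<lambda>\<sigma>. C \<sigma> - kd E' \<sigma>)"
      have "C' \<in> kosz (Suc p) j G" unfolding C'_def by (rule kosz_diff[OF G C(1) kosz_kd[OF G E'(1)]])
      moreover have "\<delta> (C' \<sigma>) = 0" for \<sigma>
        using kd_module_hom[OF \<delta>, of E' \<sigma>] E(2) by (simp add: C'_def \<delta>.diff E'(2))
      ultimately have "C' \<in> kosz (Suc p) j Z'" by (rule kerk)
      moreover have "kd C' = kd C" by (rule ext) (simp add: C'_def kd_diff kd_kd)
      ultimately show "\<exists>E\<in>kosz (Suc p) j Z'. kd E = kd C" by blast
    qed
  qed
qed

lemma koszul_inj_iff_exact:
  assumes G: "graded_family G" and Z: "graded_family Z" and sub: "\<And>d. Z d \<subseteq> G d"
    and ex: "koszul_exact (Suc p) j G"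
  shows "koszul_inj (Suc p) j G Z \<longleftrightarrow> koszul_exact (Suc p) j Z"
proof -
  have ZG: "C \<in> kosz q j G" if "C \<in> kosz q j Z" for C q
    using that sub unfolding kosz_def by (auto split: if_splits)
  show ?thesis
  proof
    assume A: "koszul_inj (Suc p) j G Z"
    show "koszul_exact (Suc p) j Z" unfolding koszul_exact_def
    proof (intro ballI impI)
      fix C assume C: "C \<in> kosz (Suc p) j Z" "kd C = (\<lambda>_. 0)"
      obtain E where E: "E \<in> kosz (Suc (Suc p)) j G" "kd E = C"
        by (rule koszul_exactD[OF ex ZG[OF C(1)] C(2)])
      obtain E' where "E' \<in> kosz (Suc (Suc p)) j Z" "kd E' = kd E"
        by (rule koszul_injD[OF A E(1)]) (use E C in auto)
      then show "\<exists>E\<in>kosz (Suc (Suc p)) j Z. kd E = C" using E(2) by auto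
    qed
  next
    assume A: "koszul_exact (Suc p) j Z"
    show "koszul_inj (Suc p) j G Z" unfolding koszul_inj_def
    proof (intro ballI impI)
      fix C assume C: "C \<in> kosz (Suc (Suc p)) j G" "kd C \<in> kosz (Suc p) j Z"
      have "kd (kd C) = (\<lambda>_. 0)" by (rule ext) (rule kd_kd)
      then show "\<exists>E\<in>kosz (Suc (Suc p)) j Z. kd E = kd C"
        using koszul_exactD[OF A C(2)] by blast
    qed
  qed
qed

section \<open>Koszul homology of monomial modules\<close>

text \<open>
  The homogeneous components of the module spanned over \<open>k\<close> by the elements \<open>t e\<^sub>b\<close> with
  \<open>(b, t) \<in> A\<close>, where \<open>e\<^sub>b\<close> has degree \<open>dg b\<close>.
\<close>

definition monomial_family ::
    "(nat \<times> ('v::finite \<Rightarrow>\<^sub>0 nat)) set \<Rightarrow> (nat \<Rightarrow> int) \<Rightarrow> int \<Rightarrow> (nat \<Rightarrow>\<^sub>0 ('v, 'k::field) mpoly) set" where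
  "monomial_family A dg d =
     {f. \<forall>b t. lookup (lookup f b) t \<noteq> 0 \<longrightarrow> (b, t) \<in> A \<and> int (mdeg t) + dg b = d}"

text \<open>The part of a Koszul chain in the multidegree \<open>\<alpha> e\<^sub>b\<close>.\<close>

definition strand :: "nat \<Rightarrow> ('v::finite \<Rightarrow>\<^sub>0 nat) \<Rightarrow> ('v set \<Rightarrow> nat \<Rightarrow>\<^sub>0 ('v, 'k::field) mpoly) \<Rightarrow> 'v set \<Rightarrow> 'k" where
  "strand b \<alpha> C \<sigma> = (if ind_le \<sigma> \<alpha> then lookup (lookup (C \<sigma>) b) (\<alpha> - ind \<sigma>) else 0)"

text \<open>
  The Koszul chain in the single multidegree \<open>\<alpha> e\<^sub>b\<close> with scalar coefficients \<open>c\<close>.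
\<close>

definition monomial_chain :: "nat \<Rightarrow> ('v::finite \<Rightarrow>\<^sub>0 nat) \<Rightarrow> ('v set \<Rightarrow> 'k::field) \<Rightarrow> 'v set \<Rightarrow> nat \<Rightarrow>\<^sub>0 ('v, 'k) mpoly" where
  "monomial_chain b \<alpha> c \<sigma> = single b (single (\<alpha> - ind \<sigma>) (c \<sigma>))"

text \<open>
  On each multidegree the Koszul differential is the simplicial boundary.
\<close>

lemma strand_kd: "strand b \<alpha> (kd C) \<tau> = bd (strand b \<alpha> C) \<tau>"
proof (cases "ind_le \<tau> \<alpha>")
  case True
  have "lookup (lookup (rscale (ksgn v \<tau> * var v) (C (insert v \<tau>))) b) (\<alpha> - ind \<tau>) =
      ksgn v \<tau> * strand b \<alpha> C (insert v \<tau>)" if "v \<notin> \<tau>" for v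
  proof -
    have "lookup (\<alpha> - ind \<tau>) v = lookup \<alpha> v" using that by (simp add: lookup_minus lookup_ind)
    moreover have "\<alpha> - ind \<tau> - single v 1 = \<alpha> - ind (insert v \<tau>)"
      by (simp add: ind_insert that diff_diff_eq)
    ultimately show ?thesis using True
      by (simp add: lookup_rscale mult.assoc lookup_ksgn_mult lookup_var_mult strand_def ind_le_insert)
  qed
  then show ?thesis using True
    by (simp add: strand_def[of b \<alpha> "kd C"] kd_def bd_def lookup_sum)
next
  case False
  then show ?thesis
    by (auto simp: strand_def bd_def ind_le_insert intro!: sum.neutral)
qed

lemma strand_eqI:
  assumes "\<And>b \<alpha> \<sigma>. strand b \<alpha> C \<sigma> = strand b \<alpha> D \<sigma>"
  shows "C = D"
proof
  fix \<sigma>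
  have "lookup (lookup (C \<sigma>) b) t = lookup (lookup (D \<sigma>) b) t" for b t
    using assms[of b "t + ind \<sigma>" \<sigma>] by (simp add: strand_def)
  then show "C \<sigma> = D \<sigma>" by (intro poly_mapping_eqI)
qed

lemma strand_zero [simp]: "strand b \<alpha> (\<lambda>_. 0) = (\<lambda>_. 0)"
  by (auto simp: strand_def)

lemma strand_sum: "strand b \<alpha> (\<lambda>\<sigma>. \<Sum>x\<in>X. f x \<sigma>) \<sigma> = (\<Sum>x\<in>X. strand b \<alpha> (f x) \<sigma>)"
  by (simp add: strand_def lookup_sum)

lemma strand_monomial_chain:
  assumes "\<And>\<sigma>. c \<sigma> \<noteq> 0 \<Longrightarrow> ind_le \<sigma> \<alpha>"
  shows "strand b' \<beta> (monomial_chain b \<alpha> c) = (if b' = b \<and> \<beta> = \<alpha> then c else (\<lambda>_. 0))"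
proof
  fix \<sigma>
  have "\<alpha> = \<beta>" if "\<alpha> - ind \<sigma> = \<beta> - ind \<sigma>" "ind_le \<sigma> \<alpha>" "ind_le \<sigma> \<beta>"
    using that by (metis ind_le_diff_add)
  then show "strand b' \<beta> (monomial_chain b \<alpha> c) \<sigma> = (if b' = b \<and> \<beta> = \<alpha> then c else (\<lambda>_. 0)) \<sigma>"
    using assms[of \<sigma>] by (auto simp: strand_def monomial_chain_def lookup_single when_def)
qed

text \<open>The faces of the strand of the Koszul complex on \<open>A\<close> in the multidegree \<open>\<alpha> e\<^sub>b\<close>.\<close>

definition strand_faces :: "(nat \<times> ('v::finite \<Rightarrow>\<^sub>0 nat)) set \<Rightarrow> nat \<Rightarrow> ('v \<Rightarrow>\<^sub>0 nat) \<Rightarrow> 'v set set" where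
  "strand_faces A b \<alpha> = {\<sigma>. ind_le \<sigma> \<alpha> \<and> (b, \<alpha> - ind \<sigma>) \<in> A}"

lemma kosz_monomial_iff:
  "C \<in> kosz p j (monomial_family A dg) \<longleftrightarrow>
    (\<forall>b \<alpha>. strand b \<alpha> C \<in> kchains p (if int (mdeg \<alpha>) + dg b = j then strand_faces A b \<alpha> else {}))"
  (is "_ \<longleftrightarrow> (\<forall>b \<alpha>. strand b \<alpha> C \<in> kchains p (?F b \<alpha>))")
proof -
  have aux: "(\<forall>b \<alpha>. P b \<alpha>) \<longleftrightarrow> (\<forall>b \<alpha>. ind_le \<sigma> \<alpha> \<longrightarrow> P b \<alpha>)" if "\<And>b \<alpha>. \<not> ind_le \<sigma> \<alpha> \<Longrightarrow> P b \<alpha>"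
    for P :: "nat \<Rightarrow> ('a \<Rightarrow>\<^sub>0 nat) \<Rightarrow> bool" and \<sigma> using that by auto
  have aux2: "(\<forall>b \<alpha>. ind_le \<sigma> \<alpha> \<longrightarrow> P b \<alpha> (\<alpha> - ind \<sigma>)) \<longleftrightarrow> (\<forall>b t. P b (t + ind \<sigma>) t)"
    for P :: "nat \<Rightarrow> ('a \<Rightarrow>\<^sub>0 nat) \<Rightarrow> ('a \<Rightarrow>\<^sub>0 nat) \<Rightarrow> bool" and \<sigma>
    by (metis add_diff_cancel_right' ind_le_add ind_le_diff_add)
  have z: "C \<sigma> = 0 \<longleftrightarrow> (\<forall>b t. lookup (lookup (C \<sigma>) b) t = 0)" for \<sigma>
    by (auto intro!: poly_mapping_eqI)
  have "(if card \<sigma> = p then C \<sigma> \<in> monomial_family A dg (j - int p) else C \<sigma> = 0) \<longleftrightarrow>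
      (\<forall>b t. lookup (lookup (C \<sigma>) b) t \<noteq> 0 \<longrightarrow> (b, t) \<in> A \<and> int (mdeg (t + ind \<sigma>)) + dg b = j \<and> card \<sigma> = p)" for \<sigma>
    by (auto simp: monomial_family_def z algebra_simps)
  also have "(\<forall>b t. lookup (lookup (C \<sigma>) b) t \<noteq> 0 \<longrightarrow> (b, t) \<in> A \<and> int (mdeg (t + ind \<sigma>)) + dg b = j \<and> card \<sigma> = p) \<longleftrightarrow>
      (\<forall>b \<alpha>. strand b \<alpha> C \<sigma> \<noteq> 0 \<longrightarrow> \<sigma> \<in> ?F b \<alpha> \<and> card \<sigma> = p)" for \<sigma>
    by (subst aux[of \<sigma>], simp add: strand_def, subst aux2[symmetric])
       (auto simp: strand_def strand_faces_def)
  finally show ?thesis by (auto simp: kosz_def kchains_def)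
qed

lemma finite_strands: "finite {(b, \<alpha>). strand b \<alpha> C \<noteq> (\<lambda>_. 0)}"
proof (rule finite_subset)
  show "{(b, \<alpha>). strand b \<alpha> C \<noteq> (\<lambda>_. 0)} \<subseteq>
      (\<Union>\<sigma>. \<Union>b\<in>keys (C \<sigma>). \<Union>t\<in>keys (lookup (C \<sigma>) b). {(b, t + ind \<sigma>)})"
  proof safe
    fix b \<alpha> assume "strand b \<alpha> C \<noteq> (\<lambda>_. 0)"
    then obtain \<sigma> where \<sigma>: "ind_le \<sigma> \<alpha>" "lookup (lookup (C \<sigma>) b) (\<alpha> - ind \<sigma>) \<noteq> 0"
      by (auto simp: strand_def fun_eq_iff split: if_splits)
    then have "b \<in> keys (C \<sigma>)" by (auto simp: in_keys_iff)
    moreover have "\<alpha> = (\<alpha> - ind \<sigma>) + ind \<sigma>" by (simp add: ind_le_diff_add \<sigma>(1))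
    ultimately show "(b, \<alpha>) \<in> (\<Union>\<sigma>. \<Union>b\<in>keys (C \<sigma>). \<Union>t\<in>keys (lookup (C \<sigma>) b). {(b, t + ind \<sigma>)})"
      using \<sigma>(2) by (fastforce simp: in_keys_iff)
  qed
qed auto

text \<open>Boundaries may be assembled from boundaries in the finitely many nonzero strands.\<close>

lemma kosz_assemble:
  fixes A :: "(nat \<times> ('v::finite \<Rightarrow>\<^sub>0 nat)) set"
    and C :: "'v set \<Rightarrow> nat \<Rightarrow>\<^sub>0 ('v, 'k::field) mpoly"
  assumes C: "C \<in> kosz p j (monomial_family A dg)"
    and ex: "\<And>b \<alpha>. int (mdeg \<alpha>) + dg b = j \<Longrightarrow> \<exists>e\<in>kchains (Suc p) (strand_faces A b \<alpha>). bd e = strand b \<alpha> C"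
  shows "\<exists>E\<in>kosz (Suc p) j (monomial_family A dg). kd E = C"
proof -
  let ?F = "\<lambda>b \<alpha>. if int (mdeg \<alpha>) + dg b = j then strand_faces A b \<alpha> else {}"
  have "\<exists>e\<in>kchains (Suc p) (?F b \<alpha>). bd e = strand b \<alpha> C" for b \<alpha>
  proof (cases "int (mdeg \<alpha>) + dg b = j")
    case True
    then show ?thesis using ex by auto
  next
    case False
    have "strand b \<alpha> C \<in> kchains p {}" using C False unfolding kosz_monomial_iff by metis
    then have "bd (\<lambda>_. 0) = strand b \<alpha> C" by (auto simp: kchains_def bd_def)
    then show ?thesis by (intro bexI[of _ "\<lambda>_. 0"]) (auto simp: kchains_def)
  qed
  then have "\<forall>b \<alpha>. \<exists>e. e \<in> kchains (Suc p) (?F b \<alpha>) \<and> bd e = strand b \<alpha> C" by blast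
  then have "\<exists>e. \<forall>b \<alpha>. e b \<alpha> \<in> kchains (Suc p) (?F b \<alpha>) \<and> bd (e b \<alpha>) = strand b \<alpha> C"
    unfolding choice_iff .
  then obtain e where e: "\<And>b \<alpha>. e b \<alpha> \<in> kchains (Suc p) (?F b \<alpha>)" "\<And>b \<alpha>. bd (e b \<alpha>) = strand b \<alpha> C"
    by blast
  define S where "S = {(b, \<alpha>). strand b \<alpha> C \<noteq> (\<lambda>_. 0)}"
  define E where "E = (\<lambda>\<sigma>. \<Sum>x\<in>S. monomial_chain (fst x) (snd x) (e (fst x) (snd x)) \<sigma>)"
  have le: "e b \<alpha> \<sigma> \<noteq> 0 \<Longrightarrow> ind_le \<sigma> \<alpha>" for b \<alpha> \<sigma>
    using e(1)[of b \<alpha>] by (auto simp: kchains_def strand_faces_def split: if_splits)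
  have E: "strand b \<alpha> E \<sigma> = (if (b, \<alpha>) \<in> S then e b \<alpha> \<sigma> else 0)" for b \<alpha> \<sigma>
  proof -
    have "strand b \<alpha> E \<sigma> = (\<Sum>x\<in>S. if x = (b, \<alpha>) then e b \<alpha> \<sigma> else 0)"
      unfolding E_def strand_sum by (intro sum.cong) (auto simp: strand_monomial_chain[OF le])
    then show ?thesis using finite_strands[of C] by (simp add: S_def)
  qed
  have "E \<in> kosz (Suc p) j (monomial_family A dg)" unfolding kosz_monomial_iff
  proof (intro allI)
    fix b \<alpha> show "strand b \<alpha> E \<in> kchains (Suc p) (?F b \<alpha>)"
      using e(1)[of b \<alpha>] unfolding kchains_def by (auto simp: E)
  qed
  moreover have "kd E = C"
  proof (rule strand_eqI)
    fix b \<alpha> \<sigma>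
    have "bd (strand b \<alpha> E) \<sigma> = strand b \<alpha> C \<sigma>"
    proof (cases "(b, \<alpha>) \<in> S")
      case True
      then have "strand b \<alpha> E = e b \<alpha>" by (auto simp: E)
      then show ?thesis by (simp add: e)
    next
      case False
      then have "strand b \<alpha> E = (\<lambda>_. 0)" by (auto simp: E)
      then show ?thesis using False by (auto simp: S_def bd_def)
    qed
    then show "strand b \<alpha> (kd E) \<sigma> = strand b \<alpha> C \<sigma>" by (simp add: strand_kd)
  qed
  ultimately show ?thesis by blast
qed

text \<open>
  Koszul homology of a monomial module is the direct sum of the homology of its strands.
\<close>

lemma koszul_exact_monomial_iff:
  "koszul_exact p j (monomial_family A dg :: int \<Rightarrow> (nat \<Rightarrow>\<^sub>0 ('v::finite, 'k::field) mpoly) set) \<longleftrightarrow>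
    (\<forall>b \<alpha>. int (mdeg \<alpha>) + dg b = j \<longrightarrow> acyclic_at TYPE('k) p (strand_faces A b \<alpha>))"
  (is "koszul_exact p j ?M \<longleftrightarrow> _")
proof
  assume ex: "koszul_exact p j ?M"
  show "\<forall>b \<alpha>. int (mdeg \<alpha>) + dg b = j \<longrightarrow> acyclic_at TYPE('k) p (strand_faces A b \<alpha>)"
  proof (intro allI impI)
    fix b and \<alpha> :: "'v \<Rightarrow>\<^sub>0 nat" assume deg: "int (mdeg \<alpha>) + dg b = j"
    show "acyclic_at TYPE('k) p (strand_faces A b \<alpha>)" unfolding acyclic_at_def
    proof (intro ballI impI)
      fix c :: "'v set \<Rightarrow> 'k" assume c: "c \<in> kchains p (strand_faces A b \<alpha>)" "bd c = (\<lambda>_. 0)"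
      have le: "c \<sigma> \<noteq> 0 \<Longrightarrow> ind_le \<sigma> \<alpha>" for \<sigma> using c(1) by (auto simp: kchains_def strand_faces_def)
      define C where "C = monomial_chain b \<alpha> c"
      have C: "strand b' \<beta> C = (if b' = b \<and> \<beta> = \<alpha> then c else (\<lambda>_. 0))" for b' \<beta>
        unfolding C_def by (rule strand_monomial_chain[OF le])
      have 0: "bd (\<lambda>_. 0 :: 'k) = (\<lambda>_. 0 :: 'k)" by (rule ext) (simp add: bd_def)
      have "C \<in> kosz p j ?M" unfolding kosz_monomial_iff C using c(1) deg by (auto simp: kchains_def)
      moreover have "kd C = (\<lambda>_. 0)"
        by (rule strand_eqI) (auto simp: strand_kd C c(2) 0)
      ultimately obtain E where E: "E \<in> kosz (Suc p) j ?M" "kd E = C" using ex by (auto simp: koszul_exact_def)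
      have "bd (strand b \<alpha> E) = c" using strand_kd[of b \<alpha> E] E(2) C[of b \<alpha>] by auto
      moreover have "strand b \<alpha> E \<in> kchains (Suc p) (strand_faces A b \<alpha>)"
        using E(1) deg unfolding kosz_monomial_iff by metis
      ultimately show "\<exists>e\<in>kchains (Suc p) (strand_faces A b \<alpha>). bd e = c" by blast
    qed
  qed
next
  assume ac: "\<forall>b \<alpha>. int (mdeg \<alpha>) + dg b = j \<longrightarrow> acyclic_at TYPE('k) p (strand_faces A b \<alpha>)"
  show "koszul_exact p j ?M" unfolding koszul_exact_def
  proof (intro ballI impI)
    fix C :: "'v set \<Rightarrow> nat \<Rightarrow>\<^sub>0 ('v, 'k) mpoly"
    assume C: "C \<in> kosz p j ?M" "kd C = (\<lambda>_. 0)"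
    show "\<exists>E\<in>kosz (Suc p) j ?M. kd E = C"
    proof (rule kosz_assemble[OF C(1)])
      fix b and \<alpha> :: "'v \<Rightarrow>\<^sub>0 nat" assume deg: "int (mdeg \<alpha>) + dg b = j"
      have "bd (strand b \<alpha> C) = (\<lambda>_. 0)" using strand_kd[of b \<alpha> C] C(2) by auto
      moreover have "strand b \<alpha> C \<in> kchains p (strand_faces A b \<alpha>)"
        using C(1) deg unfolding kosz_monomial_iff by metis
      ultimately show "\<exists>e\<in>kchains (Suc p) (strand_faces A b \<alpha>). bd e = strand b \<alpha> C"
        using ac deg unfolding acyclic_at_def by auto
    qed
  qed
qed

lemma graded_family_monomial:
  assumes "\<And>b t v. (b, t) \<in> A \<Longrightarrow> (b, t + single v 1) \<in> A"
  shows "graded_family (monomial_family A dg)"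
  unfolding graded_family_def
proof (intro allI conjI ballI)
  fix d f v assume f: "f \<in> monomial_family A dg d"
  show "rscale (var v) f \<in> monomial_family A dg (d + 1)" unfolding monomial_family_def mem_Collect_eq
  proof (intro allI impI)
    fix b t assume "lookup (lookup (rscale (var v) f) b) t \<noteq> 0"
    then have t: "lookup t v > 0" and nz: "lookup (lookup f b) (t - single v 1) \<noteq> 0"
      by (auto simp: lookup_rscale lookup_var_mult split: if_splits)
    define s where "s = t - single v 1"
    have ts: "t = s + single v 1"
      using t by (intro poly_mapping_eqI) (auto simp: s_def lookup_add lookup_minus lookup_single when_def)
    show "(b, t) \<in> A \<and> int (mdeg t) + dg b = d + 1"
      using f nz assms unfolding monomial_family_def s_def[symmetric] ts by auto
  qed
qed (auto simp: monomial_family_def lookup_minus, metis+)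

text \<open>The Koszul complex of a free module is exact: all strands in nonzero multidegrees are cones.\<close>

lemma koszul_exact_free:
  "koszul_exact (Suc p) j (monomial_family (B \<times> UNIV) dg :: int \<Rightarrow> (nat \<Rightarrow>\<^sub>0 ('v::finite, 'k::field) mpoly) set)"
  unfolding koszul_exact_monomial_iff
proof (intro allI impI)
  fix b :: nat and \<alpha> :: "'v \<Rightarrow>\<^sub>0 nat"
  show "acyclic_at TYPE('k) (Suc p) (strand_faces (B \<times> UNIV) b \<alpha>)"
  proof (cases "\<alpha> = 0")
    case True
    have "c = (\<lambda>_. 0)" if "c \<in> kchains (Suc p) (strand_faces (B \<times> UNIV) b \<alpha>)" for c :: "'v set \<Rightarrow> 'k"
    proof (rule ext, rule ccontr)
      fix \<sigma> assume "c \<sigma> \<noteq> 0"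
      then have "card \<sigma> = Suc p" "ind_le \<sigma> 0"
        using that by (auto simp: kchains_def strand_faces_def True)
      then show False by (cases "\<sigma> = {}") (auto simp: ind_le_def)
    qed
    moreover have "(\<lambda>_. 0) \<in> kchains (Suc (Suc p)) (strand_faces (B \<times> UNIV) b \<alpha>)" "bd (\<lambda>_. 0 :: 'k) = (\<lambda>_. 0 :: 'k)"
      by (auto simp: kchains_def bd_def)
    ultimately show ?thesis unfolding acyclic_at_def by metis
  next
    case False
    then obtain v where "lookup \<alpha> v > 0" by (metis gr0I lookup_zero poly_mapping_eqI)
    then show ?thesis by (intro acyclic_cone[of v]) (auto simp: strand_faces_def ind_le_insert)
  qed
qed

section \<open>Graded components\<close>

text \<open>
  The homogeneous component of degree \<open>j\<close>, where the basis element \<open>e\<^sub>b\<close> has degree \<open>dg b\<close>.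
\<close>

definition gproj :: "(nat \<Rightarrow> int) \<Rightarrow> int \<Rightarrow> (nat \<Rightarrow>\<^sub>0 ('v::finite, 'k::field) mpoly) \<Rightarrow> (nat \<Rightarrow>\<^sub>0 ('v, 'k) mpoly)" where
  "gproj dg j f = Poly_Mapping.mapp (\<lambda>b. Poly_Mapping.mapp (\<lambda>t c. if int (mdeg t) + dg b = j then c else 0)) f"

lemma lookup_gproj:
  "lookup (lookup (gproj dg j f) b) t = (if int (mdeg t) + dg b = j then lookup (lookup f b) t else 0)"
  by (auto simp: gproj_def lookup_mapp when_def in_keys_iff)

lemma lookup_nonzero_keys: "lookup (lookup f b) t \<noteq> 0 \<Longrightarrow> b \<in> keys f"
  by (auto simp: in_keys_iff)

lemma gproj_mem: "keys f \<subseteq> B \<Longrightarrow> gproj dg j f \<in> monomial_family (B \<times> UNIV) dg j"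
  by (auto simp: monomial_family_def lookup_gproj dest: lookup_nonzero_keys split: if_splits)

lemma monomial_family_keys: "f \<in> monomial_family (B \<times> UNIV) dg d \<Longrightarrow> keys f \<subseteq> B"
  by (auto simp: monomial_family_def in_keys_iff) (metis lookup_zero poly_mapping_eqI)

lemma gproj_id: "f \<in> monomial_family A dg j \<Longrightarrow> gproj dg j f = f"
  by (intro poly_mapping_eqI) (auto simp: lookup_gproj monomial_family_def)

lemma gproj_sum: "\<exists>D. finite D \<and> f = (\<Sum>d\<in>D. gproj dg d f)"
proof -
  define D where "D = (\<Union>b\<in>keys f. \<Union>t\<in>keys (lookup f b). {int (mdeg t) + dg b})"
  have "lookup (lookup (\<Sum>d\<in>D. gproj dg d f) b) t = lookup (lookup f b) t" for b t
  proof -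
    have "lookup (lookup (\<Sum>d\<in>D. gproj dg d f) b) t =
        (\<Sum>d\<in>D. if d = int (mdeg t) + dg b then lookup (lookup f b) t else 0)"
      by (auto simp: lookup_sum lookup_gproj intro!: sum.cong)
    moreover have "lookup (lookup f b) t = 0" if "int (mdeg t) + dg b \<notin> D"
    proof (rule ccontr)
      assume *: "lookup (lookup f b) t \<noteq> 0"
      then have "b \<in> keys f" "t \<in> keys (lookup f b)" by (auto simp: in_keys_iff)
      then show False using that unfolding D_def by blast
    qed
    moreover have "finite D" by (simp add: D_def)
    ultimately show ?thesis by auto
  qed
  then have "f = (\<Sum>d\<in>D. gproj dg d f)" by (intro poly_mapping_eqI) simp
  moreover have "finite D" by (simp add: D_def)
  ultimately show ?thesis by blast
qed

text \<open>A homogeneous map of degree zero commutes with taking homogeneous components.\<close>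

lemma gproj_hom:
  assumes \<delta>: "module_hom rscale rscale \<delta>"
    and gr: "\<And>d. \<delta> ` monomial_family (B \<times> UNIV) dg d \<subseteq> monomial_family A dg' d"
    and g: "keys g \<subseteq> B"
  shows "gproj dg' j (\<delta> g) = \<delta> (gproj dg j g)"
proof -
  interpret \<delta>: module_hom rscale rscale \<delta> by fact
  obtain D where D: "finite D" "g = (\<Sum>d\<in>D. gproj dg d g)" using gproj_sum by blast
  have mem: "\<delta> (gproj dg d g) \<in> monomial_family A dg' d" for d using gr gproj_mem[OF g] by blast
  have eq: "\<delta> g = (\<Sum>d\<in>D. \<delta> (gproj dg d g))" by (subst D(2)) (simp add: \<delta>.sum)
  have out: "gproj dg j g = 0" if "j \<notin> D"
  proof (intro poly_mapping_eqI)
    fix b t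
    have "lookup (lookup (gproj dg j g) b) t = (\<Sum>d\<in>D. lookup (lookup (gproj dg j (gproj dg d g)) b) t)"
      by (subst D(2)) (simp add: lookup_gproj lookup_sum)
    also have "\<dots> = 0" using that by (intro sum.neutral) (auto simp: lookup_gproj)
    finally show "lookup (lookup (gproj dg j g) b) t = lookup (lookup 0 b) t" by simp
  qed
  have "lookup (lookup (gproj dg' j (\<delta> g)) b) t = lookup (lookup (\<delta> (gproj dg j g)) b) t" for b t
  proof (cases "int (mdeg t) + dg' b = j")
    case True
    have "lookup (lookup (\<delta> g) b) t = (\<Sum>d\<in>D. lookup (lookup (\<delta> (gproj dg d g)) b) t)"
      by (simp add: eq lookup_sum)
    also have "\<dots> = (\<Sum>d\<in>D. if d = j then lookup (lookup (\<delta> (gproj dg j g)) b) t else 0)"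
      using mem True by (intro sum.cong) (auto simp: monomial_family_def)
    also have "\<dots> = lookup (lookup (\<delta> (gproj dg j g)) b) t" using D(1) out by simp
    finally show ?thesis using True by (simp add: lookup_gproj)
  next
    case False
    then show ?thesis using mem[of j] by (auto simp: lookup_gproj monomial_family_def)
  qed
  then show ?thesis by (intro poly_mapping_eqI)
qed

section \<open>Betti numbers as Koszul homology\<close>

lemma free_comp_eq: "free_comp F i d = monomial_family (basis F i \<times> UNIV) (bdeg F i) d"
proof -
  have "f \<in> free_comp F i d \<longleftrightarrow> f \<in> monomial_family (basis F i \<times> UNIV) (bdeg F i) d" for f
  proof -
    have "f \<in> free_comp F i d \<longleftrightarrow> keys f \<subseteq> basis F i \<and>
        (\<forall>b\<in>basis F i. \<forall>t. lookup (lookup f b) t \<noteq> 0 \<longrightarrow> int (mdeg t) + bdeg F i b = d)"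
      by (auto simp: free_comp_def free_mod_def homogeneous_def in_keys_iff algebra_simps)
    also have "\<dots> \<longleftrightarrow> f \<in> monomial_family (basis F i \<times> UNIV) (bdeg F i) d"
    proof
      assume "f \<in> monomial_family (basis F i \<times> UNIV) (bdeg F i) d"
      with monomial_family_keys[OF this] show "keys f \<subseteq> basis F i \<and>
          (\<forall>b\<in>basis F i. \<forall>t. lookup (lookup f b) t \<noteq> 0 \<longrightarrow> int (mdeg t) + bdeg F i b = d)"
        by (auto simp: monomial_family_def)
    qed (auto dest: lookup_nonzero_keys simp: monomial_family_def)
    finally show ?thesis .
  qed
  then show ?thesis by blast
qed

text \<open>
  Only the vanishing of Betti numbers matters for the regularity. Closure of \<open>W\<close> under scaling is
  needed for the criterion: it makes the line through a vector outside \<open>W\<close> meet \<open>W\<close> in zero only.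
\<close>

lemma (in vector_space) quotient_dim_eq_0_iff:
  assumes "0 \<in> W" "\<And>c v. v \<in> W \<Longrightarrow> scale c v \<in> W"
  shows "quotient_dim V W = 0 \<longleftrightarrow> V \<subseteq> W"
proof -
  let ?\<B> = "{B. finite B \<and> B \<subseteq> V \<and> independent B \<and> span B \<inter> W = {0}}"
  have "quotient_dim V W = 0 \<longleftrightarrow> (\<forall>B\<in>?\<B>. enat (card B) = 0)"
    unfolding quotient_dim_def bot_enat_def[symmetric] by (rule SUP_bot_conv)
  also have "\<dots> \<longleftrightarrow> ?\<B> \<subseteq> {{}}" by (auto simp: zero_enat_def)
  also have "\<dots> \<longleftrightarrow> V \<subseteq> W"
  proof
    assume *: "?\<B> \<subseteq> {{}}"
    show "V \<subseteq> W"
    proof (rule subsetI, rule ccontr)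
      fix v assume v: "v \<in> V" "v \<notin> W"
      then have "v \<noteq> 0" using assms by auto
      have "c = 0 \<or> scale c v \<notin> W" for c
        using assms(2)[of "scale c v" "inverse c"] v by auto
      then have "span {v} \<inter> W = {0}" using assms(1) span_zero[of "{v}"] by (auto simp: span_singleton) metis
      then have "{v} \<in> ?\<B>" using v \<open>v \<noteq> 0\<close> by (auto simp: dependent_single)
      then show False using * by blast
    qed
  next
    assume *: "V \<subseteq> W"
    show "?\<B> \<subseteq> {{}}"
    proof
      fix B assume B: "B \<in> ?\<B>"
      have "b = 0" if "b \<in> B" for b using B * that span_base[of b B] by blast
      then have "B \<subseteq> {0}" by blast
      moreover have "0 \<notin> B" using B dependent_zero by blast
      ultimately show "B \<in> {{}}" by blast
    qed
  qed
  finally show ?thesis .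
qed

lemma irrelevant_ideal_lookup_0:
  fixes r :: "('v::finite, 'k::field) mpoly"
  shows "r \<in> irrelevant_ideal \<Longrightarrow> lookup r 0 = 0"
proof -
  interpret R: module "(*) :: ('v, 'k) mpoly \<Rightarrow> _" by (rule module_mpoly)
  have m0: "lookup (p * q) 0 = lookup p 0 * lookup q 0" for p q :: "('v, 'k) mpoly"
  proof (induction p rule: poly_mapping_additive_induct)
    case (single t c)
    show ?case
    proof (induction q rule: poly_mapping_additive_induct)
      case (single s d)
      have "t + s = 0 \<longleftrightarrow> t = 0 \<and> s = 0" by (metis add_eq_0_iff_both_eq_0 mdeg_eq_0 mdeg_simps(2))
      then show ?case by (auto simp: mult_single lookup_single when_def)
    qed (simp_all add: algebra_simps lookup_add)
  qed (simp_all add: algebra_simps lookup_add)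
  have "R.subspace {r :: ('v, 'k) mpoly. lookup r 0 = 0}"
    by (auto simp: R.subspace_def lookup_add m0)
  moreover have "range var \<subseteq> {r :: ('v, 'k) mpoly. lookup r 0 = 0}"
    using lookup_var_mult[of _ 1 0] by auto
  ultimately have "irrelevant_ideal \<subseteq> {r :: ('v, 'k) mpoly. lookup r 0 = 0}"
    unfolding irrelevant_ideal_def ideal_def by (intro R.span_minimal)
  then show "r \<in> irrelevant_ideal \<Longrightarrow> lookup r 0 = 0" by blast
qed

lemma irrelevant_mult_lookup_0:
  fixes F :: "('v::finite, 'k::field) free_complex"
  shows "f \<in> irrelevant_mult F i \<Longrightarrow> lookup (lookup f b) 0 = 0"
proof -
  interpret R: module "(*) :: ('v, 'k) mpoly \<Rightarrow> _" by (rule module_mpoly)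
  have ideal: "s * r \<in> irrelevant_ideal" if "r \<in> irrelevant_ideal" for r s :: "('v, 'k) mpoly"
    using that unfolding irrelevant_ideal_def ideal_def by (rule R.span_scale)
  have 1: "f \<in> irrelevant_mult F i \<Longrightarrow> lookup f b \<in> irrelevant_ideal" for f b
  proof -
    have "rs.subspace {f. \<forall>b. lookup f b \<in> (irrelevant_ideal :: ('v, 'k) mpoly set)}"
      unfolding rs.subspace_def lookup_rscale lookup_add mem_Collect_eq
      using ideal by (auto simp: irrelevant_ideal_def ideal_def R.span_zero R.span_add)
    moreover have "{rscale r f |r f. r \<in> irrelevant_ideal \<and> f \<in> free_mod F i} \<subseteq> {f. \<forall>b. lookup f b \<in> irrelevant_ideal}"
      using ideal by (auto simp: lookup_rscale mult.commute)
    ultimately have "irrelevant_mult F i \<subseteq> {f. \<forall>b. lookup f b \<in> irrelevant_ideal}"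
      unfolding irrelevant_mult_def by (rule rs.span_minimal[rotated])
    then show "f \<in> irrelevant_mult F i \<Longrightarrow> lookup f b \<in> irrelevant_ideal" by blast
  qed
  then show "f \<in> irrelevant_mult F i \<Longrightarrow> lookup (lookup f b) 0 = 0"
    using irrelevant_ideal_lookup_0 by blast
qed

text \<open>
  An element of \<open>M\<close> as an element of \<open>K\<^sub>0(M)\<close>.
\<close>

definition vertex_chain :: "(nat \<Rightarrow>\<^sub>0 ('v, 'k::field) mpoly) \<Rightarrow> 'v::finite set \<Rightarrow> (nat \<Rightarrow>\<^sub>0 ('v, 'k) mpoly)" where
  "vertex_chain f \<sigma> = (if \<sigma> = {} then f else 0)"

lemma kosz_0_iff: "C \<in> kosz 0 j M \<longleftrightarrow> (\<exists>f\<in>M j. C = vertex_chain f)"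
proof
  assume C: "C \<in> kosz 0 j M"
  have "C {} \<in> M j" using C by (auto simp: kosz_def dest: spec[of _ "{}"])
  moreover have "C = vertex_chain (C {})" using C by (auto simp: kosz_def vertex_chain_def fun_eq_iff)
  ultimately show "\<exists>f\<in>M j. C = vertex_chain f" by blast
next
  assume "\<exists>f\<in>M j. C = vertex_chain f"
  then show "C \<in> kosz 0 j M" by (auto simp: kosz_def vertex_chain_def card_eq_0_iff split: if_splits)
qed

lemma kd_kosz_0: "C \<in> kosz 0 j M \<Longrightarrow> kd C = (\<lambda>_. 0)"
  by (auto simp: kosz_0_iff vertex_chain_def kd_def fun_eq_iff intro!: sum.neutral)

lemma kd_kosz_1: "graded_family M \<Longrightarrow> C \<in> kosz (Suc 0) j M \<Longrightarrow> kd C = vertex_chain (kd C {})"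
  using kosz_kd[of M C 0 j] by (auto simp: kosz_0_iff vertex_chain_def)

text \<open>
  In each degree, \<open>\<mm> F\<^sub>i\<close> is the image of \<open>K\<^sub>1(F\<^sub>i)\<close> in \<open>K\<^sub>0(F\<^sub>i)\<close>.
\<close>

lemma irrelevant_mult_iff:
  assumes f: "f \<in> free_comp F i j"
  shows "f \<in> irrelevant_mult F i \<longleftrightarrow> (\<exists>C\<in>kosz (Suc 0) j (free_comp F i). kd C {} = f)"
    (is "_ \<longleftrightarrow> (\<exists>C\<in>kosz _ _ ?M. _)")
proof
  assume fm: "f \<in> irrelevant_mult F i"
  have M: "?M = monomial_family (basis F i \<times> UNIV) (bdeg F i)" by (rule ext) (rule free_comp_eq)
  have fC: "vertex_chain f \<in> kosz 0 j ?M" using f by (auto simp: kosz_0_iff)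
  have "\<exists>E\<in>kosz (Suc 0) j ?M. kd E = vertex_chain f" unfolding M
  proof (rule kosz_assemble)
    show "vertex_chain f \<in> kosz 0 j (monomial_family (basis F i \<times> UNIV) (bdeg F i))" using fC unfolding M .
    fix b and \<alpha> :: "'a \<Rightarrow>\<^sub>0 nat" assume deg: "int (mdeg \<alpha>) + bdeg F i b = j"
    let ?\<Delta> = "strand_faces (basis F i \<times> UNIV) b \<alpha>"
    show "\<exists>e\<in>kchains (Suc 0) ?\<Delta>. bd e = strand b \<alpha> (vertex_chain f)"
    proof (cases "\<alpha> = 0")
      case True
      have "ind {} = (0 :: 'a \<Rightarrow>\<^sub>0 nat)" by (rule poly_mapping_eqI) (simp add: lookup_ind)
      then have "strand b \<alpha> (vertex_chain f) = (\<lambda>_. 0)"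
        using irrelevant_mult_lookup_0[OF fm, of b] by (auto simp: strand_def vertex_chain_def True fun_eq_iff)
      then have "bd (\<lambda>_. 0) = strand b \<alpha> (vertex_chain f)" by (auto simp: bd_def)
      then show ?thesis by (intro bexI[of _ "\<lambda>_. 0"]) (auto simp: kchains_def)
    next
      case False
      then obtain v where "lookup \<alpha> v > 0" by (metis gr0I lookup_zero poly_mapping_eqI)
      then have "acyclic_at TYPE('b) 0 ?\<Delta>" by (intro acyclic_cone[of v]) (auto simp: strand_faces_def ind_le_insert)
      moreover have c: "strand b \<alpha> (vertex_chain f) \<in> kchains 0 ?\<Delta>"
        using fC[unfolded M kosz_monomial_iff, rule_format, of b \<alpha>] deg by simp
      ultimately show ?thesis using bd_kchains_0[OF c] by (rule acyclic_atD)
    qed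
  qed
  then obtain E where "E \<in> kosz (Suc 0) j ?M" "kd E = vertex_chain f" by blast
  then show "\<exists>C\<in>kosz (Suc 0) j ?M. kd C {} = f" by (intro bexI[of _ E]) (simp_all add: vertex_chain_def)
next
  assume "\<exists>C\<in>kosz (Suc 0) j ?M. kd C {} = f"
  then obtain C where C: "C \<in> kosz (Suc 0) j ?M" "kd C {} = f" by blast
  have "rscale (var v) (C {v}) \<in> irrelevant_mult F i" for v
  proof -
    have "C {v} \<in> free_mod F i" using C(1) by (auto simp: kosz_def free_comp_def dest!: spec[of _ "{v}"])
    moreover have "var v \<in> irrelevant_ideal"
      unfolding irrelevant_ideal_def ideal_def by (auto intro: module.span_base[OF module_mpoly])
    ultimately show ?thesis unfolding irrelevant_mult_def by (intro rs.span_base) blast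
  qed
  then have "rscale (ksgn v {}) (rscale (var v) (C {v})) \<in> irrelevant_mult F i" for v
    unfolding irrelevant_mult_def by (rule rs.span_scale)
  then have "kd C {} \<in> irrelevant_mult F i"
    unfolding kd_def irrelevant_mult_def by (intro rs.span_sum) simp
  then show "f \<in> irrelevant_mult F i" using C(2) by simp
qed

text \<open>
  The maps of the augmented complex \<open>\<dots> \<longrightarrow> F\<^sub>1 \<longrightarrow> F\<^sub>0 \<longrightarrow> R e\<^sub>0\<close>, where \<open>R\<close> is embedded as a free module of
  rank one: \<open>res_map F i\<close> starts at \<open>F\<^sub>i\<close>.
\<close>

definition res_map :: "('v, 'k::field) free_complex \<Rightarrow> nat \<Rightarrow> (nat \<Rightarrow>\<^sub>0 ('v, 'k) mpoly) \<Rightarrow> (nat \<Rightarrow>\<^sub>0 ('v, 'k) mpoly)" where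
  "res_map F i = (case i of 0 \<Rightarrow> (\<lambda>f. single 0 (aug F f)) | Suc l \<Rightarrow> diff F l)"

text \<open>
  The degree \<open>d\<close> part of the \<open>i\<close>-th syzygy module: \<open>I e\<^sub>0\<close> for \<open>i = 0\<close>, and otherwise the kernel of the
  map that starts at \<open>F\<^bsub>i-1\<^esub>\<close>. It is also the image of the map that starts at \<open>F\<^sub>i\<close>.
\<close>

definition syz :: "('v::finite, 'k::field) mpoly set \<Rightarrow> ('v, 'k) free_complex \<Rightarrow> nat \<Rightarrow> int \<Rightarrow> (nat \<Rightarrow>\<^sub>0 ('v, 'k) mpoly) set" where
  "syz I F i d = (case i of 0 \<Rightarrow> {single 0 p | p. p \<in> I \<and> homogeneous d p}
     | Suc l \<Rightarrow> {g \<in> free_comp F l d. res_map F l g = 0})"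

text \<open>
  Below, \<open>G i\<close> are the graded components of \<open>F\<^sub>i\<close>, and \<open>Z\<close> and \<open>\<delta>\<close> the syzygies and the maps, so that the
  sequences \<open>0 \<longrightarrow> Z (Suc i) \<longrightarrow> G i \<longrightarrow> Z i \<longrightarrow> 0\<close> with second map \<open>\<delta> i\<close> are exact.
\<close>

locale graded_resolution =
  fixes I :: "('v::finite, 'k::field) mpoly set" and F :: "('v, 'k) free_complex"
  assumes res: "graded_free_resolution I F"
begin

abbreviation "G \<equiv> free_comp F"
abbreviation "Z \<equiv> syz I F"
abbreviation "\<delta> \<equiv> res_map F"

lemma diff_G: "diff F i ` G (Suc i) j \<subseteq> G i j"
  using res by (simp add: graded_free_resolution_def)

lemma exact_diff: "diff F (Suc i) ` free_mod F (Suc (Suc i)) = {f \<in> free_mod F (Suc i). diff F i f = 0}"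
  using res by (simp add: graded_free_resolution_def)

lemma exact_aug: "diff F 0 ` free_mod F (Suc 0) = {f \<in> free_mod F 0. aug F f = 0}"
  using res by (simp add: graded_free_resolution_def)

lemma hom: "module_hom rscale rscale (\<delta> i)"
proof (cases i)
  case 0
  interpret aug: module_hom rscale "(*)" "aug F" using res by (simp add: graded_free_resolution_def)
  have "module_hom rscale rscale (\<lambda>f. single 0 (aug F f))"
    by unfold_locales
      (auto intro!: poly_mapping_eqI simp: aug.add aug.scale single_add lookup_rscale lookup_single when_def lookup_add)
  then show ?thesis by (simp add: res_map_def 0)
next
  case (Suc l)
  then show ?thesis using res by (simp add: graded_free_resolution_def res_map_def)
qed

sublocale h: module_hom rscale rscale "\<delta> i" for i by (rule hom)

lemma graded_family_G: "graded_family (G i)"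
  using graded_family_monomial[of "basis F i \<times> UNIV" "bdeg F i"] by (simp add: free_comp_eq[abs_def])

lemma exact_G: "koszul_exact (Suc p) j (G i)"
  using koszul_exact_free[of p j "basis F i" "bdeg F i", where 'k = 'k] by (simp add: free_comp_eq[abs_def])

lemma target: "\<exists>A dg. \<forall>d. \<delta> i ` G i d \<subseteq> monomial_family A dg d \<and> Z i d \<subseteq> monomial_family A dg d"
proof (cases i)
  case 0
  have "\<delta> i ` G i d \<subseteq> monomial_family UNIV (\<lambda>_. 0) d" for d
    using res by (auto simp: 0 res_map_def graded_free_resolution_def monomial_family_def lookup_single
        when_def homogeneous_def in_keys_iff split: if_splits)
  moreover have "Z i d \<subseteq> monomial_family UNIV (\<lambda>_. 0) d" for d
    by (auto simp: 0 syz_def monomial_family_def lookup_single when_def homogeneous_def in_keys_iff split: if_splits)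
  ultimately show ?thesis by (intro exI[of _ UNIV] exI[of _ "\<lambda>_. 0"]) simp
next
  case (Suc l)
  have "\<delta> i ` G i d \<subseteq> G l d" for d using diff_G[of l d] by (simp add: Suc res_map_def)
  moreover have "Z i d \<subseteq> G l d" for d by (auto simp: Suc syz_def)
  ultimately show ?thesis unfolding free_comp_eq[of F l]
    by (intro exI[of _ "basis F l \<times> UNIV"] exI[of _ "bdeg F l"]) simp
qed

lemma image_G: "\<delta> i ` G i d = Z i d"
proof
  show "\<delta> i ` G i d \<subseteq> Z i d"
  proof (cases i)
    case 0
    have "aug F f \<in> I" "homogeneous d (aug F f)" if "f \<in> G 0 d" for f
      using res that by (auto simp: graded_free_resolution_def free_comp_def)
    then show ?thesis by (auto simp: 0 res_map_def syz_def)
  next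
    case (Suc l)
    have "diff F l f \<in> G l d" "res_map F l (diff F l f) = 0" if "f \<in> G (Suc l) d" for f
    proof -
      show "diff F l f \<in> G l d" using diff_G[of l d] that by blast
      have f: "f \<in> free_mod F (Suc l)" using that by (simp add: free_comp_def)
      show "res_map F l (diff F l f) = 0"
      proof (cases l)
        case 0
        then have "diff F l f \<in> {f \<in> free_mod F 0. aug F f = 0}"
          using exact_aug f by auto
        then show ?thesis by (simp add: res_map_def 0)
      next
        case (Suc m)
        then have "diff F l f \<in> {f \<in> free_mod F (Suc m). diff F m f = 0}"
          using exact_diff[of m] f by auto
        then show ?thesis by (simp add: res_map_def Suc)
      qed
    qed
    then show ?thesis by (auto simp: Suc syz_def res_map_def)
  qed
next
  show "Z i d \<subseteq> \<delta> i ` G i d"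
  proof
    fix z assume z: "z \<in> Z i d"
    have "\<exists>g\<in>free_mod F i. \<delta> i g = z"
    proof (cases i)
      case 0
      then obtain p where p: "z = single 0 p" "p \<in> I" using z by (auto simp: syz_def)
      then have "p \<in> aug F ` free_mod F 0" using res by (simp add: graded_free_resolution_def)
      then show ?thesis using p by (auto simp: 0 res_map_def)
    next
      case (Suc l)
      then have zl: "z \<in> free_mod F l" "\<delta> l z = 0" using z by (auto simp: syz_def free_comp_def)
      have "z \<in> diff F l ` free_mod F (Suc l)"
      proof (cases l)
        case 0
        then have "aug F z = 0" using zl by (simp add: res_map_def) (metis lookup_single_eq lookup_zero)
        then show ?thesis using exact_aug zl 0 by auto
      next
        case (Suc m)
        then show ?thesis using exact_diff[of m] zl by (auto simp: res_map_def)
      qed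
      then show ?thesis by (auto simp: Suc res_map_def)
    qed
    then obtain g where g: "keys g \<subseteq> basis F i" "\<delta> i g = z" by (auto simp: free_mod_def)
    from target[of i] obtain A where "\<exists>dg. \<forall>d. \<delta> i ` G i d \<subseteq> monomial_family A dg d \<and> Z i d \<subseteq> monomial_family A dg d" ..
    then obtain dg where t: "\<forall>d. \<delta> i ` G i d \<subseteq> monomial_family A dg d \<and> Z i d \<subseteq> monomial_family A dg d" ..
    have "\<delta> i (gproj (bdeg F i) d g) = gproj dg d z"
      using gproj_hom[OF hom[of i] _ g(1), of "bdeg F i" A dg d] t g(2) by (simp add: free_comp_eq)
    also have "\<dots> = z" using t z by (intro gproj_id[of _ A]) auto
    finally show "z \<in> \<delta> i ` G i d" using gproj_mem[OF g(1), of "bdeg F i" d] by (force simp: free_comp_eq)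
  qed
qed

lemma graded_family_Z: "graded_family (Z i)"
  unfolding graded_family_def
proof (intro allI conjI ballI)
  fix d f g v
  show "0 \<in> Z i d"
    using imageI[OF graded_familyD(1)[OF graded_family_G, of i d], of "\<delta> i"] by (simp add: h.zero image_G)
  assume "f \<in> Z i d"
  then obtain f' where f': "f' \<in> G i d" "f = \<delta> i f'" unfolding image_G[symmetric] by blast
  show "rscale (var v) f \<in> Z i (d + 1)"
    using imageI[OF graded_familyD(5)[OF graded_family_G f'(1)], of "\<delta> i" v] by (simp add: h.scale f'(2) image_G)
  assume "g \<in> Z i d"
  then obtain g' where g': "g' \<in> G i d" "g = \<delta> i g'" unfolding image_G[symmetric] by blast
  show "f - g \<in> Z i d"
    using imageI[OF graded_familyD(2)[OF graded_family_G f'(1) g'(1)], of "\<delta> i"]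
    by (simp add: h.diff f'(2) g'(2) image_G)
qed

lemma Z_Suc: "Z (Suc i) d = {g \<in> G i d. \<delta> i g = 0}"
  by (simp add: syz_def)

text \<open>
  \<open>Z (Suc q)\<close> is the \<open>(q+1)\<close>-st syzygy module of \<open>Z 0 = I\<close>, so that passing to \<open>I\<close> raises the
  homological degree by \<open>q + 1\<close>.
\<close>

lemma koszul_shift: "koszul_inj p j (G q) (Z (Suc q)) \<longleftrightarrow> koszul_exact (Suc (p + q)) j (Z 0)"
proof (induction q arbitrary: p)
  case 0
  show ?case
    using koszul_exact_iff_inj[OF graded_family_G graded_family_Z graded_family_Z hom image_G Z_Suc exact_G] by simp
next
  case (Suc q)
  have "koszul_inj p j (G (Suc q)) (Z (Suc (Suc q))) \<longleftrightarrow> koszul_exact (Suc p) j (Z (Suc q))"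
    using koszul_exact_iff_inj[OF graded_family_G graded_family_Z graded_family_Z hom image_G Z_Suc exact_G] by simp
  also have "\<dots> \<longleftrightarrow> koszul_inj (Suc p) j (G q) (Z (Suc q))"
    by (rule koszul_inj_iff_exact[symmetric, OF graded_family_G graded_family_Z _ exact_G]) (auto simp: Z_Suc)
  finally show ?case using Suc.IH[of "Suc p"] by simp
qed

text \<open>
  The boundaries \<open>\<delta> F\<^bsub>i+1\<^esub> + \<mm> F\<^sub>i\<close> of \<open>F \<otimes> k\<close> are the elements that the differential maps to \<open>\<mm> Z\<^sub>i\<close>, as
  its kernel is \<open>\<delta> F\<^bsub>i+1\<^esub>\<close> and \<open>\<delta> F\<^sub>i = Z\<^sub>i\<close>.
\<close>

lemma tor_boundaries_iff:
  assumes f: "f \<in> G i j"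
  shows "f \<in> tor_boundaries F i j \<longleftrightarrow> (\<exists>E\<in>kosz (Suc 0) j (Z i). kd E {} = \<delta> i f)"
proof
  assume "f \<in> tor_boundaries F i j"
  then obtain g where g: "g \<in> G (Suc i) j" "f - diff F i g \<in> irrelevant_mult F i" by (auto simp: tor_boundaries_def)
  have dg: "diff F i g \<in> Z (Suc i) j" using image_G[of "Suc i" j] g(1) by (auto simp: res_map_def)
  then have "f - diff F i g \<in> G i j" using f graded_familyD(2)[OF graded_family_G] by (auto simp: Z_Suc)
  then obtain C where C: "C \<in> kosz (Suc 0) j (G i)" "kd C {} = f - diff F i g"
    using g(2) irrelevant_mult_iff by blast
  have "kd (\<lambda>\<sigma>. \<delta> i (C \<sigma>)) {} = \<delta> i f"
    using dg by (simp add: kd_module_hom[OF hom] C(2) h.diff Z_Suc)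
  moreover have "(\<lambda>\<sigma>. \<delta> i (C \<sigma>)) \<in> kosz (Suc 0) j (Z i)"
    using C(1) image_G[of i] unfolding kosz_def by (auto split: if_splits)
  ultimately show "\<exists>E\<in>kosz (Suc 0) j (Z i). kd E {} = \<delta> i f" by blast
next
  assume "\<exists>E\<in>kosz (Suc 0) j (Z i). kd E {} = \<delta> i f"
  then obtain E where E: "E \<in> kosz (Suc 0) j (Z i)" "kd E {} = \<delta> i f" by blast
  have "\<forall>\<sigma>. \<exists>c. (if card \<sigma> = Suc 0 then c \<in> G i (j - int (Suc 0)) else c = 0) \<and> \<delta> i c = E \<sigma>"
  proof
    fix \<sigma>
    have "if card \<sigma> = Suc 0 then E \<sigma> \<in> \<delta> i ` G i (j - int (Suc 0)) else E \<sigma> = 0"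
      using E(1) unfolding kosz_def mem_Collect_eq image_G by (rule spec)
    then show "\<exists>c. (if card \<sigma> = Suc 0 then c \<in> G i (j - int (Suc 0)) else c = 0) \<and> \<delta> i c = E \<sigma>"
      by (auto split: if_splits)
  qed
  then have "\<exists>C. \<forall>\<sigma>. (if card \<sigma> = Suc 0 then C \<sigma> \<in> G i (j - int (Suc 0)) else C \<sigma> = 0) \<and> \<delta> i (C \<sigma>) = E \<sigma>"
    unfolding choice_iff .
  then obtain C where "\<And>\<sigma>. if card \<sigma> = Suc 0 then C \<sigma> \<in> G i (j - int (Suc 0)) else C \<sigma> = 0" and CE: "\<And>\<sigma>. \<delta> i (C \<sigma>) = E \<sigma>"
    by blast
  then have C: "C \<in> kosz (Suc 0) j (G i)" unfolding kosz_def by blast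
  have kdC: "kd C {} \<in> G i j" using kosz_kd[OF graded_family_G C] by (auto simp: kosz_def dest!: spec[of _ "{}"])
  have "\<delta> i (kd C {}) = \<delta> i f"
    using kd_module_hom[OF hom[of i], of C "{}"] E(2) by (simp add: CE)
  then have "f - kd C {} \<in> Z (Suc i) j"
    using f kdC graded_familyD(2)[OF graded_family_G] by (auto simp: Z_Suc h.diff)
  then obtain g where g: "g \<in> G (Suc i) j" "diff F i g = f - kd C {}"
    using image_G[of "Suc i" j] by (force simp: res_map_def)
  have "kd C {} \<in> irrelevant_mult F i" using irrelevant_mult_iff[OF kdC] C by blast
  then have "f - diff F i g \<in> irrelevant_mult F i" by (simp add: g(2))
  then show "f \<in> tor_boundaries F i j" using f g(1) by (auto simp: tor_boundaries_def)
qed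

text \<open>Vanishing of \<open>Tor\<^sub>i(I, k)\<close> in degree \<open>j\<close>, computed from \<open>F \<otimes> k\<close> and from \<open>K(I)\<close>.\<close>

lemma tor_cycles_subset_iff: "tor_cycles F i j \<subseteq> tor_boundaries F i j \<longleftrightarrow> koszul_exact i j (Z 0)"
proof (cases i)
  case 0
  have "tor_cycles F 0 j = G 0 j" by (simp add: tor_cycles_def)
  then have "tor_cycles F 0 j \<subseteq> tor_boundaries F 0 j \<longleftrightarrow> (\<forall>f\<in>G 0 j. \<exists>E\<in>kosz (Suc 0) j (Z 0). kd E {} = \<delta> 0 f)"
    using tor_boundaries_iff by (auto simp: subset_iff)
  also have "\<dots> \<longleftrightarrow> (\<forall>z\<in>Z 0 j. \<exists>E\<in>kosz (Suc 0) j (Z 0). kd E {} = z)"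
    by (simp flip: image_G)
  also have "\<dots> \<longleftrightarrow> (\<forall>z\<in>Z 0 j. \<exists>E\<in>kosz (Suc 0) j (Z 0). kd E = vertex_chain z)"
  proof -
    have "kd E {} = z \<longleftrightarrow> kd E = vertex_chain z" if "E \<in> kosz (Suc 0) j (Z 0)" for E z
      using kd_kosz_1[OF graded_family_Z that] by (metis vertex_chain_def)
    then show ?thesis by blast
  qed
  also have "\<dots> \<longleftrightarrow> koszul_exact 0 j (Z 0)"
  proof -
    have "koszul_exact 0 j (Z 0) \<longleftrightarrow> (\<forall>C\<in>kosz 0 j (Z 0). \<exists>E\<in>kosz (Suc 0) j (Z 0). kd E = C)"
      by (simp add: koszul_exact_def kd_kosz_0)
    moreover have "kosz 0 j (Z 0) = vertex_chain ` Z 0 j" by (auto simp: kosz_0_iff)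
    ultimately show ?thesis by simp
  qed
  finally show ?thesis using 0 by simp
next
  case (Suc l)
  have "tor_cycles F (Suc l) j \<subseteq> tor_boundaries F (Suc l) j \<longleftrightarrow>
      (\<forall>f\<in>G (Suc l) j. diff F l f \<in> irrelevant_mult F l \<longrightarrow> (\<exists>E\<in>kosz (Suc 0) j (Z (Suc l)). kd E {} = diff F l f))"
    using tor_boundaries_iff[of _ "Suc l" j] by (auto simp: tor_cycles_def subset_iff res_map_def)
  also have "\<dots> \<longleftrightarrow> (\<forall>f\<in>\<delta> (Suc l) ` G (Suc l) j. f \<in> irrelevant_mult F l \<longrightarrow> (\<exists>E\<in>kosz (Suc 0) j (Z (Suc l)). kd E {} = f))"
    by (simp add: res_map_def)
  also have "\<dots> \<longleftrightarrow> (\<forall>z\<in>Z (Suc l) j. z \<in> irrelevant_mult F l \<longrightarrow> (\<exists>E\<in>kosz (Suc 0) j (Z (Suc l)). kd E {} = z))"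
    unfolding image_G ..
  also have "\<dots> \<longleftrightarrow> (\<forall>z\<in>Z (Suc l) j. (\<exists>C\<in>kosz (Suc 0) j (G l). kd C = vertex_chain z) \<longrightarrow>
      (\<exists>E\<in>kosz (Suc 0) j (Z (Suc l)). kd E = vertex_chain z))"
  proof -
    have 1: "kd E {} = z \<longleftrightarrow> kd E = vertex_chain z" if "E \<in> kosz (Suc 0) j (Z (Suc l))" for E z
      using kd_kosz_1[OF graded_family_Z that] by (metis vertex_chain_def)
    have 2: "kd E {} = z \<longleftrightarrow> kd E = vertex_chain z" if "E \<in> kosz (Suc 0) j (G l)" for E z
      using kd_kosz_1[OF graded_family_G that] by (metis vertex_chain_def)
    have 3: "z \<in> irrelevant_mult F l \<longleftrightarrow> (\<exists>C\<in>kosz (Suc 0) j (G l). kd C = vertex_chain z)"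
      if "z \<in> Z (Suc l) j" for z
    proof -
      have "z \<in> G l j" using that by (simp add: Z_Suc)
      from irrelevant_mult_iff[OF this] show ?thesis using 2 by simp
    qed
    show ?thesis using 1 3 by simp
  qed
  also have "\<dots> \<longleftrightarrow> koszul_inj 0 j (G l) (Z (Suc l))"
    (is "?L \<longleftrightarrow> _")
  proof
    assume L: ?L
    show "koszul_inj 0 j (G l) (Z (Suc l))" unfolding koszul_inj_def
    proof (intro ballI impI)
      fix C assume C: "C \<in> kosz (Suc 0) j (G l)" "kd C \<in> kosz 0 j (Z (Suc l))"
      then obtain z where z: "z \<in> Z (Suc l) j" "kd C = vertex_chain z" unfolding kosz_0_iff by (elim bexE)
      have "\<exists>C\<in>kosz (Suc 0) j (G l). kd C = vertex_chain z" using z(2) C(1) by (rule bexI)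
      then show "\<exists>E\<in>kosz (Suc 0) j (Z (Suc l)). kd E = kd C" using L z by simp
    qed
  next
    assume R: "koszul_inj 0 j (G l) (Z (Suc l))"
    show ?L
    proof (intro ballI impI)
      fix z assume z: "z \<in> Z (Suc l) j" "\<exists>C\<in>kosz (Suc 0) j (G l). kd C = vertex_chain z"
      then obtain C where C: "C \<in> kosz (Suc 0) j (G l)" "kd C = vertex_chain z" by (elim bexE)
      have "kd C \<in> kosz 0 j (Z (Suc l))" unfolding kosz_0_iff using C(2) z(1) by (rule bexI)
      then obtain E where "E \<in> kosz (Suc 0) j (Z (Suc l))" "kd E = kd C" by (rule koszul_injD[OF R C(1)])
      then show "\<exists>E\<in>kosz (Suc 0) j (Z (Suc l)). kd E = vertex_chain z" by (simp add: C(2) bexI[of _ E])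
    qed
  qed
  also have "\<dots> \<longleftrightarrow> koszul_exact (Suc l) j (Z 0)" using koszul_shift[of 0 j l] by simp
  finally show ?thesis using Suc by simp
qed

lemma quotient_dim_eq_0:
  "vector_space.quotient_dim kscale (tor_cycles F i j) (tor_boundaries F i j) = 0 \<longleftrightarrow> koszul_exact i j (Z 0)"
proof -
  interpret k: vector_space "kscale :: 'k \<Rightarrow> (nat \<Rightarrow>\<^sub>0 ('v, 'k) mpoly) \<Rightarrow> _" by (rule vector_space_kscale)
  have l: "lookup (lookup (kscale c f) b) t = c * lookup (lookup f b) t" for c :: 'k and f :: "nat \<Rightarrow>\<^sub>0 ('v, 'k) mpoly" and b t
  proof -
    have "lookup (const c * p) t = c * lookup p t" for p :: "('v, 'k) mpoly"
    proof (induction p rule: poly_mapping_additive_induct)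
      case (single s d)
      show ?case by (auto simp: const_def mult_single lookup_single when_def)
    qed (simp_all add: algebra_simps lookup_add)
    then show ?thesis by (simp add: kscale_def lookup_rscale)
  qed
  have G: "kscale c f \<in> G i d" if "f \<in> G i d" for c f i d
    using that unfolding free_comp_eq by (auto simp: monomial_family_def l)
  have m: "kscale c f \<in> irrelevant_mult F i" if "f \<in> irrelevant_mult F i" for c f i
    using that unfolding irrelevant_mult_def kscale_def by (rule rs.span_scale)
  have d: "kscale c f - diff F i (kscale c g) = kscale c (f - diff F i g)" for c f g
    using h.scale[of "Suc i" "const c" g] by (simp add: res_map_def kscale_def rs.scale_right_diff_distrib)
  have "kscale c f \<in> tor_boundaries F i j" if "f \<in> tor_boundaries F i j" for c f
    using that G m d unfolding tor_boundaries_def by (auto intro!: bexI[of _ "kscale c _"])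
  moreover have "0 \<in> tor_boundaries F i j"
  proof -
    have "diff F i 0 = 0" using h.zero[of "Suc i"] by (simp add: res_map_def)
    then show ?thesis using graded_familyD(1)[OF graded_family_G]
      unfolding tor_boundaries_def irrelevant_mult_def by (auto intro!: bexI[of _ 0] simp: rs.span_zero)
  qed
  ultimately show ?thesis by (subst k.quotient_dim_eq_0_iff) (auto simp: tor_cycles_subset_iff)
qed

end

section \<open>Existence of graded free resolutions\<close>

lemma countable_exponents: "countable (UNIV :: ('v::finite \<Rightarrow>\<^sub>0 nat) set)"
proof (rule countableI)
  show "inj (\<lambda>t :: 'v \<Rightarrow>\<^sub>0 nat. to_nat (lookup t))"
    by (rule injI) (simp add: poly_mapping_eqI)
qed

text \<open>
  The module \<open>nat \<Rightarrow>\<^sub>0 R\<close> has a countable \<open>k\<close>-basis of monomials, each vector lies in the span of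
  finitely many of them, and a finite-dimensional subspace contains only finitely many
  elements of an independent set.
\<close>

lemma countable_independent:
  fixes S :: "(nat \<Rightarrow>\<^sub>0 ('v::finite, 'k::field) mpoly) set"
  assumes "\<not> module.dependent kscale S"
  shows "countable S"
proof -
  interpret k: vector_space "kscale :: 'k \<Rightarrow> (nat \<Rightarrow>\<^sub>0 ('v, 'k) mpoly) \<Rightarrow> _" by (rule vector_space_kscale)
  define e where "e = (\<lambda>(b, t). single b (single t 1) :: nat \<Rightarrow>\<^sub>0 ('v, 'k) mpoly)"
  have "\<exists>T. finite T \<and> f \<in> k.span (e ` T)" for f
  proof -
    define T where "T = (SIGMA b:keys f. keys (lookup f b))"
    have "kscale c (e (b, t)) = single b (single t c)" for b t c
      by (intro poly_mapping_eqI)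
        (auto simp: kscale_def lookup_rscale e_def const_def lookup_single when_def mult_single)
    then have "single b (single t (lookup (lookup f b) t)) \<in> k.span (e ` T)"
      if "b \<in> keys f" "t \<in> keys (lookup f b)" for b t
      using k.span_scale[OF k.span_base[of "e (b, t)" "e ` T"]] that by (metis SigmaI T_def imageI)
    then have "(\<Sum>b\<in>keys f. \<Sum>t\<in>keys (lookup f b). single b (single t (lookup (lookup f b) t))) \<in> k.span (e ` T)"
      by (intro k.span_sum) auto
    moreover have "(\<Sum>t\<in>keys p. single b (single t (lookup p t))) = single b p" for b :: nat and p :: "('v, 'k) mpoly"
    proof -
      have "(\<Sum>t\<in>A. single b (g t)) = single b (\<Sum>t\<in>A. g t)" for A and g :: "('v \<Rightarrow>\<^sub>0 nat) \<Rightarrow> ('v, 'k) mpoly"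
        by (induction A rule: infinite_finite_induct) (auto simp: single_add)
      then show ?thesis by (simp add: sum_single)
    qed
    ultimately have "f \<in> k.span (e ` T)" by (simp add: sum_single)
    moreover have "finite T" by (simp add: T_def)
    ultimately show ?thesis by blast
  qed
  then have "S \<subseteq> (\<Union>T\<in>{T. finite T \<and> T \<subseteq> UNIV}. S \<inter> k.span (e ` T))" by blast
  moreover have "countable {T. finite T \<and> T \<subseteq> (UNIV :: (nat \<times> ('v \<Rightarrow>\<^sub>0 nat)) set)}"
    using countable_SIGMA[of "UNIV :: nat set" "\<lambda>_. UNIV :: ('v \<Rightarrow>\<^sub>0 nat) set"] countable_exponents
    by (intro countable_Collect_finite_subset) simp
  moreover have "countable (S \<inter> k.span (e ` T))" if "T \<in> {T. finite T \<and> T \<subseteq> UNIV}" for T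
  proof -
    have "k.independent (S \<inter> k.span (e ` T))" using assms k.independent_mono by blast
    then show ?thesis using that k.independent_span_bound[of "e ` T" "S \<inter> k.span (e ` T)"]
      by (auto intro: countable_finite)
  qed
  ultimately show ?thesis by (meson countable_UN countable_subset)
qed

lemma subspace_keys: "rs.subspace {f :: nat \<Rightarrow>\<^sub>0 ('v, 'k::field) mpoly. keys f \<subseteq> B}"
  unfolding rs.subspace_def mem_Collect_eq
proof (intro conjI ballI allI)
  fix f g :: "nat \<Rightarrow>\<^sub>0 ('v, 'k) mpoly" and r
  assume f: "f \<in> {f. keys f \<subseteq> B}"
  have "keys (rscale r f) \<subseteq> keys f" by (auto simp: in_keys_iff lookup_rscale)
  then show "keys (rscale r f) \<subseteq> B" using f by blast
  show "keys (f + g) \<subseteq> B" if "g \<in> {f. keys f \<subseteq> B}"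
    using f that Poly_Mapping.keys_add[of f g] by blast
qed simp

lemma rscale_homogeneous:
  assumes p: "\<And>t. t \<in> keys p \<Longrightarrow> int (mdeg t) + e = d" and g: "g \<in> monomial_family UNIV dg e"
  shows "rscale p g \<in> monomial_family UNIV dg d"
  unfolding monomial_family_def mem_Collect_eq
proof (intro allI impI)
  fix b t assume "lookup (lookup (rscale p g) b) t \<noteq> 0"
  then have "t \<in> keys (p * lookup g b)" by (simp add: lookup_rscale in_keys_iff)
  then obtain s u where "t = s + u" "s \<in> keys p" "u \<in> keys (lookup g b)" using keys_mult by blast
  then show "(b, t) \<in> UNIV \<and> int (mdeg t) + dg b = d"
    using p[of s] g by (auto simp: monomial_family_def in_keys_iff)
qed

text \<open>
  Every graded submodule is the image of a graded free module with basis indexed by natural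
  numbers: the \<open>k\<close>-bases of all homogeneous components form a countable generating set, and no
  Noetherian argument is needed.
\<close>

lemma graded_cover:
  fixes Z :: "(nat \<Rightarrow>\<^sub>0 ('v::finite, 'k::field) mpoly) set"
  assumes sub: "rs.subspace Z" and gr: "\<And>z j. z \<in> Z \<Longrightarrow> gproj dg j z \<in> Z"
  obtains B' dg' d where "module_hom rscale rscale d" "d ` {f. keys f \<subseteq> B'} = Z"
    "\<And>j. d ` monomial_family (B' \<times> UNIV) dg' j \<subseteq> monomial_family UNIV dg j"
proof -
  interpret k: vector_space "kscale :: 'k \<Rightarrow> (nat \<Rightarrow>\<^sub>0 ('v, 'k) mpoly) \<Rightarrow> _" by (rule vector_space_kscale)
  define Zj where "Zj j = Z \<inter> monomial_family UNIV dg j" for j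
  have "\<forall>j. \<exists>S. S \<subseteq> Zj j \<and> k.independent S \<and> Zj j \<subseteq> k.span S"
    using k.maximal_independent_subset by metis
  then obtain S where S: "\<And>j. S j \<subseteq> Zj j" "\<And>j. k.independent (S j)" "\<And>j. Zj j \<subseteq> k.span (S j)"
    by metis
  define T where "T = Sigma UNIV S"
  have T: "countable T" unfolding T_def by (intro countable_SIGMA countable_independent S(2)) simp
  define B' where "B' = to_nat_on T ` T"
  define dg' where "dg' b = fst (from_nat_into T b)" for b
  define gen where "gen b = (if b \<in> B' then snd (from_nat_into T b) else 0)" for b
  have gen: "gen b \<in> Zj (dg' b)" if b: "b \<in> B'" for b
  proof -
    obtain j s where "b = to_nat_on T (j, s)" "(j, s) \<in> T" using b by (auto simp: B'_def)
    then have "gen b = s" "dg' b = j" "s \<in> S j" using b T by (simp_all add: gen_def dg'_def) (simp add: T_def)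
    then show ?thesis using S(1)[of j] by blast
  qed
  have genS: "\<exists>b\<in>B'. gen b = s" if "s \<in> S j" for s j
  proof (intro bexI)
    have "(j, s) \<in> T" using that by (simp add: T_def)
    then show "to_nat_on T (j, s) \<in> B'" "gen (to_nat_on T (j, s)) = s" using T by (auto simp: B'_def gen_def)
  qed
  define d where "d f = (\<Sum>b\<in>keys f. rscale (lookup f b) (gen b))" for f
  have d: "d f = (\<Sum>b\<in>A. rscale (lookup f b) (gen b))" if "finite A" "keys f \<subseteq> A" for f A
    unfolding d_def using that by (intro sum.mono_neutral_left) (auto simp: in_keys_iff)
  have hom: "module_hom rscale rscale d"
  proof unfold_locales
    fix f g :: "nat \<Rightarrow>\<^sub>0 ('v, 'k) mpoly" and r
    have "keys (f + g) \<subseteq> keys f \<union> keys g" by (rule Poly_Mapping.keys_add)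
    then show "d (f + g) = d f + d g"
      by (simp add: d[of "keys f \<union> keys g"] lookup_add rs.scale_left_distrib sum.distrib)
    have "keys (rscale r f) \<subseteq> keys f" by (auto simp: in_keys_iff lookup_rscale)
    then show "d (rscale r f) = rscale r (d f)"
      by (simp add: d[of "keys f"] lookup_rscale rs.scale_sum_right)
  qed
  interpret d: module_hom rscale rscale d by fact
  have dgen: "d (single b 1) = gen b" for b by (simp add: d[of "{b}"])
  have im: "d ` {f. keys f \<subseteq> B'} = Z"
  proof
    show "d ` {f. keys f \<subseteq> B'} \<subseteq> Z"
      using gen by (auto simp: d_def Zj_def intro!: rs.subspace_sum[OF sub] rs.subspace_scale[OF sub])
    have im: "rs.subspace (d ` {f. keys f \<subseteq> B'})" by (rule d.subspace_image[OF subspace_keys])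
    then have kim: "k.subspace (d ` {f. keys f \<subseteq> B'})"
      unfolding rs.subspace_def k.subspace_def kscale_def by blast
    have "S j \<subseteq> d ` {f. keys f \<subseteq> B'}" for j
    proof
      fix s assume "s \<in> S j"
      then obtain b where b: "b \<in> B'" "gen b = s" using genS by blast
      have "keys (single b (1 :: ('v, 'k) mpoly)) \<subseteq> B'" using b(1) by simp
      then show "s \<in> d ` {f. keys f \<subseteq> B'}" using dgen[of b] b(2) by (metis (mono_tags, lifting) imageI mem_Collect_eq)
    qed
    then have Zj: "Zj j \<subseteq> d ` {f. keys f \<subseteq> B'}" for j using S(3)[of j] k.span_minimal[OF _ kim] by blast
    show "Z \<subseteq> d ` {f. keys f \<subseteq> B'}"
    proof
      fix z assume z: "z \<in> Z"
      obtain D where D: "finite D" "z = (\<Sum>j\<in>D. gproj dg j z)" using gproj_sum by blast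
      have "gproj dg j z \<in> Zj j" for j
        using gr[OF z] by (auto simp: Zj_def monomial_family_def lookup_gproj split: if_splits)
      then have "(\<Sum>j\<in>D. gproj dg j z) \<in> d ` {f. keys f \<subseteq> B'}" using Zj by (intro rs.subspace_sum[OF im]) blast
      then show "z \<in> d ` {f. keys f \<subseteq> B'}" using D(2) by simp
    qed
  qed
  have "d ` monomial_family (B' \<times> UNIV) dg' j \<subseteq> monomial_family UNIV dg j" for j
  proof safe
    fix f :: "nat \<Rightarrow>\<^sub>0 ('v, 'k) mpoly" assume f: "f \<in> monomial_family (B' \<times> UNIV) dg' j"
    have "graded_family (monomial_family UNIV dg :: int \<Rightarrow> (nat \<Rightarrow>\<^sub>0 ('v, 'k) mpoly) set)" by (rule graded_family_monomial) simp
    moreover have "rscale (lookup f b) (gen b) \<in> monomial_family UNIV dg j" if "b \<in> keys f" for b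
    proof (rule rscale_homogeneous)
      show "gen b \<in> monomial_family UNIV dg (dg' b)" using gen[of b] that monomial_family_keys[OF f] by (auto simp: Zj_def)
      show "int (mdeg t) + dg' b = j" if "t \<in> keys (lookup f b)" for t
        using that f by (auto simp: monomial_family_def in_keys_iff)
    qed
    ultimately show "d f \<in> monomial_family UNIV dg j" unfolding d_def by (rule graded_family_sum)
  qed
  with hom im show ?thesis by (rule that)
qed

text \<open>
  An ideal that contains the homogeneous components of its elements; the component \<open>q\<close> of degree
  \<open>j\<close> of \<open>p\<close> is given by its coefficients.
\<close>

definition graded_ideal :: "('v::finite, 'k::field) mpoly set \<Rightarrow> bool" where
  "graded_ideal I \<longleftrightarrow> module.subspace (*) I \<and>
     (\<forall>p\<in>I. \<forall>q j. (\<forall>t. lookup q t = (if int (mdeg t) = j then lookup p t else 0)) \<longrightarrow> q \<in> I)"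

theorem graded_free_resolution_exists:
  fixes I :: "('v::finite, 'k::field) mpoly set"
  assumes I: "graded_ideal I"
  shows "\<exists>F. graded_free_resolution I F"
proof -
  interpret R: module "(*) :: ('v, 'k) mpoly \<Rightarrow> _" by (rule module_mpoly)
  define fm where "fm B = {f :: nat \<Rightarrow>\<^sub>0 ('v, 'k) mpoly. keys f \<subseteq> B}" for B
  define P where "P = (\<lambda>(n::nat) (B, dg, Z, d :: (nat \<Rightarrow>\<^sub>0 ('v, 'k) mpoly) \<Rightarrow> (nat \<Rightarrow>\<^sub>0 ('v, 'k) mpoly)).
     rs.subspace Z \<and> Z \<subseteq> fm B \<and> (\<forall>z\<in>Z. \<forall>j. gproj dg j z \<in> Z) \<and> (n = 0 \<longrightarrow> B = {0} \<and> dg = (\<lambda>_. 0) \<and> Z = single 0 ` I))"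
  define Q where "Q = (\<lambda>(n::nat) (B, dg, Z, d :: (nat \<Rightarrow>\<^sub>0 ('v, 'k) mpoly) \<Rightarrow> (nat \<Rightarrow>\<^sub>0 ('v, 'k) mpoly)) (B', dg', Z', d').
     module_hom rscale rscale d' \<and> d' ` fm B' = Z \<and>
     (\<forall>j. d' ` monomial_family (B' \<times> UNIV) dg' j \<subseteq> monomial_family (B \<times> UNIV) dg j) \<and> Z' = {f \<in> fm B'. d' f = 0})"
  \<comment> \<open>A state consists of a graded free module, a graded submodule \<open>Z\<close> still to be covered, and the
    map to the previous free module; the next state covers \<open>Z\<close> and passes to the kernel.\<close>
  have "\<exists>f. \<forall>n. P n (f n) \<and> Q n (f n) (f (Suc n))"
  proof (rule dependent_nat_choice)
    have "rs.subspace (single 0 ` I)"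
      unfolding rs.subspace_def
    proof (intro conjI ballI allI)
      have sI: "R.subspace I" using I by (simp add: graded_ideal_def)
      show "0 \<in> single 0 ` I" using R.subspace_0[OF sI] by (metis imageI single_zero)
      fix x assume "x \<in> single (0::nat) ` I"
      then obtain p where p: "x = single 0 p" "p \<in> I" by blast
      have "rscale c x = single 0 (c * p)" for c
        by (rule poly_mapping_eqI) (simp add: p lookup_rscale lookup_single when_def)
      then show "rscale c x \<in> single 0 ` I" for c using R.subspace_scale[OF sI p(2)] by simp
      fix y assume "y \<in> single (0::nat) ` I"
      then obtain q where q: "y = single 0 q" "q \<in> I" by blast
      show "x + y \<in> single 0 ` I" using R.subspace_add[OF sI p(2) q(2)] by (simp add: p(1) q(1) flip: single_add)
    qed
    moreover have "single 0 ` I \<subseteq> fm {0}" by (auto simp: fm_def split: if_splits)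
    moreover have "gproj (\<lambda>_. 0) j z \<in> single 0 ` I" if z: "z \<in> single 0 ` I" for z j
    proof -
      obtain p where p: "z = single 0 p" "p \<in> I" using z by blast
      define q where "q = lookup (gproj (\<lambda>_. 0) j z) 0"
      have "lookup q t = (if int (mdeg t) = j then lookup p t else 0)" for t by (simp add: q_def lookup_gproj p)
      then have "q \<in> I" using I p(2) by (auto simp: graded_ideal_def)
      moreover have "gproj (\<lambda>_. 0) j z = single 0 q"
        by (intro poly_mapping_eqI) (auto simp: q_def lookup_gproj p lookup_single when_def)
      ultimately show ?thesis by blast
    qed
    ultimately show "\<exists>x. P 0 x"
      by (intro exI[of _ "({0}, \<lambda>_. 0, single 0 ` I, id)"]) (simp add: P_def)
  next
    fix x n assume Px: "P n x"
    obtain B dg Z d where x: "x = (B, dg, Z, d)" by (cases x)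
    have Z: "rs.subspace Z" "Z \<subseteq> fm B" "\<And>z j. z \<in> Z \<Longrightarrow> gproj dg j z \<in> Z" using Px by (auto simp: P_def x)
    obtain B' dg' d' where d': "module_hom rscale rscale d'" "d' ` fm B' = Z"
      and grd: "\<And>j. d' ` monomial_family (B' \<times> UNIV) dg' j \<subseteq> monomial_family UNIV dg j"
      using graded_cover[OF Z(1), of dg] Z(3) unfolding fm_def by metis
    interpret d': module_hom rscale rscale d' by fact
    have gr: "d' ` monomial_family (B' \<times> UNIV) dg' j \<subseteq> monomial_family (B \<times> UNIV) dg j" for j
    proof safe
      fix f :: "nat \<Rightarrow>\<^sub>0 ('v, 'k) mpoly" assume f: "f \<in> monomial_family (B' \<times> UNIV) dg' j"
      then have "f \<in> fm B'" unfolding fm_def using monomial_family_keys by blast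
      then have "d' f \<in> fm B" using d'(2) Z(2) by blast
      then show "d' f \<in> monomial_family (B \<times> UNIV) dg j"
        using grd[of j] f by (auto simp: monomial_family_def fm_def dest: lookup_nonzero_keys)
    qed
    define Z' where "Z' = {f \<in> fm B'. d' f = 0}"
    have "rs.subspace Z'"
      using subspace_keys[of B'] unfolding rs.subspace_def Z'_def fm_def
      by (simp add: d'.add d'.scale d'.zero) blast
    moreover have "gproj dg' j z \<in> Z'" if "z \<in> Z'" for z j
    proof -
      have z: "keys z \<subseteq> B'" "d' z = 0" using that by (auto simp: Z'_def fm_def)
      have "d' (gproj dg' j z) = gproj dg j (d' z)" by (rule gproj_hom[OF d'(1) gr z(1), symmetric])
      also have "\<dots> = 0" by (intro poly_mapping_eqI) (simp add: z lookup_gproj)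
      finally show ?thesis using monomial_family_keys[OF gproj_mem[OF z(1)]] by (simp add: Z'_def fm_def)
    qed
    ultimately have "P (Suc n) (B', dg', Z', d')" by (auto simp: P_def Z'_def)
    moreover have "Q n x (B', dg', Z', d')" using d' gr by (simp add: Q_def x Z'_def)
    ultimately show "\<exists>y. P (Suc n) y \<and> Q n x y" by blast
  qed
  then obtain f where f: "\<And>n. P n (f n)" "\<And>n. Q n (f n) (f (Suc n))" by blast
  define B where "B n = fst (f n)" for n
  define dg where "dg n = fst (snd (f n))" for n
  define Z where "Z n = fst (snd (snd (f n)))" for n
  define d where "d n = snd (snd (snd (f n)))" for n
  have fn: "f n = (B n, dg n, Z n, d n)" for n by (simp add: B_def dg_def Z_def d_def)
  have 0: "B 0 = {0}" "dg 0 = (\<lambda>_. 0)" "Z 0 = single 0 ` I" using f(1)[of 0] by (simp_all add: P_def fn)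
  have S: "module_hom rscale rscale (d (Suc n))" "d (Suc n) ` fm (B (Suc n)) = Z n"
     "d (Suc n) ` monomial_family (B (Suc n) \<times> UNIV) (dg (Suc n)) j \<subseteq> monomial_family (B n \<times> UNIV) (dg n) j"
     "Z (Suc n) = {f \<in> fm (B (Suc n)). d (Suc n) f = 0}" for n j
    using f(2)[of n] by (simp_all add: Q_def fn)
  define F where "F = \<lparr>basis = (\<lambda>i. B (Suc i)), bdeg = (\<lambda>i. dg (Suc i)), diff = (\<lambda>i. d (Suc (Suc i))),
     aug = (\<lambda>f. lookup (d (Suc 0) f) 0)\<rparr>"
  have [simp]: "free_mod F i = fm (B (Suc i))" for i by (simp add: free_mod_def F_def fm_def)
  have [simp]: "free_comp F i = monomial_family (B (Suc i) \<times> UNIV) (dg (Suc i))" for i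
    by (rule ext) (simp add: free_comp_eq, simp add: F_def)
  have d1: "d (Suc 0) f \<in> single 0 ` I" if "f \<in> fm (B (Suc 0))" for f
    using S(2)[of 0] that by (auto simp: 0)
  interpret d1: module_hom rscale rscale "d (Suc 0)" by (rule S(1))
  have "graded_free_resolution I F"
    unfolding graded_free_resolution_def
  proof (intro conjI allI ballI)
    show "module_hom rscale (*) (aug F)"
      by unfold_locales (simp_all add: F_def d1.add d1.scale lookup_add lookup_rscale)
    show "module_hom rscale rscale (diff F i)" for i by (simp add: F_def S(1))
    show "homogeneous j (aug F f)" if "f \<in> free_comp F 0 j" for j f
    proof -
      have "f \<in> monomial_family (B (Suc 0) \<times> UNIV) (dg (Suc 0)) j" using that by simp
      then have "d (Suc 0) f \<in> monomial_family (B 0 \<times> UNIV) (dg 0) j" using S(3)[of 0 j] by blast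
      then show ?thesis by (simp add: 0 F_def homogeneous_def monomial_family_def in_keys_iff)
    qed
    show "diff F i ` free_comp F (Suc i) j \<subseteq> free_comp F i j" for i j
    proof -
      have "diff F i = d (Suc (Suc i))" by (simp add: F_def)
      then show ?thesis using S(3)[of "Suc i" j] by simp
    qed
    have aug: "aug F = (\<lambda>f. lookup (d (Suc 0) f) 0)" by (simp add: F_def)
    have "aug F ` free_mod F 0 = (\<lambda>z. lookup z 0) ` (d (Suc 0) ` fm (B (Suc 0)))"
      by (simp add: aug image_image)
    also have "\<dots> = I" by (simp add: S(2) 0 image_image)
    finally show "aug F ` free_mod F 0 = I" .
    have "d (Suc 0) f = 0 \<longleftrightarrow> lookup (d (Suc 0) f) 0 = 0" if f: "f \<in> fm (B (Suc 0))" for f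
      using d1[OF f] by auto
    moreover have diffF: "diff F i = d (Suc (Suc i))" for i by (simp add: F_def)
    ultimately show "diff F 0 ` free_mod F 1 = {f \<in> free_mod F 0. aug F f = 0}"
      using S(2)[of "Suc 0"] S(4)[of 0] by (auto simp: aug)
    show "diff F (Suc i) ` free_mod F (Suc (Suc i)) = {f \<in> free_mod F (Suc i). diff F i f = 0}" for i
      using S(2)[of "Suc (Suc i)"] S(4)[of "Suc i"] by (simp add: diffF)
  qed
  then show ?thesis by blast
qed

section \<open>Multigraded Betti numbers of monomial ideals\<close>

text \<open>
  The exponents of the monomials of a monomial ideal are closed under adding exponents.
\<close>

definition up_closed :: "('v \<Rightarrow>\<^sub>0 nat) set \<Rightarrow> bool" where
  "up_closed U \<longleftrightarrow> (\<forall>s\<in>U. \<forall>t. s + t \<in> U)"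

text \<open>The ideal spanned over \<open>k\<close> by the monomials with exponent in \<open>U\<close>.\<close>

definition exp_ideal :: "('v \<Rightarrow>\<^sub>0 nat) set \<Rightarrow> ('v, 'k::field) mpoly set" where
  "exp_ideal U = {p. keys p \<subseteq> U}"

lemma exp_ideal_subspace: "up_closed U \<Longrightarrow> module.subspace (*) (exp_ideal U :: ('v, 'k::field) mpoly set)"
proof -
  interpret R: module "(*) :: ('v, 'k) mpoly \<Rightarrow> _" by (rule module_mpoly)
  assume U: "up_closed U"
  show ?thesis unfolding R.subspace_def exp_ideal_def mem_Collect_eq
  proof (intro conjI ballI allI)
    show "keys (x + y) \<subseteq> U" if "x \<in> {p. keys p \<subseteq> U}" "y \<in> {p. keys p \<subseteq> U}" for x y :: "('v, 'k) mpoly"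
      using that Poly_Mapping.keys_add[of x y] by blast
    fix c x :: "('v, 'k) mpoly" assume x: "x \<in> {p. keys p \<subseteq> U}"
    show "keys (c * x) \<subseteq> U"
    proof
      fix t assume "t \<in> keys (c * x)"
      then obtain a b where "t = a + b" "b \<in> keys x" using keys_mult by blast
      then have "b + a \<in> U" "t = b + a" using U x by (auto simp: up_closed_def add.commute[of a b])
      then show "t \<in> U" by simp
    qed
  qed simp
qed

text \<open>The upper Koszul simplicial complex in degree \<open>\<alpha>\<close> of the monomial ideal with exponent set \<open>U\<close>.\<close>

definition upper_koszul :: "('v::finite \<Rightarrow>\<^sub>0 nat) set \<Rightarrow> ('v \<Rightarrow>\<^sub>0 nat) \<Rightarrow> 'v set set" where
  "upper_koszul U \<alpha> = {\<sigma>. ind_le \<sigma> \<alpha> \<and> \<alpha> - ind \<sigma> \<in> U}"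

theorem betti_exp_ideal:
  fixes U :: "('v::finite \<Rightarrow>\<^sub>0 nat) set"
  assumes U: "up_closed U"
  shows "betti i j (exp_ideal U :: ('v, 'k::field) mpoly set) \<noteq> 0 \<longleftrightarrow>
    (\<exists>\<alpha>. int (mdeg \<alpha>) = j \<and> \<not> acyclic_at TYPE('k) i (upper_koszul U \<alpha>))"
proof -
  define I :: "('v, 'k) mpoly set" where "I = exp_ideal U"
  have "graded_ideal I" unfolding graded_ideal_def
    using exp_ideal_subspace[OF U] by (auto simp: I_def exp_ideal_def in_keys_iff subset_iff split: if_splits)
  then have "graded_free_resolution I (SOME F. graded_free_resolution I F)"
    by (rule someI_ex[OF graded_free_resolution_exists])
  then interpret graded_resolution I "SOME F. graded_free_resolution I F" by unfold_locales
  have "Z 0 d = monomial_family ({0} \<times> U) (\<lambda>_. 0) d" for d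
  proof
    show "Z 0 d \<subseteq> monomial_family ({0} \<times> U) (\<lambda>_. 0) d"
      by (auto simp: syz_def monomial_family_def I_def exp_ideal_def homogeneous_def in_keys_iff lookup_single when_def split: if_splits)
    show "monomial_family ({0} \<times> U) (\<lambda>_. 0) d \<subseteq> Z 0 d"
    proof
      fix f :: "nat \<Rightarrow>\<^sub>0 ('v, 'k) mpoly" assume f: "f \<in> monomial_family ({0} \<times> U) (\<lambda>_. 0) d"
      have "f = single 0 (lookup f 0)"
        using f by (intro poly_mapping_eqI) (auto simp: monomial_family_def lookup_single when_def)
      moreover have "lookup f 0 \<in> I" "homogeneous d (lookup f 0)"
        using f by (auto simp: monomial_family_def I_def exp_ideal_def homogeneous_def in_keys_iff)
      ultimately show "f \<in> Z 0 d" by (auto simp: syz_def)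
    qed
  qed
  then have "Z 0 = monomial_family ({0} \<times> U) (\<lambda>_. 0)" by (rule ext)
  then have "betti i j I = 0 \<longleftrightarrow> koszul_exact i j (monomial_family ({0} \<times> U) (\<lambda>_. 0) :: int \<Rightarrow> (nat \<Rightarrow>\<^sub>0 ('v, 'k) mpoly) set)"
    using quotient_dim_eq_0[of i j] by (simp add: betti_def Let_def)
  also have "\<dots> \<longleftrightarrow> (\<forall>\<alpha>. int (mdeg \<alpha>) = j \<longrightarrow> acyclic_at TYPE('k) i (upper_koszul U \<alpha>))"
  proof -
    have "strand_faces ({0} \<times> U) b \<alpha> = (if b = 0 then upper_koszul U \<alpha> else {})" for b \<alpha>
      by (auto simp: strand_faces_def upper_koszul_def)
    moreover have "acyclic_at TYPE('k) i ({} :: 'v set set)" by (rule acyclic_cone) simp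
    ultimately show ?thesis unfolding koszul_exact_monomial_iff by auto
  qed
  finally show ?thesis by (auto simp: I_def)
qed

section \<open>Monomial ideals and their exponent sets\<close>

text \<open>
  The exponents of the multiples of the monomials with exponents in \<open>T\<close>.
\<close>

definition up_closure :: "('v \<Rightarrow>\<^sub>0 nat) set \<Rightarrow> ('v \<Rightarrow>\<^sub>0 nat) set" where
  "up_closure T = {s + t | s t. s \<in> T}"

text \<open>
  Minkowski sums of exponent sets correspond to products of monomial ideals, and the iterated sums
  below to powers. The zeroth power is the whole ring.
\<close>

definition set_sum :: "('v \<Rightarrow>\<^sub>0 nat) set \<Rightarrow> ('v \<Rightarrow>\<^sub>0 nat) set \<Rightarrow> ('v \<Rightarrow>\<^sub>0 nat) set" where
  "set_sum U V = {u + v | u v. u \<in> U \<and> v \<in> V}"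

primrec set_mult :: "('v \<Rightarrow>\<^sub>0 nat) set \<Rightarrow> nat \<Rightarrow> ('v \<Rightarrow>\<^sub>0 nat) set" where
  "set_mult U 0 = UNIV"
| "set_mult U (Suc h) = set_sum U (set_mult U h)"

lemma up_closedD: "up_closed U \<Longrightarrow> s \<in> U \<Longrightarrow> s + t \<in> U"
  by (simp add: up_closed_def)

lemma up_closed_up_closure: "up_closed (up_closure T)"
  unfolding up_closed_def up_closure_def by clarsimp (metis add.assoc)

lemma up_closed_set_sum: "up_closed V \<Longrightarrow> up_closed (set_sum U V)"
  unfolding up_closed_def set_sum_def by clarsimp (metis add.assoc)

lemma up_closed_set_mult: "up_closed (set_mult U h)"
proof (induction h)
  case 0 show ?case by (simp add: up_closed_def)
qed (simp add: up_closed_set_sum)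

lemma single_in_exp_ideal [simp]: "single t (1::'k::field) \<in> exp_ideal U \<longleftrightarrow> t \<in> U"
  by (simp add: exp_ideal_def)

lemma exp_ideal_inject: "(exp_ideal U :: ('v, 'k::field) mpoly set) = exp_ideal V \<longleftrightarrow> U = V"
proof
  assume "(exp_ideal U :: ('v, 'k) mpoly set) = exp_ideal V"
  then show "U = V" by (metis single_in_exp_ideal subsetI subset_antisym)
qed simp

lemma ideal_eqI:
  assumes "up_closed U" "A \<subseteq> exp_ideal U"
    and "\<And>t c. t \<in> U \<Longrightarrow> single t c \<in> ideal A"
  shows "ideal A = (exp_ideal U :: ('v, 'k::field) mpoly set)"
proof
  interpret R: module "(*) :: ('v, 'k) mpoly \<Rightarrow> _" by (rule module_mpoly)
  show "ideal A \<subseteq> exp_ideal U"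
    unfolding ideal_def using assms(2) exp_ideal_subspace[OF assms(1)] by (rule R.span_minimal)
  show "exp_ideal U \<subseteq> ideal A"
  proof
    fix p :: "('v, 'k) mpoly" assume "p \<in> exp_ideal U"
    then have "single t (lookup p t) \<in> ideal A" if "t \<in> keys p" for t
      using that assms(3) by (auto simp: exp_ideal_def)
    then have "(\<Sum>t\<in>keys p. single t (lookup p t)) \<in> ideal A"
      unfolding ideal_def by (rule R.span_sum)
    then show "p \<in> ideal A" by (simp add: sum_single)
  qed
qed

lemma ideal_multI: "a \<in> A \<Longrightarrow> b * a \<in> ideal A"
  unfolding ideal_def by (intro module.span_scale[OF module_mpoly] module.span_base[OF module_mpoly])

lemma ideal_monom: "ideal (monom ` T) = (exp_ideal (up_closure T) :: ('v, 'k::field) mpoly set)"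
proof (rule ideal_eqI[OF up_closed_up_closure])
  show "monom ` T \<subseteq> (exp_ideal (up_closure T) :: ('v, 'k) mpoly set)"
    by (auto simp: monom_def up_closure_def) (metis add_0_right)
  fix t and c :: 'k assume "t \<in> up_closure T"
  then obtain s r where t: "t = s + r" "s \<in> T" by (auto simp: up_closure_def)
  have "single t c = single r c * monom s" by (simp add: t monom_def mult_single add.commute)
  then show "single t c \<in> ideal (monom ` T)" using t(2) by (simp add: ideal_multI)
qed

lemma exp_ideal_add:
  "ideal_add (exp_ideal U) (exp_ideal V) = (exp_ideal (U \<union> V) :: ('v, 'k::field) mpoly set)"
proof
  show "ideal_add (exp_ideal U) (exp_ideal V) \<subseteq> (exp_ideal (U \<union> V) :: ('v, 'k) mpoly set)"
  proof
    fix p :: "('v, 'k) mpoly" assume "p \<in> ideal_add (exp_ideal U) (exp_ideal V)"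
    then obtain a b where "p = a + b" "keys a \<subseteq> U" "keys b \<subseteq> V" by (auto simp: ideal_add_def exp_ideal_def)
    then show "p \<in> exp_ideal (U \<union> V)" using Poly_Mapping.keys_add[of a b] by (auto simp: exp_ideal_def)
  qed
  show "(exp_ideal (U \<union> V) :: ('v, 'k) mpoly set) \<subseteq> ideal_add (exp_ideal U) (exp_ideal V)"
  proof
    fix p :: "('v, 'k) mpoly" assume p: "p \<in> exp_ideal (U \<union> V)"
    define a where "a = Poly_Mapping.mapp (\<lambda>t c. if t \<in> U then c else 0) p"
    define b where "b = Poly_Mapping.mapp (\<lambda>t c. if t \<in> U then 0 else c) p"
    have la: "lookup a t = (if t \<in> U then lookup p t else 0)" and lb: "lookup b t = (if t \<in> U then 0 else lookup p t)" for t
      by (auto simp: a_def b_def lookup_mapp when_def in_keys_iff)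
    have "p = a + b" by (intro poly_mapping_eqI) (simp add: la lb lookup_add)
    moreover have "a \<in> exp_ideal U" "b \<in> exp_ideal V"
      using p by (auto simp: exp_ideal_def in_keys_iff la lb subset_iff split: if_splits)
    ultimately show "p \<in> ideal_add (exp_ideal U) (exp_ideal V)" by (auto simp: ideal_add_def)
  qed
qed

lemma exp_ideal_mult:
  assumes "up_closed V"
  shows "ideal_mult (exp_ideal U) (exp_ideal V) = (exp_ideal (set_sum U V) :: ('v, 'k::field) mpoly set)"
  unfolding ideal_mult_def
proof (rule ideal_eqI[OF up_closed_set_sum[OF assms]])
  show "{a * b |a b. a \<in> exp_ideal U \<and> b \<in> exp_ideal V} \<subseteq> (exp_ideal (set_sum U V) :: ('v, 'k) mpoly set)"
  proof safe
    fix a b :: "('v, 'k) mpoly" assume "a \<in> exp_ideal U" "b \<in> exp_ideal V"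
    then show "a * b \<in> exp_ideal (set_sum U V)"
      using keys_mult[of a b] by (force simp: exp_ideal_def set_sum_def)
  qed
  fix t and c :: 'k assume "t \<in> set_sum U V"
  then obtain u v where t: "t = u + v" "u \<in> U" "v \<in> V" by (auto simp: set_sum_def)
  have "single u 1 * single v 1 \<in> {a * b |a b. a \<in> (exp_ideal U :: ('v, 'k) mpoly set) \<and> b \<in> exp_ideal V}"
    using t single_in_exp_ideal by blast
  then have "single 0 c * (single u 1 * single v 1) \<in> ideal {a * b |a b. a \<in> (exp_ideal U :: ('v, 'k) mpoly set) \<and> b \<in> exp_ideal V}"
    by (rule ideal_multI)
  then show "single t c \<in> ideal {a * b |a b. a \<in> (exp_ideal U :: ('v, 'k) mpoly set) \<and> b \<in> exp_ideal V}"
    by (simp add: mult_single t)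
qed

lemma exp_ideal_power: "ideal_power (exp_ideal U) h = (exp_ideal (set_mult U h) :: ('v, 'k::field) mpoly set)"
proof (induction h)
  case 0 show ?case by (simp add: exp_ideal_def)
next
  case (Suc h) then show ?case by (simp add: exp_ideal_mult up_closed_set_mult)
qed

lemma ideal_var_power: "ideal {var y ^ c} = (exp_ideal {t. c \<le> lookup t y} :: ('v, 'k::field) mpoly set)"
proof -
  have "(var y ^ c :: ('v, 'k) mpoly) = monom (single y c)"
    by (induction c) (simp_all add: var_def monom_def mult_single flip: single_add)
  then have "ideal {var y ^ c} = (exp_ideal (up_closure {single y c}) :: ('v, 'k) mpoly set)"
    using ideal_monom[of "{single y c}"] by simp
  moreover have "up_closure {single y c} = {t. c \<le> lookup t y}"
  proof safe
    fix t assume "t \<in> up_closure {single y c}"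
    then show "c \<le> lookup t y" by (auto simp: up_closure_def lookup_add)
  next
    fix t assume "c \<le> lookup t y"
    then have "t = single y c + (t - single y c)"
      by (intro poly_mapping_eqI) (auto simp: lookup_add lookup_minus lookup_single when_def)
    then show "t \<in> up_closure {single y c}" by (auto simp: up_closure_def)
  qed
  ultimately show ?thesis by simp
qed

section \<open>Minimal generators\<close>

text \<open>
  The exponents of the minimal generators: the minimal elements of \<open>U\<close> for divisibility.
\<close>

definition min_exps :: "('v::finite \<Rightarrow>\<^sub>0 nat) set \<Rightarrow> ('v \<Rightarrow>\<^sub>0 nat) set" where
  "min_exps U = {s \<in> U. \<forall>t\<in>U. \<forall>r. s = t + r \<longrightarrow> r = 0}"

lemma up_closure_min_exps: "up_closed U \<Longrightarrow> up_closure (min_exps U) = U"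
proof
  assume U: "up_closed U"
  show "up_closure (min_exps U) \<subseteq> U" using U by (auto simp: up_closure_def min_exps_def up_closed_def)
  show "U \<subseteq> up_closure (min_exps U)"
  proof
    fix s assume "s \<in> U"
    then show "s \<in> up_closure (min_exps U)"
    proof (induction "mdeg s" arbitrary: s rule: less_induct)
      case less
      show ?case
      proof (cases "s \<in> min_exps U")
        case True
        then show ?thesis unfolding up_closure_def by (metis (mono_tags, lifting) add_0_right mem_Collect_eq)
      next
        case False
        then obtain t r where t: "t \<in> U" "s = t + r" "r \<noteq> 0" using less.prems by (auto simp: min_exps_def)
        then have "mdeg t < mdeg s" using mdeg_eq_0[of r] by (simp del: mdeg_eq_0)
        then have "t \<in> up_closure (min_exps U)" using less.hyps t(1) by blast
        then show ?thesis using up_closedD[OF up_closed_up_closure] t(2) by blast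
      qed
    qed
  qed
qed

text \<open>
  Every generating set contains the minimal exponents, hence these are the only minimal generating
  set.
\<close>

lemma min_exps_subset: "up_closure T = U \<Longrightarrow> min_exps U \<subseteq> T"
proof
  fix s assume T: "up_closure T = U" and s: "s \<in> min_exps U"
  then obtain t r where t: "s = t + r" "t \<in> T" by (auto simp: min_exps_def up_closure_def)
  then have "t \<in> U" using T unfolding up_closure_def by (metis (mono_tags, lifting) add_0_right mem_Collect_eq)
  then have "r = 0" using s t(1) by (auto simp: min_exps_def)
  then show "s \<in> T" using t by simp
qed

lemma min_gens_exp_ideal:
  assumes "up_closed U"
  shows "min_gens (exp_ideal U :: ('v::finite, 'k::field) mpoly set) = min_exps U"
  unfolding min_gens_def ideal_monom exp_ideal_inject
proof (rule the_equality)
  show "up_closure (min_exps U) = U \<and> (\<forall>S. S \<subset> min_exps U \<longrightarrow> up_closure S \<noteq> U)"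
    using up_closure_min_exps[OF assms] min_exps_subset by blast
  show "T = min_exps U" if "up_closure T = U \<and> (\<forall>S. S \<subset> T \<longrightarrow> up_closure S \<noteq> U)" for T
    using that up_closure_min_exps[OF assms] min_exps_subset[of T U] by blast
qed

lemma change_field_exp_ideal:
  "up_closed U \<Longrightarrow> change_field (exp_ideal U :: ('v::finite, 'k::field) mpoly set) = (exp_ideal U :: ('v, 'l::field) mpoly set)"
  by (simp add: change_field_def min_gens_exp_ideal ideal_monom up_closure_min_exps)

text \<open>
  The key step of Dickson's lemma: a sequence of exponents has a subsequence that is nondecreasing in
  all given variables.
\<close>

lemma monotone_subsequence:
  fixes f :: "nat \<Rightarrow> ('v \<Rightarrow>\<^sub>0 nat)"
  assumes "finite V"
  shows "\<exists>g :: nat \<Rightarrow> nat. strict_mono g \<and> (\<forall>v\<in>V. \<forall>i j. i \<le> j \<longrightarrow> lookup (f (g i)) v \<le> lookup (f (g j)) v)"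
  using assms
proof (induction V rule: finite_induct)
  case empty
  show ?case by (intro exI[of _ id]) (simp add: strict_mono_def)
next
  case (insert v V)
  then obtain g :: "nat \<Rightarrow> nat" where g: "strict_mono g" "\<forall>v\<in>V. \<forall>i j. i \<le> j \<longrightarrow> lookup (f (g i)) v \<le> lookup (f (g j)) v" by blast
  obtain k :: "nat \<Rightarrow> nat" where k: "strict_mono k" "monoseq (\<lambda>n. lookup (f (g (k n))) v)"
    using seq_monosub[of "\<lambda>n. lookup (f (g n)) v"] by blast
  have "\<exists>N. \<forall>i j. i \<le> j \<longrightarrow> lookup (f (g (k (N + i)))) v \<le> lookup (f (g (k (N + j)))) v"
  proof (cases "\<forall>m n. m \<le> n \<longrightarrow> lookup (f (g (k m))) v \<le> lookup (f (g (k n))) v")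
    case True
    then show ?thesis by auto
  next
    case False
    then have dec: "\<And>m n. m \<le> n \<Longrightarrow> lookup (f (g (k n))) v \<le> lookup (f (g (k m))) v"
      using k(2) by (auto simp: monoseq_def)
    \<comment> \<open>A nonincreasing sequence of natural numbers is constant once its minimum is attained.\<close>
    obtain N where "\<And>n. lookup (f (g (k N))) v \<le> lookup (f (g (k n))) v"
      using exists_least_iff[of "\<lambda>x. \<exists>n. x = lookup (f (g (k n))) v"] by (metis not_le)
    then have "\<forall>i j. i \<le> j \<longrightarrow> lookup (f (g (k (N + i)))) v \<le> lookup (f (g (k (N + j)))) v"
      using dec by (meson le_add1 order_trans)
    then show ?thesis by blast
  qed
  then obtain N where N: "\<forall>i j. i \<le> j \<longrightarrow> lookup (f (g (k (N + i)))) v \<le> lookup (f (g (k (N + j)))) v" ..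
  have "strict_mono (\<lambda>i. g (k (N + i)))" using g(1) k(1) by (simp add: strict_mono_def)
  moreover have "k (N + i) \<le> k (N + j)" if "i \<le> j" for i j
    using k(1) that by (simp add: strict_mono_less_eq)
  ultimately show ?case using g(2) N by (intro exI[of _ "\<lambda>i. g (k (N + i))"]) auto
qed

lemma finite_min_exps: "finite (min_exps U)"
proof (rule ccontr)
  assume "infinite (min_exps U)"
  then obtain f :: "nat \<Rightarrow> _" where f: "inj f" "range f \<subseteq> min_exps U" using infinite_countable_subset by blast
  obtain g :: "nat \<Rightarrow> nat" where g: "strict_mono g" "\<forall>v. \<forall>i j. i \<le> j \<longrightarrow> lookup (f (g i)) v \<le> lookup (f (g j)) v"
    using monotone_subsequence[of UNIV f] by auto
  have "f (g 1) = f (g 0) + (f (g 1) - f (g 0))"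
    using g(2)[rule_format, of 0 1] by (intro poly_mapping_eqI) (simp add: lookup_add lookup_minus)
  moreover have "f (g 0) \<in> U" "f (g 1) \<in> min_exps U" using f(2) by (auto simp: min_exps_def)
  ultimately have "f (g 1) - f (g 0) = 0" by (auto simp: min_exps_def)
  then have "f (g 1) = f (g 0)" using \<open>f (g 1) = _\<close> by simp
  then have "g 1 = g 0" using f(1) by (simp add: inj_eq)
  then show False using g(1) by (metis less_irrefl strict_mono_less zero_less_one)
qed

section \<open>Regularity of powers\<close>

text \<open>
  For \<open>U\<close> closed under adding exponents: all minimal generators have \<open>v\<close>-exponent at most \<open>D\<close>. Phrased
  without generators, this passes easily to powers. For \<open>D = 0\<close> it says that \<open>v\<close> does not
  occur in the generators.
\<close>

definition exp_bounded :: "('v \<Rightarrow>\<^sub>0 nat) set \<Rightarrow> nat \<Rightarrow> 'v \<Rightarrow> bool" where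
  "exp_bounded U D v \<longleftrightarrow> (\<forall>t\<in>U. lookup t v > D \<longrightarrow> t - single v 1 \<in> U)"

lemma diff_single_add: "lookup t v > 0 \<Longrightarrow> (t - single v 1) + single v 1 = (t :: 'v \<Rightarrow>\<^sub>0 nat)"
  by (intro poly_mapping_eqI) (auto simp: lookup_add lookup_minus lookup_single when_def)

lemma exp_bounded_min_exps:
  assumes U: "up_closed U" and D: "\<And>t. t \<in> min_exps U \<Longrightarrow> lookup t v \<le> D"
  shows "exp_bounded U D v"
  unfolding exp_bounded_def
proof (intro ballI impI)
  fix t assume "t \<in> U" and gt: "lookup t v > D"
  then have "t \<in> up_closure (min_exps U)" using up_closure_min_exps[OF U] by simp
  then obtain s r where t: "t = s + r" "s \<in> min_exps U" by (auto simp: up_closure_def)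
  with gt have "lookup r v > 0" using D[OF t(2)] by (simp add: lookup_add)
  then have "t - single v 1 = s + (r - single v 1)"
    by (intro poly_mapping_eqI) (auto simp: t(1) lookup_add lookup_minus lookup_single when_def)
  then show "t - single v 1 \<in> U" using up_closedD[OF U] t(2) by (simp add: min_exps_def)
qed

lemma exp_bounded_set_mult:
  assumes "exp_bounded U D v"
  shows "exp_bounded (set_mult U i) (i * D) v"
proof (induction i)
  case 0 show ?case by (simp add: exp_bounded_def)
next
  case (Suc i)
  show ?case unfolding exp_bounded_def
  proof (intro ballI impI)
    fix t assume "t \<in> set_mult U (Suc i)" and gt: "lookup t v > Suc i * D"
    then obtain u w where t: "t = u + w" "u \<in> U" "w \<in> set_mult U i" by (auto simp: set_sum_def)
    show "t - single v 1 \<in> set_mult U (Suc i)"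
    proof (cases "lookup u v > D")
      case True
      then have "u - single v 1 \<in> U" using assms t by (auto simp: exp_bounded_def)
      moreover have "t - single v 1 = (u - single v 1) + w"
        using True by (intro poly_mapping_eqI) (auto simp: t(1) lookup_add lookup_minus lookup_single when_def)
      ultimately show ?thesis using t by (auto simp: set_sum_def)
    next
      case False
      then have w: "lookup w v > i * D" using gt by (simp add: t(1) lookup_add)
      then have "w - single v 1 \<in> set_mult U i" using Suc t by (auto simp: exp_bounded_def)
      moreover have "t - single v 1 = u + (w - single v 1)"
        using w by (intro poly_mapping_eqI) (auto simp: t(1) lookup_add lookup_minus lookup_single when_def)
      ultimately show ?thesis using t by (auto simp: set_sum_def)
    qed
  qed
qed

lemma independent_shift:
  assumes U: "up_closed U" and y: "exp_bounded U 0 y"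
  shows "t + single y n \<in> U \<longleftrightarrow> t \<in> U"
proof
  show "t + single y n \<in> U \<Longrightarrow> t \<in> U"
  proof (induction n)
    case (Suc n)
    have "t + single y (Suc n) - single y 1 = t + single y n"
      by (intro poly_mapping_eqI) (auto simp: lookup_add lookup_minus lookup_single when_def)
    moreover have "t + single y (Suc n) - single y 1 \<in> U"
      using Suc.prems y by (auto simp: exp_bounded_def lookup_add)
    ultimately show ?case using Suc.IH by simp
  qed simp
qed (rule up_closedD[OF U])

lemma set_mult_Suc_subset: "set_mult U (Suc i) \<subseteq> set_mult U i"
  using up_closed_set_mult[of U i] by (auto simp: set_sum_def up_closed_def add.commute) (metis add.commute)

lemma set_mult_antimono: "i \<le> j \<Longrightarrow> set_mult U j \<subseteq> set_mult U i"
  by (induction j rule: dec_induct) (use set_mult_Suc_subset in auto)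

text \<open>The exponents of \<open>(I + (y\<^sup>c))\<^sup>h = \<Sum>\<^sub>i I\<^sup>i y\<^bsup>c(h-i)\<^esup>\<close>.\<close>

lemma set_mult_Un_iff:
  assumes U: "up_closed U" and y: "exp_bounded U 0 y"
  shows "t \<in> set_mult (U \<union> {t. c \<le> lookup t y}) h \<longleftrightarrow> (\<exists>i\<le>h. c * (h - i) \<le> lookup t y \<and> t \<in> set_mult U i)"
proof (induction h arbitrary: t)
  case 0 show ?case by simp
next
  case (Suc h)
  let ?W = "set_mult (U \<union> {t. c \<le> lookup t y})"
  show ?case
  proof
    assume "t \<in> ?W (Suc h)"
    then obtain u w where t: "t = u + w" "u \<in> U \<or> c \<le> lookup u y" "w \<in> ?W h" by (auto simp: set_sum_def)
    then obtain i where i: "i \<le> h" "c * (h - i) \<le> lookup w y" "w \<in> set_mult U i" using Suc by blast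
    show "\<exists>i\<le>Suc h. c * (Suc h - i) \<le> lookup t y \<and> t \<in> set_mult U i"
    proof (cases "u \<in> U")
      case True
      then have "t \<in> set_mult U (Suc i)" using t i by (auto simp: set_sum_def)
      then show ?thesis using i t by (intro exI[of _ "Suc i"]) (auto simp: lookup_add)
    next
      case False
      then have "c * (Suc h - i) \<le> lookup t y" using t i by (simp add: lookup_add Suc_diff_le)
      moreover have "t \<in> set_mult U i" using up_closedD[OF up_closed_set_mult i(3), of u] t(1) by (simp add: add.commute)
      ultimately show ?thesis using i by (intro exI[of _ i]) auto
    qed
  next
    assume "\<exists>i\<le>Suc h. c * (Suc h - i) \<le> lookup t y \<and> t \<in> set_mult U i"
    then obtain i where i: "i \<le> Suc h" "c * (Suc h - i) \<le> lookup t y" "t \<in> set_mult U i" by blast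
    show "t \<in> ?W (Suc h)"
    proof (cases i)
      case 0
      then have c: "c \<le> lookup t y" "c * h \<le> lookup t y - c" using i by simp_all
      have "t = single y c + (t - single y c)"
        using c(1) by (intro poly_mapping_eqI) (auto simp: lookup_add lookup_minus lookup_single when_def)
      moreover have "t - single y c \<in> ?W h"
        unfolding Suc.IH using c(2) by (intro exI[of _ 0]) (simp add: lookup_minus)
      ultimately show ?thesis by (force simp: set_sum_def)
    next
      case (Suc j)
      then obtain u w where t: "t = u + w" "u \<in> U" "w \<in> set_mult U j" using i by (auto simp: set_sum_def)
      \<comment> \<open>Move the whole \<open>y\<close>-exponent to the second summand.\<close>
      define u' where "u' = u - single y (lookup u y)"
      define w' where "w' = w + single y (lookup u y)"
      have u: "u = u' + single y (lookup u y)"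
        by (intro poly_mapping_eqI) (auto simp: u'_def lookup_add lookup_minus lookup_single when_def)
      then have "u' \<in> U" using t(2) independent_shift[OF U y] by metis
      moreover have "w' \<in> set_mult U j" unfolding w'_def by (rule up_closedD[OF up_closed_set_mult t(3)])
      moreover have tt: "t = u' + w'" unfolding t(1) w'_def by (subst u) (simp only: ac_simps)
      moreover have "lookup w' y = lookup t y" by (simp add: tt lookup_add u'_def lookup_minus)
      ultimately show ?thesis using i(1,2) Suc unfolding set_mult.simps set_sum_def Suc.IH mem_Collect_eq
        by (intro exI[of _ u'] exI[of _ w']) (use Suc.IH in auto)
    qed
  qed
qed

text \<open>
  The powers of \<open>I\<close> decrease, so that only the smallest possible \<open>i\<close> matters. Truncated subtraction
  gives \<open>i = 0\<close> as soon as \<open>t\<^sub>y \<ge> c h\<close>.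
\<close>

lemma set_mult_Un_iff_div:
  assumes U: "up_closed U" and y: "exp_bounded U 0 y" and c: "c > 0"
  shows "t \<in> set_mult (U \<union> {t. c \<le> lookup t y}) h \<longleftrightarrow> t \<in> set_mult U (h - lookup t y div c)"
proof
  assume "t \<in> set_mult (U \<union> {t. c \<le> lookup t y}) h"
  then obtain i where i: "i \<le> h" "c * (h - i) \<le> lookup t y" "t \<in> set_mult U i"
    using set_mult_Un_iff[OF U y] by blast
  then have "h - i \<le> lookup t y div c" using c by (simp add: less_eq_div_iff_mult_less_eq mult.commute)
  then have "h - lookup t y div c \<le> i" using i by linarith
  then show "t \<in> set_mult U (h - lookup t y div c)" using set_mult_antimono i(3) by blast
next
  assume t: "t \<in> set_mult U (h - lookup t y div c)"
  have "c * (h - (h - lookup t y div c)) \<le> c * (lookup t y div c)" by (intro mult_left_mono) auto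
  also have "\<dots> \<le> lookup t y" by simp
  finally show "t \<in> set_mult (U \<union> {t. c \<le> lookup t y}) h"
    using t set_mult_Un_iff[OF U y] by (meson diff_le_self)
qed

lemma acyclic_toggle:
  fixes W :: "('v::finite \<Rightarrow>\<^sub>0 nat) set"
  assumes W: "up_closed W" and v: "lookup \<alpha> v > 0"
    and *: "\<And>\<sigma>. v \<notin> \<sigma> \<Longrightarrow> ind_le \<sigma> \<alpha> \<Longrightarrow> \<alpha> - ind \<sigma> \<in> W \<Longrightarrow> \<alpha> - ind \<sigma> - single v 1 \<in> W"
  shows "acyclic_at TYPE('k::field) i (upper_koszul W \<alpha>)"
proof (rule acyclic_cone[of v])
  fix \<sigma> assume "v \<notin> \<sigma>"
  then have 1: "\<alpha> - ind (insert v \<sigma>) = \<alpha> - ind \<sigma> - single v 1" and 2: "lookup (\<alpha> - ind \<sigma>) v > 0"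
    using v by (auto simp: ind_insert diff_diff_eq lookup_minus lookup_ind)
  have "\<alpha> - ind \<sigma> \<in> W" if "\<alpha> - ind \<sigma> - single v 1 \<in> W"
    using up_closedD[OF W that, of "single v 1"] diff_single_add[OF 2] by simp
  then show "\<sigma> \<in> upper_koszul W \<alpha> \<longleftrightarrow> insert v \<sigma> \<in> upper_koszul W \<alpha>"
    using *[OF \<open>v \<notin> \<sigma>\<close>] v unfolding upper_koszul_def mem_Collect_eq ind_le_insert 1 by blast
qed

lemma acyclic_exp_bounded:
  fixes U :: "('v::finite \<Rightarrow>\<^sub>0 nat) set"
  assumes "up_closed U" "exp_bounded U D v" "lookup \<alpha> v > D"
  shows "acyclic_at TYPE('k::field) i (upper_koszul U \<alpha>)"
  using assms by (intro acyclic_toggle[where v = v]) (auto simp: exp_bounded_def lookup_minus lookup_ind)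

text \<open>
  There are no faces of cardinality larger than the number of variables.
\<close>

lemma acyclic_large_dim:
  fixes \<Delta> :: "'v::finite set set"
  assumes "CARD('v) < i"
  shows "acyclic_at TYPE('k::field) i \<Delta>"
  unfolding acyclic_at_def
proof (intro ballI impI)
  fix c :: "'v set \<Rightarrow> 'k" assume c: "c \<in> kchains i \<Delta>"
  have "card \<sigma> \<noteq> i" for \<sigma> :: "'v set" using assms card_mono[of UNIV \<sigma>] by simp
  then have "c = (\<lambda>_. 0)" using c by (auto simp: kchains_def)
  then have "bd (\<lambda>_. 0) = c" by (auto simp: bd_def)
  then show "\<exists>e\<in>kchains (Suc i) \<Delta>. bd e = c" by (intro bexI[of _ "\<lambda>_. 0"]) (auto simp: kchains_def)
qed

text \<open>
  The Betti number in homological degree zero at a minimal generator does not vanish: the complex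
  consists of the empty face only.
\<close>

lemma not_acyclic_min_exps:
  fixes U :: "('v::finite \<Rightarrow>\<^sub>0 nat) set"
  assumes "\<beta> \<in> min_exps U"
  shows "\<not> acyclic_at TYPE('k::field) 0 (upper_koszul U \<beta>)"
proof
  assume ac: "acyclic_at TYPE('k) 0 (upper_koszul U \<beta>)"
  have ind0: "ind {} = (0 :: 'v \<Rightarrow>\<^sub>0 nat)" by (rule poly_mapping_eqI) (simp add: lookup_ind)
  define c :: "'v set \<Rightarrow> 'k" where "c \<sigma> = (if \<sigma> = {} then 1 else 0)" for \<sigma>
  have c: "c \<in> kchains 0 (upper_koszul U \<beta>)"
    using assms by (auto simp: kchains_def c_def upper_koszul_def ind_le_def ind0 min_exps_def)
  obtain e where e: "e \<in> kchains (Suc 0) (upper_koszul U \<beta>)" "bd e = c"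
    using acyclic_atD[OF ac c bd_kchains_0[OF c]] by blast
  have "e \<sigma> = 0" for \<sigma>
  proof (rule ccontr)
    assume "e \<sigma> \<noteq> 0"
    then have \<sigma>: "card \<sigma> = 1" "ind_le \<sigma> \<beta>" "\<beta> - ind \<sigma> \<in> U" using e(1) by (auto simp: kchains_def upper_koszul_def)
    then have "ind \<sigma> = 0" using assms ind_le_diff_add[OF \<sigma>(2)] unfolding min_exps_def by (metis (mono_tags, lifting) mem_Collect_eq)
    then show False using \<sigma>(1) mdeg_ind[of \<sigma>] by simp
  qed
  then have "bd e {} = 0" by (simp add: bd_def)
  then show False using e(2) by (simp add: c_def)
qed

text \<open>The values \<open>|\<alpha>| - i\<close> over all nonvanishing multigraded Betti numbers.\<close>

definition reg_set :: "'k::field itself \<Rightarrow> ('v::finite \<Rightarrow>\<^sub>0 nat) set \<Rightarrow> int set" where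
  "reg_set _ U = {int (mdeg \<alpha>) - int i | i \<alpha>. \<not> acyclic_at TYPE('k) i (upper_koszul U \<alpha>)}"

lemma reg_exp_ideal: "up_closed U \<Longrightarrow> reg (exp_ideal U :: ('v::finite, 'k::field) mpoly set) = Max (reg_set TYPE('k) U)"
  unfolding reg_def reg_set_def betti_exp_ideal by (rule arg_cong[where f = Max]) blast

lemma finite_reg_set:
  fixes U :: "('v::finite \<Rightarrow>\<^sub>0 nat) set"
  assumes "\<And>i \<alpha>. \<not> acyclic_at TYPE('k::field) i (upper_koszul U \<alpha>) \<Longrightarrow> mdeg \<alpha> \<le> M"
  shows "finite (reg_set TYPE('k) U)"
proof (rule finite_subset)
  show "reg_set TYPE('k) U \<subseteq> (\<lambda>(a, i). int a - int i) ` ({..M} \<times> {..CARD('v)})"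
    using assms acyclic_large_dim[where 'k = 'k and 'v = 'v] unfolding reg_set_def by (force simp: not_less[symmetric])
qed simp

lemma mdeg_le: "(\<And>v. lookup \<alpha> v \<le> D) \<Longrightarrow> mdeg \<alpha> \<le> CARD('v) * D" for \<alpha> :: "'v::finite \<Rightarrow>\<^sub>0 nat"
  unfolding mdeg_def using sum_bounded_above[of UNIV "lookup \<alpha>" D] by simp

text \<open>
  The regularity of \<open>(I + (y\<^sup>c))\<^sup>h\<close>. The bound on \<open>c\<close> only has to ensure that the degrees \<open>\<alpha>\<close> with
  \<open>\<alpha>\<^sub>y < c h\<close> satisfy \<open>|\<alpha>| \<le> c h\<close>: with \<open>\<alpha>\<^sub>y = c (q + 1)\<close> and \<open>r = h - (q + 1) \<ge> 1\<close>, the other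
  exponents add up to at most \<open>CARD('v) D (r + 1) \<le> 2 CARD('v) D r\<close>.
\<close>

theorem Max_reg_set_power:
  fixes U :: "('v::finite \<Rightarrow>\<^sub>0 nat) set" and y :: 'v
  assumes U: "up_closed U" and ne: "U \<noteq> {}" and proper: "0 \<notin> U"
    and y: "exp_bounded U 0 y" and D: "\<And>v. exp_bounded U D v"
    and c: "c \<ge> 2 * CARD('v) * D" "c > 0" and h: "h > 0"
  shows "Max (reg_set TYPE('k::field) (set_mult (U \<union> {t. c \<le> lookup t y}) h)) = Max (reg_set TYPE('k) U) + int (c * h) - 1"
proof -
  define W where "W = set_mult (U \<union> {t. c \<le> lookup t y}) h"
  let ?ac = "acyclic_at TYPE('k)"
  have W: "up_closed W" unfolding W_def by (rule up_closed_set_mult)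
  have W_iff: "t \<in> W \<longleftrightarrow> t \<in> set_mult U (h - lookup t y div c)" for t
    unfolding W_def by (rule set_mult_Un_iff_div[OF U y c(2)])
  have Ui_y: "exp_bounded (set_mult U i) 0 y" for i using exp_bounded_set_mult[OF y, of i] by simp
  have Ui_shift: "t + single y n \<in> set_mult U i \<longleftrightarrow> t \<in> set_mult U i" for t n i
    by (rule independent_shift[OF up_closed_set_mult Ui_y])
  have U1: "set_mult U (Suc 0) = U"
    using U by (auto simp: set_sum_def up_closed_def) (metis add_0_right)

  \<comment> \<open>The relevant power of \<open>I\<close> must change when \<open>y\<close> is removed from the monomial, as the complex is a
    cone with apex \<open>y\<close> otherwise.\<close>
  have power_changes: "h - lookup \<alpha> y div c \<noteq> h - (lookup \<alpha> y - 1) div c"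
    if "\<not> ?ac i (upper_koszul W \<alpha>)" "lookup \<alpha> y > 0" for i \<alpha>
  proof
    assume eq: "h - lookup \<alpha> y div c = h - (lookup \<alpha> y - 1) div c"
    have "?ac i (upper_koszul W \<alpha>)"
    proof (rule acyclic_toggle[OF W that(2)])
      fix \<sigma> assume \<sigma>: "y \<notin> \<sigma>" "\<alpha> - ind \<sigma> \<in> W"
      then have ly: "lookup (\<alpha> - ind \<sigma>) y = lookup \<alpha> y" by (simp add: lookup_minus lookup_ind)
      then have "\<alpha> - ind \<sigma> \<in> set_mult U (h - (lookup \<alpha> y - 1) div c)" using \<sigma>(2) eq by (simp add: W_iff)
      then have "\<alpha> - ind \<sigma> - single y 1 \<in> set_mult U (h - (lookup \<alpha> y - 1) div c)"
        using Ui_y that(2) ly by (simp add: exp_bounded_def)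
      then show "\<alpha> - ind \<sigma> - single y 1 \<in> W" using ly by (simp add: W_iff lookup_minus)
    qed
    then show False using that(1) by simp
  qed

  \<comment> \<open>No exponent of another variable exceeds \<open>D\<close> times the larger of the two exponents of \<open>I\<close>
    involved. For \<open>\<alpha>\<^sub>y = 0\<close> the truncated difference \<open>\<alpha>\<^sub>y - 1\<close> gives the exponent \<open>h\<close>, as desired.\<close>
  have bound: "mdeg \<alpha> \<le> lookup \<alpha> y + CARD('v) * (D * (h - (lookup \<alpha> y - 1) div c))"
    if nac: "\<not> ?ac i (upper_koszul W \<alpha>)" for i \<alpha>
  proof -
    define m where "m = h - (lookup \<alpha> y - 1) div c"
    have "lookup \<alpha> v \<le> D * m" if "v \<noteq> y" for v
    proof (rule ccontr)
      assume gt: "\<not> lookup \<alpha> v \<le> D * m"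
      have "?ac i (upper_koszul W \<alpha>)"
      proof (rule acyclic_toggle[OF W])
        show "lookup \<alpha> v > 0" using gt by simp
        fix \<sigma> assume \<sigma>: "v \<notin> \<sigma>" "\<alpha> - ind \<sigma> \<in> W"
        define i0 where "i0 = h - lookup (\<alpha> - ind \<sigma>) y div c"
        have "(lookup \<alpha> y - 1) div c \<le> lookup (\<alpha> - ind \<sigma>) y div c"
          by (intro div_le_mono) (simp add: lookup_minus lookup_ind)
        then have "D * i0 \<le> D * m" unfolding i0_def m_def by (intro mult_left_mono) auto
        moreover have "lookup (\<alpha> - ind \<sigma>) v = lookup \<alpha> v" using \<sigma>(1) by (simp add: lookup_minus lookup_ind)
        ultimately have "lookup (\<alpha> - ind \<sigma>) v > i0 * D" using gt unfolding mult.commute[of i0] by linarith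
        moreover have "\<alpha> - ind \<sigma> \<in> set_mult U i0" using \<sigma>(2) by (simp add: W_iff i0_def)
        ultimately have "\<alpha> - ind \<sigma> - single v 1 \<in> set_mult U i0"
          using exp_bounded_set_mult[OF D[of v], of i0] by (simp add: exp_bounded_def)
        moreover have "lookup (\<alpha> - ind \<sigma> - single v 1) y = lookup (\<alpha> - ind \<sigma>) y"
          using \<open>v \<noteq> y\<close> by (simp add: lookup_minus lookup_single when_def)
        ultimately show "\<alpha> - ind \<sigma> - single v 1 \<in> W" by (simp add: W_iff i0_def)
      qed
      then show False using nac by simp
    qed
    then have "lookup (\<alpha> - single y (lookup \<alpha> y)) v \<le> D * m" for v
      by (cases "v = y") (auto simp: lookup_minus lookup_single when_def)
    then have "mdeg (\<alpha> - single y (lookup \<alpha> y)) \<le> CARD('v) * (D * m)" by (rule mdeg_le)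
    moreover have "\<alpha> = (\<alpha> - single y (lookup \<alpha> y)) + single y (lookup \<alpha> y)"
      by (intro poly_mapping_eqI) (auto simp: lookup_add lookup_minus lookup_single when_def)
    then have "mdeg \<alpha> = mdeg (\<alpha> - single y (lookup \<alpha> y)) + lookup \<alpha> y" by (metis mdeg_simps(2,3))
    ultimately show ?thesis by (simp add: m_def)
  qed

  have degree: "lookup \<alpha> y = c * h \<or> mdeg \<alpha> \<le> c * h" and y_le: "lookup \<alpha> y \<le> c * h"
    if nac: "\<not> ?ac i (upper_koszul W \<alpha>)" for i \<alpha>
  proof -
    define n where "n = CARD('v)"
    have c': "2 * (n * D) \<le> c" using c(1) by (simp add: n_def mult.assoc)
    have "(lookup \<alpha> y = c * h \<or> mdeg \<alpha> \<le> c * h) \<and> lookup \<alpha> y \<le> c * h"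
    proof (cases "lookup \<alpha> y = 0")
      case True
      have "mdeg \<alpha> \<le> n * D * h" using bound[OF nac] by (simp add: True n_def mult.assoc)
      also have "\<dots> \<le> c * h" using c' by (intro mult_right_mono) auto
      finally show ?thesis using True by simp
    next
      case False
      define a where "a = lookup \<alpha> y - 1"
      have a: "lookup \<alpha> y = Suc a" using False by (simp add: a_def)
      have jump: "h - Suc a div c \<noteq> h - a div c" using power_changes[OF nac] False by (simp add: a)
      then have ne: "Suc a div c \<noteq> a div c" by metis
      then have 1: "Suc a mod c = 0" "Suc a div c = Suc (a div c)"
        using div_Suc[of a c] by (auto split: if_splits)
      have lt: "a div c < h"
      proof (rule ccontr)
        assume "\<not> a div c < h"
        then show False using jump 1(2) by simp
      qed
      define q where "q = a div c"
      have Sa: "Suc a = c * Suc q" using 1 by (metis add.right_neutral mult_div_mod_eq q_def)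
      have q: "q < h" using lt by (simp add: q_def)
      have le: "lookup \<alpha> y \<le> c * h" unfolding a Sa using q by (intro mult_left_mono) auto
      show ?thesis
      proof (cases "Suc q = h")
        case True
        then show ?thesis using a Sa by simp
      next
        case False
        define r where "r = h - Suc q"
        have r: "h = Suc q + r" "r \<ge> 1" using q False by (auto simp: r_def)
        have "mdeg \<alpha> \<le> c * Suc q + n * D * Suc r"
          using bound[OF nac] unfolding a Sa[symmetric] n_def by (simp add: q_def[symmetric] r(1) algebra_simps)
        also have "n * D * Suc r \<le> n * D * (2 * r)" using r(2) by (intro mult_left_mono) auto
        also have "\<dots> = 2 * (n * D) * r" by simp
        also have "\<dots> \<le> c * r" using c' by (rule mult_right_mono) simp
        finally show ?thesis using le by (simp add: r(1) algebra_simps)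
      qed
    qed
    then show "lookup \<alpha> y = c * h \<or> mdeg \<alpha> \<le> c * h" "lookup \<alpha> y \<le> c * h" by auto
  qed

  \<comment> \<open>For \<open>\<alpha>\<^sub>y = c h\<close> the faces without \<open>y\<close> are unrestricted, and those with \<open>y\<close> are governed by \<open>I\<close>.\<close>
  have top: "?ac 0 (upper_koszul W (\<beta> + single y (c * h)))"
    "?ac (Suc p) (upper_koszul W (\<beta> + single y (c * h))) \<longleftrightarrow> ?ac p (upper_koszul U \<beta>)"
    if \<beta>: "lookup \<beta> y = 0" "\<beta> \<noteq> 0" for \<beta> p
  proof -
    define \<alpha> where "\<alpha> = \<beta> + single y (c * h)"
    have ch: "c * h > 0" using c h by simp
    have \<alpha>y: "lookup \<alpha> y = c * h" and \<alpha>v: "v \<noteq> y \<Longrightarrow> lookup \<alpha> v = lookup \<beta> v" for v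
      using \<beta> by (auto simp: \<alpha>_def lookup_add lookup_single when_def)
    define \<Phi> where "\<Phi> = {\<sigma>. y \<notin> \<sigma> \<and> ind_le \<sigma> \<alpha>}"
    have ind\<beta>: "ind_le \<sigma> \<beta> \<longleftrightarrow> y \<notin> \<sigma> \<and> ind_le \<sigma> \<alpha>" for \<sigma>
      using \<beta>(1) \<alpha>v unfolding ind_le_def by (metis less_irrefl)
    obtain v where v: "lookup \<beta> v > 0" using \<beta>(2) by (metis gr0I lookup_zero poly_mapping_eqI)
    have "v \<noteq> y" using v \<beta>(1) by auto
    then have ac\<Phi>: "?ac p \<Phi>" for p
      using v \<alpha>v by (intro acyclic_cone[of v]) (auto simp: \<Phi>_def ind_le_insert)
    have \<Gamma>: "upper_koszul U \<beta> \<subseteq> \<Phi>" by (auto simp: upper_koszul_def \<Phi>_def ind\<beta>)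
    have no_y: "\<sigma> \<in> upper_koszul W \<alpha> \<longleftrightarrow> \<sigma> \<in> \<Phi>" if "y \<notin> \<sigma>" for \<sigma>
    proof -
      have "lookup (\<alpha> - ind \<sigma>) y = c * h" using that \<alpha>y by (simp add: lookup_minus lookup_ind)
      then have "\<alpha> - ind \<sigma> \<in> W" using c(2) by (simp add: W_iff)
      then show ?thesis using that by (simp add: upper_koszul_def \<Phi>_def)
    qed
    have with_y: "insert y \<tau> \<in> upper_koszul W \<alpha> \<longleftrightarrow> \<tau> \<in> upper_koszul U \<beta>" if "y \<notin> \<tau>" for \<tau>
    proof -
      have "lookup (\<alpha> - ind (insert y \<tau>)) y = c * h - 1" by (simp add: \<alpha>y lookup_minus lookup_ind)
      moreover have "(c * h - 1) div c = h - 1"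
      proof -
        have "c * h - 1 = c * (h - 1) + (c - 1)" using c(2) h by (cases h) auto
        moreover have "(c * (h - 1) + (c - 1)) div c = h - 1"
          using c(2) by (subst div_mult_self4) auto
        ultimately show ?thesis by simp
      qed
      ultimately have WU: "\<alpha> - ind (insert y \<tau>) \<in> W \<longleftrightarrow> \<alpha> - ind (insert y \<tau>) \<in> U"
        using h U1 by (simp add: W_iff del: set_mult.simps)
      have "\<alpha> - ind (insert y \<tau>) = (\<beta> - ind \<tau>) + single y (c * h - 1)"
        using that \<beta>(1) by (intro poly_mapping_eqI)
          (auto simp: \<alpha>_def lookup_add lookup_minus lookup_ind lookup_single when_def)
      with WU have "\<alpha> - ind (insert y \<tau>) \<in> W \<longleftrightarrow> \<beta> - ind \<tau> \<in> U"
        using independent_shift[OF U y] by simp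
      then show ?thesis using that ch by (auto simp: upper_koszul_def ind\<beta> ind_le_insert \<alpha>y)
    qed
    have "upper_koszul W \<alpha> = \<Phi> \<union> insert y ` upper_koszul U \<beta>"
    proof (rule set_eqI)
      fix \<sigma>
      have y\<Gamma>: "y \<notin> \<tau>" if "\<tau> \<in> upper_koszul U \<beta>" for \<tau> using that \<Gamma> by (auto simp: \<Phi>_def)
      show "\<sigma> \<in> upper_koszul W \<alpha> \<longleftrightarrow> \<sigma> \<in> \<Phi> \<union> insert y ` upper_koszul U \<beta>"
      proof (cases "y \<in> \<sigma>")
        case False
        then show ?thesis using no_y by auto
      next
        case True
        then have \<sigma>: "insert y (\<sigma> - {y}) = \<sigma>" by auto
        have "\<sigma> \<in> insert y ` upper_koszul U \<beta> \<longleftrightarrow> \<sigma> - {y} \<in> upper_koszul U \<beta>"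
        proof
          assume "\<sigma> \<in> insert y ` upper_koszul U \<beta>"
          then obtain \<tau> where \<tau>: "\<tau> \<in> upper_koszul U \<beta>" "\<sigma> = insert y \<tau>" by blast
          then have "\<sigma> - {y} = \<tau>" using y\<Gamma>[OF \<tau>(1)] by auto
          then show "\<sigma> - {y} \<in> upper_koszul U \<beta>" using \<tau>(1) by simp
        next
          assume "\<sigma> - {y} \<in> upper_koszul U \<beta>"
          from imageI[OF this, of "insert y"] show "\<sigma> \<in> insert y ` upper_koszul U \<beta>" unfolding \<sigma> .
        qed
        moreover have "\<sigma> \<in> upper_koszul W \<alpha> \<longleftrightarrow> \<sigma> - {y} \<in> upper_koszul U \<beta>"
          using with_y[of "\<sigma> - {y}"] \<sigma> by simp
        moreover have "\<sigma> \<notin> \<Phi>" using True by (simp add: \<Phi>_def)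
        ultimately show ?thesis by blast
      qed
    qed
    from acyclic_suspension[OF \<Gamma> _ ac\<Phi> this]
    show "?ac 0 (upper_koszul W (\<beta> + single y (c * h)))"
      "?ac (Suc p) (upper_koszul W (\<beta> + single y (c * h))) \<longleftrightarrow> ?ac p (upper_koszul U \<beta>)"
      unfolding \<alpha>_def[symmetric] by (auto simp: \<Phi>_def)
  qed

  have U_y: "lookup \<alpha> y = 0" if "\<not> ?ac i (upper_koszul U \<alpha>)" for i \<alpha>
    using that acyclic_exp_bounded[OF U y, of \<alpha>, where 'k = 'k] by blast
  have U_le: "mdeg \<alpha> \<le> CARD('v) * D" if "\<not> ?ac i (upper_koszul U \<alpha>)" for i \<alpha>
    using that acyclic_exp_bounded[OF U D, where \<alpha> = \<alpha> and 'k = 'k] by (intro mdeg_le) (meson not_le)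
  have finU: "finite (reg_set TYPE('k) U)" using U_le by (rule finite_reg_set)
  have "mdeg \<alpha> \<le> c * h + CARD('v) * (D * h)" if nac: "\<not> ?ac i (upper_koszul W \<alpha>)" for i \<alpha>
  proof -
    have "CARD('v) * (D * (h - (lookup \<alpha> y - 1) div c)) \<le> CARD('v) * (D * h)" by (intro mult_left_mono) auto
    then show ?thesis using bound[OF nac] y_le[OF nac] by linarith
  qed
  then have finW: "finite (reg_set TYPE('k) W)" by (rule finite_reg_set)

  define r where "r = Max (reg_set TYPE('k) U)"
  obtain \<beta> where \<beta>: "\<beta> \<in> min_exps U"
    using ne up_closure_min_exps[OF U] by (auto simp: up_closure_def)
  then have "\<beta> \<noteq> 0" using proper by (auto simp: min_exps_def)
  then have "mdeg \<beta> \<ge> 1" using mdeg_eq_0[of \<beta>] by (simp add: Suc_le_eq del: mdeg_eq_0)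
  moreover have mem: "int (mdeg \<beta>) \<in> reg_set TYPE('k) U"
    using not_acyclic_min_exps[OF \<beta>, where 'k = 'k] unfolding reg_set_def by force
  ultimately have r1: "r \<ge> 1" using Max_ge[OF finU mem] by (simp add: r_def)
  have "r \<in> reg_set TYPE('k) U" unfolding r_def using finU mem by (intro Max_in) auto
  then obtain i \<alpha> where i: "r = int (mdeg \<alpha>) - int i" "\<not> ?ac i (upper_koszul U \<alpha>)"
    by (auto simp: reg_set_def)
  have "\<alpha> \<noteq> 0" using r1 i(1) by auto
  then have "\<not> ?ac (Suc i) (upper_koszul W (\<alpha> + single y (c * h)))" using top(2) U_y i(2) by blast
  then have "int (mdeg (\<alpha> + single y (c * h))) - int (Suc i) \<in> reg_set TYPE('k) W" unfolding reg_set_def by blast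
  moreover have "int (mdeg (\<alpha> + single y (c * h))) - int (Suc i) = r + int (c * h) - 1" using i(1) by simp
  ultimately have "r + int (c * h) - 1 \<in> reg_set TYPE('k) W" by metis
  moreover have "s \<le> r + int (c * h) - 1" if s: "s \<in> reg_set TYPE('k) W" for s
  proof -
    obtain i \<alpha> where \<alpha>: "s = int (mdeg \<alpha>) - int i" "\<not> ?ac i (upper_koszul W \<alpha>)"
      using s by (auto simp: reg_set_def)
    show ?thesis
    proof (cases "mdeg \<alpha> \<le> c * h")
      case True
      then show ?thesis using r1 \<alpha>(1) by (simp flip: of_nat_mult)
    next
      case False
      then have ay: "lookup \<alpha> y = c * h" using degree[OF \<alpha>(2)] by simp
      define \<beta> where "\<beta> = \<alpha> - single y (c * h)"
      have ab: "\<alpha> = \<beta> + single y (c * h)"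
        using ay by (intro poly_mapping_eqI) (auto simp: \<beta>_def lookup_add lookup_minus lookup_single when_def)
      have \<beta>: "lookup \<beta> y = 0" "\<beta> \<noteq> 0" using ay False by (auto simp: \<beta>_def lookup_minus) (simp add: ab \<beta>_def[symmetric])
      obtain p where p: "i = Suc p" using top(1)[OF \<beta>] \<alpha>(2) ab by (cases i) auto
      have "\<not> ?ac p (upper_koszul U \<beta>)" using top(2)[OF \<beta>] \<alpha>(2) ab p by simp
      then have "int (mdeg \<beta>) - int p \<in> reg_set TYPE('k) U" unfolding reg_set_def by blast
      then have "int (mdeg \<beta>) - int p \<le> r" unfolding r_def by (rule Max_ge[OF finU])
      then show ?thesis using \<alpha>(1) by (simp add: ab p)
    qed
  qed
  ultimately have "Max (reg_set TYPE('k) W) = r + int (c * h) - 1" using finW by (intro Max_eqI)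
  then show ?thesis by (simp add: W_def r_def)
qed

lemma reg_set_UNIV: "reg_set TYPE('k::field) (UNIV :: ('v::finite \<Rightarrow>\<^sub>0 nat) set) = {0}"
proof -
  have *: "\<not> acyclic_at TYPE('k) i (upper_koszul UNIV \<alpha>) \<longleftrightarrow> \<alpha> = 0 \<and> i = 0" for i and \<alpha> :: "'v \<Rightarrow>\<^sub>0 nat"
  proof
    assume nac: "\<not> acyclic_at TYPE('k) i (upper_koszul UNIV \<alpha>)"
    have "lookup \<alpha> v = 0" for v
      using nac acyclic_exp_bounded[of UNIV 0 v \<alpha>] by (auto simp: up_closed_def exp_bounded_def)
    then have \<alpha>: "\<alpha> = 0" by (intro poly_mapping_eqI) simp
    have "i = 0"
    proof (rule ccontr)
      assume "i \<noteq> 0"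
      have "acyclic_at TYPE('k) i (upper_koszul UNIV \<alpha>)" unfolding acyclic_at_def
      proof (intro ballI impI)
        fix c :: "'v set \<Rightarrow> 'k" assume c: "c \<in> kchains i (upper_koszul UNIV \<alpha>)"
        have "c \<sigma> = 0" for \<sigma> using c \<open>i \<noteq> 0\<close>
          by (cases "\<sigma> = {}") (auto simp: kchains_def upper_koszul_def \<alpha> ind_le_def)
        then have "bd (\<lambda>_. 0) = c" by (auto simp: bd_def)
        then show "\<exists>e\<in>kchains (Suc i) (upper_koszul UNIV \<alpha>). bd e = c"
          by (intro bexI[of _ "\<lambda>_. 0"]) (auto simp: kchains_def)
      qed
      then show False using nac by simp
    qed
    then show "\<alpha> = 0 \<and> i = 0" using \<alpha> by simp
  next
    assume *: "\<alpha> = 0 \<and> i = 0"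
    have "(0 :: 'v \<Rightarrow>\<^sub>0 nat) \<in> min_exps UNIV" by (auto simp: min_exps_def) (metis add_eq_0_iff_both_eq_0 mdeg_eq_0 mdeg_simps(1,2))
    then show "\<not> acyclic_at TYPE('k) i (upper_koszul UNIV \<alpha>)" using * not_acyclic_min_exps by blast
  qed
  show ?thesis unfolding reg_set_def * by auto
qed

theorem proposition3p5:
  fixes n :: nat and x :: "nat \<Rightarrow> 'v::finite" and y :: 'v
    and I :: "('v, 'k::field) mpoly set"
  assumes vars: "bij_betw x {1..n} (UNIV - {y})"
    and "monomial_ideal I" and "I \<noteq> {0}"
    and gens: "\<forall>t\<in>min_gens I. Poly_Mapping.keys t \<subseteq> x ` {1..n}"
    and "reg I \<noteq> reg (change_field I :: ('v, 'l::field) mpoly set)"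
  shows "\<exists>c::nat. \<exists>h0::nat. \<forall>h\<ge>h0.
           reg (ideal_power (ideal_add I (ideal {var y ^ c})) h) \<noteq>
           reg (change_field (ideal_power (ideal_add I (ideal {var y ^ c})) h)
                  :: ('v, 'l) mpoly set)"
proof -
  obtain T where "I = ideal (monom ` T)" using \<open>monomial_ideal I\<close> by (auto simp: monomial_ideal_def)
  define U where "U = up_closure T"
  have U: "up_closed U" and I: "I = exp_ideal U"
    using \<open>I = _\<close> by (simp_all add: U_def up_closed_up_closure ideal_monom)
  have reg_neq: "Max (reg_set TYPE('k) U) \<noteq> Max (reg_set TYPE('l) U)"
    using \<open>reg I \<noteq> _\<close> U by (simp add: I change_field_exp_ideal reg_exp_ideal)
  have "U \<noteq> {}"
  proof
    assume "U = {}"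
    then have "I = {0}" by (auto simp: I exp_ideal_def)
    then show False using \<open>I \<noteq> {0}\<close> by simp
  qed
  have "0 \<notin> U"
  proof
    assume "0 \<in> U"
    then have "U = UNIV" using up_closedD[OF U, of 0] by auto
    then show False using reg_neq by (simp add: reg_set_UNIV)
  qed
  have "exp_bounded U 0 y"
  proof (rule exp_bounded_min_exps[OF U])
    fix t assume "t \<in> min_exps U"
    then have "keys t \<subseteq> UNIV - {y}"
      using gens vars by (auto simp: I min_gens_exp_ideal[OF U] bij_betw_def)
    then show "lookup t y \<le> 0" by (auto simp: in_keys_iff)
  qed
  define D where "D = (\<Sum>t\<in>min_exps U. mdeg t)"
  have D: "exp_bounded U D v" for v
  proof (rule exp_bounded_min_exps[OF U])
    fix t assume t: "t \<in> min_exps U"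
    have "lookup t v \<le> mdeg t" unfolding mdeg_def by (rule member_le_sum) auto
    also have "\<dots> \<le> D" unfolding D_def by (rule member_le_sum[OF t _ finite_min_exps]) simp
    finally show "lookup t v \<le> D" .
  qed
  define c where "c = 2 * CARD('v) * D + 1"
  have "reg (ideal_power (ideal_add I (ideal {var y ^ c})) h) \<noteq>
      reg (change_field (ideal_power (ideal_add I (ideal {var y ^ c})) h) :: ('v, 'l) mpoly set)"
    if "h \<ge> 1" for h
  proof -
    define W where "W = set_mult (U \<union> {t. c \<le> lookup t y}) h"
    have W: "up_closed W" unfolding W_def by (rule up_closed_set_mult)
    have "ideal_power (ideal_add I (ideal {var y ^ c})) h = exp_ideal W"
      by (simp add: I ideal_var_power exp_ideal_add exp_ideal_power W_def)
    moreover have "Max (reg_set TYPE('k) W) = Max (reg_set TYPE('k) U) + int (c * h) - 1"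
      and "Max (reg_set TYPE('l) W) = Max (reg_set TYPE('l) U) + int (c * h) - 1"
      unfolding W_def using U \<open>U \<noteq> {}\<close> \<open>0 \<notin> U\<close> \<open>exp_bounded U 0 y\<close> D that
      by (intro Max_reg_set_power[where D = D]; simp add: c_def)+
    ultimately show ?thesis using reg_neq W by (simp add: change_field_exp_ideal reg_exp_ideal)
  qed
  then show ?thesis by blast
qed

end
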